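(* In the setting of the context, suppose the Standard Case (resp. Singular Case I, Singular Case II) holds, and let $(P^{b,i},\Lambda^{b,i})_{i\in\mathcal M}$ be the unique nonnegative (resp. uniformly positive, nonnegative) solution of the system (B) of BSDEs without jumps described in the context. Define, for $t\in[0,T]$ and $i\in\mathcal M$, $$P^i_t:=P^{b,i}_t\mathbf 1_{t<\tau}+G^{a,i}_\tau\mathbf 1_{t\ge\tau},\qquad \Lambda^i_t:=\Lambda^{b,i}_t\mathbf 1_{t\le\tau},\qquad U^i_t:=(G^{a,i}_t-P^{b,i}_t)\mathbf 1_{t\le\tau}.$$ Then $(P^i,\Lambda^i,U^i)_{i\in\mathcal M}$ is a nonnegative (resp. uniformly positive, positive) solution of the system (J) of BSDEs with jumps: $$\begin{cases}P^i_t=G^i+\int_{t\wedge\tau}^{T\wedge\tau}\Big[(2A^i_s+(C^i_s)'C^i_s)P^i_{s-}+\lambda^{\mathbb G}_s(E^i_s)^2(P^i_{s-}+U^i_s)+2(C^i_s)'\Lambda^i_s+2\lambda^{\mathbb G}_sE^i_sU^i_s+Q^i_s+\sum_{j=1}^\ell q_{ij}P^j_{s-}\\ \qquad-\mathcal N(s,P^i_{s-},\Lambda^i_s,U^i_s,i)'\,\mathcal R(s,P^i_{s-},U^i_s,i)^{-1}\,\mathcal N(s,P^i_{s-},\Lambda^i_s,U^i_s,i)\Big]ds-\int_{t\wedge\tau}^{T\wedge\tau}(\Lambda^i_s)'dW_s-\int_{t\wedge\tau}^{T\wedge\tau}U^i_s\,dM_s,\\ \mathcal R(s,P^i_{s-},U^i_s,i)>0\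 \text{ for } s\le T\wedge\tau\text{ and all } i\in\mathcal M,\end{cases}$$ where $$\mathcal N(s,P,\Lambda,U,i)=P\big((D^i_s)'C^i_s+B^i_s\big)+(D^i_s)'\Lambda+\lambda^{\mathbb G}_sE^i_sF^i_s(P+U)+\lambda^{\mathbb G}_sF^i_sU,$$ $$\mathcal R(s,P,U,i)=R^i_s+P(D^i_s)'D^i_s+\lambda^{\mathbb G}_s(P+U)F^i_s(F^i_s)'.$$
   Context: Setting. $(\Omega,\mathcal H,\mathbb P)$ is a complete probability space carrying a standard $n$-dimensional Brownian motion $W$; $\mathbb F=(\mathcal F_t)_{t\ge0}$ is the filtration generated by $W$ augmented by all $\mathbb P$-null sets. $\tau$ is a random time (not assumed to be an $\mathbb F$-stopping time), and $\mathbb G=(\mathcal G_t)_{t\ge0}$, $\mathcal G_t=\bigcap_{\varepsilon>0}\big(\mathcal F_{t+\varepsilon}\vee\sigma(\mathbf 1_{\tau\le u};0\le u\le t+\varepsilon)\big)$, is the smallest right-continuous extension of $\mathbb F$ making $\tau$ a stopping time. Standing assumptions: every $\mathbb F$-martingale is a $\mathbb G$-martingale; and there is a bounded nonnegative $\mathbb F$-predictable process $\lambda$ such that $M_t:=N_t-\int_0^{t\wedge\tau}\lambda_sds$ is a $\mathbb G$-martingale, where $N_t=\mathbf 1_{\tau\le t}$. Put $\lambda^{\mathbb G}_s:=\lambda_s\mathbf 1_{s\le\tau}$. $T>0$ is a constant; $\int_s^t$ means $\int_{(s,t]}$. $\mathcal M=\{1,\dots,\ell\}$, and $(q_{ij})_{\ell\times\ell}$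 is a real matrix with $q_{ij}\ge0$ for $i\ne j$ and $\sum_{j}q_{ij}=0$ for every $i$ (the generator of a Markov chain). A prime denotes transpose; $\mathbb S^m$ is the set of symmetric real $m\times m$ matrices; $M>0$ ($\ge0$) means positive definite (semidefinite). Coefficients. For each $i\in\mathcal M$, the following are $\mathbb F$-predictable and essentially bounded on $[0,T]\times\Omega$: $A^i,E^i,Q^i$ ($\mathbb R$-valued), $B^i,F^i$ ($\mathbb R^m$-valued), $C^i$ ($\mathbb R^n$-valued), $D^i$ ($\mathbb R^{n\times m}$-valued), $R^i$ ($\mathbb S^m$-valued). Moreover $G^i=G^{b,i}\mathbf 1_{T<\tau}+G^{a,i}_\tau\mathbf 1_{T\ge\tau}$, where $G^{b,i}$ is a bounded $\mathcal F_T$-measurable random variable and $G^{a,i}$ is an $\mathbb F$-predictable essentially bounded real process on $[0,T]$. Cases (inequalities a.s., a.e., for all $i\in\mathcal M$, with some constant $\delta>0$). Standard Case: $Q^i\ge0$, $G^i\ge0$, $R^i\ge\delta I_m$. Singular Case I: $Q^i\ge0$, $R^i\ge0$, $G^i\ge\delta$, $(D^i)'D^i\ge\delta I_m$. Singular Case II: $m=1$, $Q^i\ge0$, $R^i\ge0$, $G^{b,i}\ge0$, $G^{a,i}\ge\delta$, $\lambda(F^i)^2\ge\delta$. System (B) on $[0,T]$: $$\begin{cases}P^{b,i}_t=G^{b,i}+\int_t^T\Big[(2A^i_s+(C^i_s)'C^i_s-2\lambda_sE^i_s-\lambda_s)P^{b,i}_s+2(C^i_s)'\Lambda^{b,i}_s+\lambda_sG^{a,i}_s(E^i_s+1)^2+Q^i_s+\sum_{j=1}^{\ell}q_{ij}P^{b,j}_s\\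 \qquad\quad-\widehat{\mathcal N}(s,P^{b,i}_s,\Lambda^{b,i}_s,i)'\,\widehat{\mathcal R}(s,P^{b,i}_s,i)^{-1}\,\widehat{\mathcal N}(s,P^{b,i}_s,\Lambda^{b,i}_s,i)\Big]ds-\int_t^T(\Lambda^{b,i}_s)'dW_s,\\ \widehat{\mathcal R}(s,P^{b,i}_s,i)>0\ \text{ for } s\le T,\ i\in\mathcal M,\end{cases}$$ with $\widehat{\mathcal N}(s,P,\Lambda,i)=P((D^i_s)'C^i_s+B^i_s-\lambda_sF^i_s)+(D^i_s)'\Lambda+\lambda_sG^{a,i}_s(E^i_s+1)F^i_s$ and $\widehat{\mathcal R}(s,P,i)=R^i_s+P(D^i_s)'D^i_s+\lambda_sG^{a,i}_sF^i_s(F^i_s)'$. A solution of (B) is a family satisfying (B) with each $P^{b,i}$ $\mathbb F$-predictable and essentially bounded and each $\Lambda^{b,i}$ $\mathbb F$-predictable, $\mathbb R^n$-valued, $\mathbb E\int_0^T|\Lambda^{b,i}_t|^2dt<\infty$. It is nonnegative if all $P^{b,i}\ge0$ and uniformly positive if all $P^{b,i}\ge c$ for a deterministic constant $c>0$. It is known that (B) has a unique nonnegative solution in the Standard Case and in Singular Case II, and a unique uniformly positive solution in Singular Case I. Solution of (J). A family $(P^i,\Lambda^i,U^i)_{i\in\mathcal M}$ is a solution of (J) if it satisfies (J) (including the positivity constraint) and for all $i$: $P^i$ is real, càdlàg, $\mathbb G$-adapted and essentially bounded on $[0,T]$; $\Lambda^i$ is $\mathbb G$-predictable, $\mathbb R^n$-valued,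 with $\mathbb E\int_0^T|\Lambda^i_t|^2dt<\infty$; $U^i$ is real, $\mathbb G$-predictable and essentially bounded on $[0,T]$. It is called nonnegative if $P^i_t\ge0$, $t\in[0,T]$, a.s.; uniformly positive if $P^i_t\ge c$, $t\in[0,T]$, a.s.; and positive if $P^i_t\ge0$ and $P^i_{t-}+U^i_t\ge c$, $t\in[0,T]$, a.s. (for all $i$), where $c>0$ is some deterministic constant.
   Formalization: In Singular Case II the bound G^{a,i} ≥ δ is also required at time 0 on {τ=0} (otherwise P_t = G^a_0 could be negative), and in "positive" the bound P_{t-}+U_t ≥ c holds for a.e. (t,ω), since for t ≤ τ it equals G^a_t, which is bounded below only a.e. *)

theory Defs
  imports "HOL-Probability.Probability"
begin

section \<open>Filtrations, martingales, predictability\<close>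

text \<open>Time is of type \<^typ>\<open>real\<close>; only times \<open>t \<ge> 0\<close> are ever used. A random time takes
  values in \<open>[0, \<infinity>]\<close> and is modelled as an \<^typ>\<open>ereal\<close>-valued random variable.\<close>

definition natural_filtration ::
  "'w measure \<Rightarrow> (real \<Rightarrow> 'w \<Rightarrow> 'b::topological_space) \<Rightarrow> real \<Rightarrow> 'w measure" where
  "natural_filtration P X t =
     sigma (space P) {X s -` B \<inter> space P |s B. 0 \<le> s \<and> s \<le> t \<and> B \<in> sets borel}"

definition augmented_filtration ::
  "'w measure \<Rightarrow> (real \<Rightarrow> 'w \<Rightarrow> 'b::topological_space) \<Rightarrow> real \<Rightarrow> 'w measure" where
  "augmented_filtration P X t =
     sigma (space P) (sets (natural_filtration P X t) \<union> null_sets P)"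

definition enlarged_filtration ::
  "'w measure \<Rightarrow> (real \<Rightarrow> 'w measure) \<Rightarrow> ('w \<Rightarrow> ereal) \<Rightarrow> real \<Rightarrow> 'w measure" where
  "enlarged_filtration P \<F> \<tau> t =
     sigma (space P) (\<Inter>\<epsilon>\<in>{0<..}. sigma_sets (space P)
       (sets (\<F> (t + \<epsilon>)) \<union> {{\<omega> \<in> space P. \<tau> \<omega> \<le> ereal u} |u. 0 \<le> u \<and> u \<le> t + \<epsilon>}))"

definition martingale ::
  "'w measure \<Rightarrow> (real \<Rightarrow> 'w measure) \<Rightarrow> (real \<Rightarrow> 'w \<Rightarrow> real) \<Rightarrow> bool" where
  "martingale P \<F> X \<longleftrightarrow>
     (\<forall>t\<ge>0. X t \<in> borel_measurable (\<F> t) \<and> integrable P (X t)) \<and>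
     (\<forall>s t. 0 \<le> s \<and> s \<le> t \<longrightarrow> (AE \<omega> in P. real_cond_exp P (\<F> s) (X t) \<omega> = X s \<omega>))"

definition predictable_algebra :: "'w measure \<Rightarrow> (real \<Rightarrow> 'w measure) \<Rightarrow> (real \<times> 'w) measure" where
  "predictable_algebra P \<F> = sigma ({0..} \<times> space P)
     ({{0} \<times> A |A. A \<in> sets (\<F> 0)} \<union>
      {{s<..t} \<times> A |s t A. 0 \<le> s \<and> s \<le> t \<and> A \<in> sets (\<F> s)})"

text \<open>Predictability of a process indexed by a time interval \<open>J\<close>; values outside \<open>J\<close>
  are irrelevant.\<close>

definition predictable_on ::
  "'w measure \<Rightarrow> (real \<Rightarrow> 'w measure) \<Rightarrow> real set \<Rightarrow> (real \<Rightarrow> 'w \<Rightarrow> 'b::topological_space) \<Rightarrow> bool"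
  where
  "predictable_on P \<F> J X \<longleftrightarrow>
     (\<lambda>(t, \<omega>). X t \<omega>) \<in> borel_measurable (restrict_space (predictable_algebra P \<F>) (J \<times> space P))"

definition adapted_on ::
  "(real \<Rightarrow> 'w measure) \<Rightarrow> real set \<Rightarrow> (real \<Rightarrow> 'w \<Rightarrow> 'b::topological_space) \<Rightarrow> bool" where
  "adapted_on \<F> J X \<longleftrightarrow> (\<forall>t\<in>J. X t \<in> borel_measurable (\<F> t))"

text \<open>``A.s., a.e.'', i.e. almost everywhere on \<open>[0,T] \<times> \<Omega>\<close> with respect to \<open>dt \<otimes> dP\<close>.\<close>

definition ae_time :: "'w measure \<Rightarrow> real \<Rightarrow> (real \<Rightarrow> 'w \<Rightarrow> bool) \<Rightarrow> bool" where
  "ae_time P T Q \<longleftrightarrow> (AE x in lborel \<Otimes>\<^sub>M P. fst x \<in> {0..T} \<longrightarrow> Q (fst x) (snd x))"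

definition ess_bounded :: "'w measure \<Rightarrow> real \<Rightarrow> (real \<Rightarrow> 'w \<Rightarrow> 'b::real_normed_vector) \<Rightarrow> bool" where
  "ess_bounded P T X \<longleftrightarrow> (\<exists>K. ae_time P T (\<lambda>t \<omega>. norm (X t \<omega>) \<le> K))"

definition L2_norm2 :: "'w measure \<Rightarrow> real \<Rightarrow> (real \<Rightarrow> 'w \<Rightarrow> 'b::real_normed_vector) \<Rightarrow> ennreal" where
  "L2_norm2 P T X =
     (\<integral>\<^sup>+\<omega>. (\<integral>\<^sup>+t. ennreal ((norm (X t \<omega>))\<^sup>2) * indicator {0..T} t \<partial>lborel) \<partial>P)"

definition cadlag_on :: "real \<Rightarrow> (real \<Rightarrow> real) \<Rightarrow> bool" where
  "cadlag_on T f \<longleftrightarrow> (\<forall>t\<in>{0..<T}. (f \<longlongrightarrow> f t) (at_right t)) \<and>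
                     (\<forall>t\<in>{0<..T}. \<exists>l. (f \<longlongrightarrow> l) (at_left t))"

text \<open>The usual convention \<open>f(0-) = f(0)\<close> is used at time \<open>0\<close>.\<close>

definition left_limit :: "(real \<Rightarrow> real) \<Rightarrow> real \<Rightarrow> real" where
  "left_limit f t = (if t \<le> 0 then f 0 else Lim (at_left t) f)"


section \<open>Brownian motion and the Ito integral\<close>

definition standard_brownian_motion ::
  "'w measure \<Rightarrow> (real \<Rightarrow> 'w \<Rightarrow> real ^ 'n) \<Rightarrow> bool" where
  "standard_brownian_motion P W \<longleftrightarrow>
     (\<forall>t\<ge>0. W t \<in> borel_measurable P) \<and>
     (AE \<omega> in P. W 0 \<omega> = 0) \<and>
     (AE \<omega> in P. continuous_on {0..} (\<lambda>t. W t \<omega>)) \<and>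
     (\<forall>s t. 0 \<le> s \<and> s < t \<longrightarrow>
        prob_space.indep_set P (sets (natural_filtration P W s))
          (sets (vimage_algebra (space P) (\<lambda>\<omega>. W t \<omega> - W s \<omega>) borel)) \<and>
        prob_space.indep_vars P (\<lambda>_. borel) (\<lambda>k \<omega>. W t \<omega> $ k - W s \<omega> $ k) UNIV \<and>
        (\<forall>k. distributed P lborel (\<lambda>\<omega>. W t \<omega> $ k - W s \<omega> $ k)
               (\<lambda>x. ennreal (normal_density 0 (sqrt (t - s)) x))))"

text \<open>A simple integrand is a finite sum of terms \<open>\<xi> 1\<^bsub>(a,b]\<^esub>\<close> with \<open>\<xi>\<close> bounded and
  \<open>\<F>\<^sub>a\<close>-measurable; it is represented by the list of the triples \<open>(a, b, \<xi>)\<close>.\<close>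

type_synonym ('w, 'n) simple_integrand = "(real \<times> real \<times> ('w \<Rightarrow> real ^ 'n)) list"

definition simple_integrand ::
  "'w measure \<Rightarrow> (real \<Rightarrow> 'w measure) \<Rightarrow> real \<Rightarrow> ('w, 'n::finite) simple_integrand \<Rightarrow> bool" where
  "simple_integrand P \<F> T S \<longleftrightarrow>
     (\<forall>(a, b, \<xi>)\<in>set S. 0 \<le> a \<and> a \<le> b \<and> b \<le> T \<and> \<xi> \<in> borel_measurable (\<F> a) \<and>
        (\<exists>K. \<forall>\<omega>\<in>space P. norm (\<xi> \<omega>) \<le> K))"

definition simple_value :: "('w, 'n::finite) simple_integrand \<Rightarrow> real \<Rightarrow> 'w \<Rightarrow> real ^ 'n" where
  "simple_value S t \<omega> = (\<Sum>(a, b, \<xi>)\<leftarrow>S. indicator {a<..b} t *\<^sub>R \<xi> \<omega>)"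

definition simple_integral ::
  "(real \<Rightarrow> 'w \<Rightarrow> real ^ 'n) \<Rightarrow> ('w, 'n::finite) simple_integrand \<Rightarrow> real \<Rightarrow> 'w \<Rightarrow> real" where
  "simple_integral W S t \<omega> = (\<Sum>(a, b, \<xi>)\<leftarrow>S. \<xi> \<omega> \<bullet> (W (min b t) \<omega> - W (min a t) \<omega>))"

text \<open>\<open>I\<close> is (a version, unique up to indistinguishability, of) the continuous process
  \<open>t \<mapsto> \<integral>\<^bsub>(0,t]\<^esub> H' dW\<close>, \<open>t \<in> [0,T]\<close>: the \<open>L\<^sup>2\<close>-limit of the integrals of simple integrands
  converging to \<open>H\<close> in \<open>L\<^sup>2(dt \<otimes> dP)\<close>.\<close>

definition has_ito_integral ::
  "'w measure \<Rightarrow> (real \<Rightarrow> 'w measure) \<Rightarrow> (real \<Rightarrow> 'w \<Rightarrow> real ^ 'n) \<Rightarrow> real \<Rightarrow>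
   (real \<Rightarrow> 'w \<Rightarrow> real ^ 'n::finite) \<Rightarrow> (real \<Rightarrow> 'w \<Rightarrow> real) \<Rightarrow> bool" where
  "has_ito_integral P \<F> W T H I \<longleftrightarrow>
     predictable_on P \<F> {0..T} H \<and> L2_norm2 P T H < \<infinity> \<and>
     adapted_on \<F> {0..T} I \<and> (AE \<omega> in P. continuous_on {0..T} (\<lambda>t. I t \<omega>)) \<and>
     (\<exists>S. (\<forall>k. simple_integrand P \<F> T (S k)) \<and>
          (\<lambda>k::nat. L2_norm2 P T (\<lambda>t \<omega>. simple_value (S k) t \<omega> - H t \<omega>)) \<longlonglongrightarrow> 0 \<and>
          (\<forall>t\<in>{0..T}. (\<lambda>k. \<integral>\<^sup>+\<omega>. ennreal ((simple_integral W (S k) t \<omega> - I t \<omega>)\<^sup>2) \<partial>P) \<longlonglongrightarrow> 0))"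


section \<open>The random time and its compensated jump process\<close>

definition stopped :: "real \<Rightarrow> ereal \<Rightarrow> real" where
  "stopped t r = real_of_ereal (min (ereal t) r)"

definition jump_process :: "('w \<Rightarrow> ereal) \<Rightarrow> real \<Rightarrow> 'w \<Rightarrow> real" where
  "jump_process \<tau> t \<omega> = of_bool (\<tau> \<omega> \<le> ereal t)"

definition compensator :: "('w \<Rightarrow> ereal) \<Rightarrow> (real \<Rightarrow> 'w \<Rightarrow> real) \<Rightarrow> real \<Rightarrow> 'w \<Rightarrow> real" where
  "compensator \<tau> lam t \<omega> = (LINT s:{0<..stopped t (\<tau> \<omega>)}|lborel. lam s \<omega>)"

definition intensity_G :: "('w \<Rightarrow> ereal) \<Rightarrow> (real \<Rightarrow> 'w \<Rightarrow> real) \<Rightarrow> real \<Rightarrow> 'w \<Rightarrow> real" where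
  "intensity_G \<tau> lam s \<omega> = lam s \<omega> * of_bool (ereal s \<le> \<tau> \<omega>)"

text \<open>The martingale \<open>M = N - compensator\<close> has paths of finite variation; \<open>\<integral>\<^bsub>(a,b]\<^esub> U dM\<close> is the
  pathwise Lebesgue-Stieltjes integral, i.e. the difference of the integrals with respect to
  the two nondecreasing right-continuous paths.\<close>

definition M_integrable ::
  "('w \<Rightarrow> ereal) \<Rightarrow> (real \<Rightarrow> 'w \<Rightarrow> real) \<Rightarrow> (real \<Rightarrow> 'w \<Rightarrow> real) \<Rightarrow> real \<Rightarrow> real \<Rightarrow> 'w \<Rightarrow> bool" where
  "M_integrable \<tau> lam U a b \<omega> \<longleftrightarrow>
     set_integrable (interval_measure (\<lambda>u. jump_process \<tau> u \<omega>)) {a<..b} (\<lambda>s. U s \<omega>) \<and>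
     set_integrable (interval_measure (\<lambda>u. compensator \<tau> lam u \<omega>)) {a<..b} (\<lambda>s. U s \<omega>)"

definition M_integral ::
  "('w \<Rightarrow> ereal) \<Rightarrow> (real \<Rightarrow> 'w \<Rightarrow> real) \<Rightarrow> (real \<Rightarrow> 'w \<Rightarrow> real) \<Rightarrow> real \<Rightarrow> real \<Rightarrow> 'w \<Rightarrow> real" where
  "M_integral \<tau> lam U a b \<omega> =
     (LINT s:{a<..b}|interval_measure (\<lambda>u. jump_process \<tau> u \<omega>). U s \<omega>) -
     (LINT s:{a<..b}|interval_measure (\<lambda>u. compensator \<tau> lam u \<omega>). U s \<omega>)"

abbreviation filt_F :: "'w measure \<Rightarrow> (real \<Rightarrow> 'w \<Rightarrow> real ^ 'n) \<Rightarrow> real \<Rightarrow> 'w measure" where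
  "filt_F P W \<equiv> augmented_filtration P W"

abbreviation filt_G ::
  "'w measure \<Rightarrow> (real \<Rightarrow> 'w \<Rightarrow> real ^ 'n) \<Rightarrow> ('w \<Rightarrow> ereal) \<Rightarrow> real \<Rightarrow> 'w measure" where
  "filt_G P W \<tau> \<equiv> enlarged_filtration P (augmented_filtration P W) \<tau>"

definition default_setting ::
  "'w measure \<Rightarrow> (real \<Rightarrow> 'w \<Rightarrow> real ^ 'n) \<Rightarrow> ('w \<Rightarrow> ereal) \<Rightarrow> (real \<Rightarrow> 'w \<Rightarrow> real) \<Rightarrow> bool" where
  "default_setting P W \<tau> lam \<longleftrightarrow>
     prob_space P \<and> complete_measure P \<and> standard_brownian_motion P W \<and>
     \<tau> \<in> borel_measurable P \<and> (\<forall>\<omega>\<in>space P. 0 \<le> \<tau> \<omega>) \<and>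
     (\<forall>X. martingale P (filt_F P W) X \<longrightarrow> martingale P (filt_G P W \<tau>) X) \<and>
     predictable_on P (filt_F P W) {0..} lam \<and>
     (\<exists>K. \<forall>t\<ge>0. \<forall>\<omega>\<in>space P. 0 \<le> lam t \<omega> \<and> lam t \<omega> \<le> K) \<and>
     martingale P (filt_G P W \<tau>) (\<lambda>t \<omega>. jump_process \<tau> t \<omega> - compensator \<tau> lam t \<omega>)"


section \<open>Coefficients\<close>

definition pos_semidef :: "real ^ 'm ^ 'm \<Rightarrow> bool" where
  "pos_semidef A \<longleftrightarrow> transpose A = A \<and> (\<forall>x. 0 \<le> x \<bullet> (A *v x))"

definition pos_def :: "real ^ 'm ^ 'm \<Rightarrow> bool" where
  "pos_def A \<longleftrightarrow> transpose A = A \<and> (\<forall>x. x \<noteq> 0 \<longrightarrow> 0 < x \<bullet> (A *v x))"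

definition outer :: "real ^ 'm \<Rightarrow> real ^ 'm ^ 'm" where
  "outer v = (\<chi> i j. v $ i * v $ j)"

definition generator_matrix :: "('l::finite \<Rightarrow> 'l \<Rightarrow> real) \<Rightarrow> bool" where
  "generator_matrix q \<longleftrightarrow> (\<forall>i j. i \<noteq> j \<longrightarrow> 0 \<le> q i j) \<and> (\<forall>i. (\<Sum>j\<in>UNIV. q i j) = 0)"

text \<open>The set of regimes \<open>{1,\<dots>,\<ell>}\<close> is the finite type \<open>'l\<close>. All fields are processes
  \<open>regime \<Rightarrow> time \<Rightarrow> \<omega> \<Rightarrow> value\<close>, except \<open>cGb\<close>, which is a family of random variables.\<close>

record ('l, 'w, 'n, 'm) coefficients =
  cA :: "'l \<Rightarrow> real \<Rightarrow> 'w \<Rightarrow> real"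
  cE :: "'l \<Rightarrow> real \<Rightarrow> 'w \<Rightarrow> real"
  cQ :: "'l \<Rightarrow> real \<Rightarrow> 'w \<Rightarrow> real"
  cB :: "'l \<Rightarrow> real \<Rightarrow> 'w \<Rightarrow> real ^ 'm::finite"
  cF :: "'l \<Rightarrow> real \<Rightarrow> 'w \<Rightarrow> real ^ 'm::finite"
  cC :: "'l \<Rightarrow> real \<Rightarrow> 'w \<Rightarrow> real ^ 'n::finite"
  cD :: "'l \<Rightarrow> real \<Rightarrow> 'w \<Rightarrow> real ^ 'm::finite ^ 'n::finite"
  cR :: "'l \<Rightarrow> real \<Rightarrow> 'w \<Rightarrow> real ^ 'm::finite ^ 'm::finite"
  cGb :: "'l \<Rightarrow> 'w \<Rightarrow> real"
  cGa :: "'l \<Rightarrow> real \<Rightarrow> 'w \<Rightarrow> real"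

definition bounded_predictable ::
  "'w measure \<Rightarrow> (real \<Rightarrow> 'w measure) \<Rightarrow> real \<Rightarrow> (real \<Rightarrow> 'w \<Rightarrow> 'b::real_normed_vector) \<Rightarrow> bool" where
  "bounded_predictable P \<F> T X \<longleftrightarrow> predictable_on P \<F> {0..T} X \<and> ess_bounded P T X"

definition admissible_coefficients ::
  "'w measure \<Rightarrow> (real \<Rightarrow> 'w measure) \<Rightarrow> real \<Rightarrow> ('l, 'w, 'n::finite, 'm::finite) coefficients \<Rightarrow> bool"
  where
  "admissible_coefficients P \<F> T c \<longleftrightarrow>
     (\<forall>i. bounded_predictable P \<F> T (cA c i) \<and> bounded_predictable P \<F> T (cE c i) \<and>
          bounded_predictable P \<F> T (cQ c i) \<and> bounded_predictable P \<F> T (cB c i) \<and>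
          bounded_predictable P \<F> T (cF c i) \<and> bounded_predictable P \<F> T (cC c i) \<and>
          bounded_predictable P \<F> T (cD c i) \<and> bounded_predictable P \<F> T (cR c i) \<and>
          (\<forall>t\<in>{0..T}. \<forall>\<omega>\<in>space P. transpose (cR c i t \<omega>) = cR c i t \<omega>) \<and>
          cGb c i \<in> borel_measurable (\<F> T) \<and> (\<exists>K. \<forall>\<omega>\<in>space P. \<bar>cGb c i \<omega>\<bar> \<le> K) \<and>
          bounded_predictable P \<F> T (cGa c i))"

text \<open>\<open>real_of_ereal \<infinity> = 0\<close>, but the second summand vanishes there.\<close>

definition terminal ::
  "('w \<Rightarrow> ereal) \<Rightarrow> real \<Rightarrow> ('l, 'w, 'n::finite, 'm::finite) coefficients \<Rightarrow> 'l \<Rightarrow> 'w \<Rightarrow> real" where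
  "terminal \<tau> T c i \<omega> = cGb c i \<omega> * of_bool (ereal T < \<tau> \<omega>) +
     cGa c i (real_of_ereal (\<tau> \<omega>)) \<omega> * of_bool (\<tau> \<omega> \<le> ereal T)"

definition standard_case ::
  "'w measure \<Rightarrow> ('w \<Rightarrow> ereal) \<Rightarrow> real \<Rightarrow> ('l, 'w, 'n::finite, 'm::finite) coefficients \<Rightarrow> bool" where
  "standard_case P \<tau> T c \<longleftrightarrow> (\<exists>\<delta>>0. \<forall>i.
     ae_time P T (\<lambda>t \<omega>. 0 \<le> cQ c i t \<omega>) \<and>
     (AE \<omega> in P. 0 \<le> terminal \<tau> T c i \<omega>) \<and>
     ae_time P T (\<lambda>t \<omega>. pos_semidef (cR c i t \<omega> - \<delta> *\<^sub>R mat 1)))"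

definition singular_case_I ::
  "'w measure \<Rightarrow> ('w \<Rightarrow> ereal) \<Rightarrow> real \<Rightarrow> ('l, 'w, 'n::finite, 'm::finite) coefficients \<Rightarrow> bool" where
  "singular_case_I P \<tau> T c \<longleftrightarrow> (\<exists>\<delta>>0. \<forall>i.
     ae_time P T (\<lambda>t \<omega>. 0 \<le> cQ c i t \<omega>) \<and>
     ae_time P T (\<lambda>t \<omega>. pos_semidef (cR c i t \<omega>)) \<and>
     (AE \<omega> in P. \<delta> \<le> terminal \<tau> T c i \<omega>) \<and>
     ae_time P T (\<lambda>t \<omega>. pos_semidef (transpose (cD c i t \<omega>) ** cD c i t \<omega> - \<delta> *\<^sub>R mat 1)))"

text \<open>\<open>cF\<close> takes values in a one-dimensional space here, so \<open>F \<bullet> F\<close> is the square of \<open>F\<close>.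
  The inequality \<open>G\<^sup>a \<ge> \<delta>\<close> is imposed almost everywhere on \<open>[0,T] \<times> \<Omega>\<close>. This leaves \<open>G\<^sup>a\<close> at time
  \<open>0\<close> undetermined, which is harmless if \<open>\<tau> > 0\<close> almost surely; as \<open>\<tau> = 0\<close> is not excluded,
  the inequality is also required of \<open>G\<^sup>a\<^sub>0\<close> on the event \<open>\<tau> = 0\<close>. (The values \<open>G\<^sup>a\<^sub>\<tau>\<close> on
  \<open>0 < \<tau> \<le> T\<close> need no such provision, \<open>\<tau>\<close> having an absolutely continuous compensator.)\<close>

definition singular_case_II ::
  "'w measure \<Rightarrow> ('w \<Rightarrow> ereal) \<Rightarrow> (real \<Rightarrow> 'w \<Rightarrow> real) \<Rightarrow> real \<Rightarrow>
   ('l, 'w, 'n::finite, 'm::finite) coefficients \<Rightarrow> bool" where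
  "singular_case_II P \<tau> lam T c \<longleftrightarrow> CARD('m) = 1 \<and> (\<exists>\<delta>>0. \<forall>i.
     ae_time P T (\<lambda>t \<omega>. 0 \<le> cQ c i t \<omega>) \<and>
     ae_time P T (\<lambda>t \<omega>. pos_semidef (cR c i t \<omega>)) \<and>
     (AE \<omega> in P. 0 \<le> cGb c i \<omega>) \<and>
     ae_time P T (\<lambda>t \<omega>. \<delta> \<le> cGa c i t \<omega>) \<and>
     (AE \<omega> in P. \<tau> \<omega> = 0 \<longrightarrow> \<delta> \<le> cGa c i 0 \<omega>) \<and>
     ae_time P T (\<lambda>t \<omega>. \<delta> \<le> lam t \<omega> * (cF c i t \<omega> \<bullet> cF c i t \<omega>)))"


section \<open>The system (B) of BSDEs without jumps\<close>

definition N_hat ::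
  "('l, 'w, 'n::finite, 'm::finite) coefficients \<Rightarrow> (real \<Rightarrow> 'w \<Rightarrow> real) \<Rightarrow>
   'l \<Rightarrow> real \<Rightarrow> 'w \<Rightarrow> real \<Rightarrow> real ^ 'n \<Rightarrow> real ^ 'm" where
  "N_hat c lam i s \<omega> p L =
     p *\<^sub>R (transpose (cD c i s \<omega>) *v cC c i s \<omega> + cB c i s \<omega> - lam s \<omega> *\<^sub>R cF c i s \<omega>)
     + transpose (cD c i s \<omega>) *v L
     + (lam s \<omega> * cGa c i s \<omega> * (cE c i s \<omega> + 1)) *\<^sub>R cF c i s \<omega>"

definition R_hat ::
  "('l, 'w, 'n::finite, 'm::finite) coefficients \<Rightarrow> (real \<Rightarrow> 'w \<Rightarrow> real) \<Rightarrow>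
   'l \<Rightarrow> real \<Rightarrow> 'w \<Rightarrow> real \<Rightarrow> real ^ 'm ^ 'm" where
  "R_hat c lam i s \<omega> p =
     cR c i s \<omega> + p *\<^sub>R (transpose (cD c i s \<omega>) ** cD c i s \<omega>)
     + (lam s \<omega> * cGa c i s \<omega>) *\<^sub>R outer (cF c i s \<omega>)"

definition driver_B ::
  "('l::finite, 'w, 'n::finite, 'm::finite) coefficients \<Rightarrow> ('l \<Rightarrow> 'l \<Rightarrow> real) \<Rightarrow>
   (real \<Rightarrow> 'w \<Rightarrow> real) \<Rightarrow> ('l \<Rightarrow> real \<Rightarrow> 'w \<Rightarrow> real) \<Rightarrow> ('l \<Rightarrow> real \<Rightarrow> 'w \<Rightarrow> real ^ 'n) \<Rightarrow>
   'l \<Rightarrow> 'w \<Rightarrow> real \<Rightarrow> real" where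
  "driver_B c q lam Pb Lb i \<omega> s =
     (2 * cA c i s \<omega> + cC c i s \<omega> \<bullet> cC c i s \<omega> - 2 * lam s \<omega> * cE c i s \<omega> - lam s \<omega>) * Pb i s \<omega>
     + 2 * (cC c i s \<omega> \<bullet> Lb i s \<omega>)
     + lam s \<omega> * cGa c i s \<omega> * (cE c i s \<omega> + 1)\<^sup>2
     + cQ c i s \<omega>
     + (\<Sum>j\<in>UNIV. q i j * Pb j s \<omega>)
     - N_hat c lam i s \<omega> (Pb i s \<omega>) (Lb i s \<omega>) \<bullet>
         (matrix_inv (R_hat c lam i s \<omega> (Pb i s \<omega>)) *v N_hat c lam i s \<omega> (Pb i s \<omega>) (Lb i s \<omega>))"

definition solution_B ::
  "'w measure \<Rightarrow> (real \<Rightarrow> 'w \<Rightarrow> real ^ 'n::finite) \<Rightarrow> (real \<Rightarrow> 'w \<Rightarrow> real) \<Rightarrow> real \<Rightarrow>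
   ('l::finite \<Rightarrow> 'l \<Rightarrow> real) \<Rightarrow> ('l, 'w, 'n, 'm::finite) coefficients \<Rightarrow>
   ('l \<Rightarrow> real \<Rightarrow> 'w \<Rightarrow> real) \<Rightarrow> ('l \<Rightarrow> real \<Rightarrow> 'w \<Rightarrow> real ^ 'n) \<Rightarrow> bool" where
  "solution_B P W lam T q c Pb Lb \<longleftrightarrow> (\<forall>i.
     bounded_predictable P (filt_F P W) T (Pb i) \<and>
     predictable_on P (filt_F P W) {0..T} (Lb i) \<and> L2_norm2 P T (Lb i) < \<infinity> \<and>
     (\<exists>I. has_ito_integral P (filt_F P W) W T (Lb i) I \<and>
       (AE \<omega> in P. set_integrable lborel {0<..T} (driver_B c q lam Pb Lb i \<omega>) \<and>
         (\<forall>t\<in>{0..T}. Pb i t \<omega> =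
            cGb c i \<omega> + (LINT s:{t<..T}|lborel. driver_B c q lam Pb Lb i \<omega> s) - (I T \<omega> - I t \<omega>)))) \<and>
     ae_time P T (\<lambda>s \<omega>. pos_def (R_hat c lam i s \<omega> (Pb i s \<omega>))))"


section \<open>The system (J) of BSDEs with jumps\<close>

definition N_jump ::
  "('l, 'w, 'n::finite, 'm::finite) coefficients \<Rightarrow> ('w \<Rightarrow> ereal) \<Rightarrow> (real \<Rightarrow> 'w \<Rightarrow> real) \<Rightarrow>
   'l \<Rightarrow> real \<Rightarrow> 'w \<Rightarrow> real \<Rightarrow> real ^ 'n \<Rightarrow> real \<Rightarrow> real ^ 'm" where
  "N_jump c \<tau> lam i s \<omega> p L u =
     p *\<^sub>R (transpose (cD c i s \<omega>) *v cC c i s \<omega> + cB c i s \<omega>)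
     + transpose (cD c i s \<omega>) *v L
     + (intensity_G \<tau> lam s \<omega> * cE c i s \<omega> * (p + u)) *\<^sub>R cF c i s \<omega>
     + (intensity_G \<tau> lam s \<omega> * u) *\<^sub>R cF c i s \<omega>"

definition R_jump ::
  "('l, 'w, 'n::finite, 'm::finite) coefficients \<Rightarrow> ('w \<Rightarrow> ereal) \<Rightarrow> (real \<Rightarrow> 'w \<Rightarrow> real) \<Rightarrow>
   'l \<Rightarrow> real \<Rightarrow> 'w \<Rightarrow> real \<Rightarrow> real \<Rightarrow> real ^ 'm ^ 'm" where
  "R_jump c \<tau> lam i s \<omega> p u =
     cR c i s \<omega> + p *\<^sub>R (transpose (cD c i s \<omega>) ** cD c i s \<omega>)
     + (intensity_G \<tau> lam s \<omega> * (p + u)) *\<^sub>R outer (cF c i s \<omega>)"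

definition driver_J ::
  "('l::finite, 'w, 'n::finite, 'm::finite) coefficients \<Rightarrow> ('l \<Rightarrow> 'l \<Rightarrow> real) \<Rightarrow>
   ('w \<Rightarrow> ereal) \<Rightarrow> (real \<Rightarrow> 'w \<Rightarrow> real) \<Rightarrow> ('l \<Rightarrow> real \<Rightarrow> 'w \<Rightarrow> real) \<Rightarrow>
   ('l \<Rightarrow> real \<Rightarrow> 'w \<Rightarrow> real ^ 'n) \<Rightarrow> ('l \<Rightarrow> real \<Rightarrow> 'w \<Rightarrow> real) \<Rightarrow> 'l \<Rightarrow> 'w \<Rightarrow> real \<Rightarrow> real" where
  "driver_J c q \<tau> lam Pj Lj Uj i \<omega> s =
     (let p = (\<lambda>j. left_limit (\<lambda>u. Pj j u \<omega>) s); L = Lj i s \<omega>; u = Uj i s \<omega>;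
          lG = intensity_G \<tau> lam s \<omega>; N = N_jump c \<tau> lam i s \<omega> (p i) L u
      in (2 * cA c i s \<omega> + cC c i s \<omega> \<bullet> cC c i s \<omega>) * p i
         + lG * (cE c i s \<omega>)\<^sup>2 * (p i + u)
         + 2 * (cC c i s \<omega> \<bullet> L)
         + 2 * lG * cE c i s \<omega> * u
         + cQ c i s \<omega>
         + (\<Sum>j\<in>UNIV. q i j * p j)
         - N \<bullet> (matrix_inv (R_jump c \<tau> lam i s \<omega> (p i) u) *v N))"

definition solution_J ::
  "'w measure \<Rightarrow> (real \<Rightarrow> 'w \<Rightarrow> real ^ 'n::finite) \<Rightarrow> ('w \<Rightarrow> ereal) \<Rightarrow> (real \<Rightarrow> 'w \<Rightarrow> real) \<Rightarrow> real \<Rightarrow>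
   ('l::finite \<Rightarrow> 'l \<Rightarrow> real) \<Rightarrow> ('l, 'w, 'n, 'm::finite) coefficients \<Rightarrow>
   ('l \<Rightarrow> real \<Rightarrow> 'w \<Rightarrow> real) \<Rightarrow> ('l \<Rightarrow> real \<Rightarrow> 'w \<Rightarrow> real ^ 'n) \<Rightarrow> ('l \<Rightarrow> real \<Rightarrow> 'w \<Rightarrow> real) \<Rightarrow> bool"
  where
  "solution_J P W \<tau> lam T q c Pj Lj Uj \<longleftrightarrow> (\<forall>i.
     (AE \<omega> in P. cadlag_on T (\<lambda>t. Pj i t \<omega>)) \<and> adapted_on (filt_G P W \<tau>) {0..T} (Pj i) \<and>
     ess_bounded P T (Pj i) \<and>
     predictable_on P (filt_G P W \<tau>) {0..T} (Lj i) \<and> L2_norm2 P T (Lj i) < \<infinity> \<and>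
     bounded_predictable P (filt_G P W \<tau>) T (Uj i) \<and>
     (\<exists>I. has_ito_integral P (filt_G P W \<tau>) W T (Lj i) I \<and>
       (AE \<omega> in P. set_integrable lborel {0<..stopped T (\<tau> \<omega>)} (driver_J c q \<tau> lam Pj Lj Uj i \<omega>) \<and>
         M_integrable \<tau> lam (Uj i) 0 (stopped T (\<tau> \<omega>)) \<omega> \<and>
         (\<forall>t\<in>{0..T}. Pj i t \<omega> =
            terminal \<tau> T c i \<omega>
            + (LINT s:{stopped t (\<tau> \<omega>)<..stopped T (\<tau> \<omega>)}|lborel. driver_J c q \<tau> lam Pj Lj Uj i \<omega> s)
            - (I (stopped T (\<tau> \<omega>)) \<omega> - I (stopped t (\<tau> \<omega>)) \<omega>)
            - M_integral \<tau> lam (Uj i) (stopped t (\<tau> \<omega>)) (stopped T (\<tau> \<omega>)) \<omega>))) \<and>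
     ae_time P T (\<lambda>s \<omega>. ereal s \<le> \<tau> \<omega> \<longrightarrow>
       pos_def (R_jump c \<tau> lam i s \<omega> (left_limit (\<lambda>u. Pj i u \<omega>) s) (Uj i s \<omega>))))"


section \<open>Signs of solutions, and the processes built from a solution of (B)\<close>

definition nonnegative_family :: "'w measure \<Rightarrow> real \<Rightarrow> ('l \<Rightarrow> real \<Rightarrow> 'w \<Rightarrow> real) \<Rightarrow> bool" where
  "nonnegative_family P T X \<longleftrightarrow> (\<forall>i. AE \<omega> in P. \<forall>t\<in>{0..T}. 0 \<le> X i t \<omega>)"

definition uniformly_positive_family ::
  "'w measure \<Rightarrow> real \<Rightarrow> ('l \<Rightarrow> real \<Rightarrow> 'w \<Rightarrow> real) \<Rightarrow> bool" where
  "uniformly_positive_family P T X \<longleftrightarrow> (\<exists>c>0. \<forall>i. AE \<omega> in P. \<forall>t\<in>{0..T}. c \<le> X i t \<omega>)"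

text \<open>The predictable process \<open>X\<^bsub>t-\<^esub> + U\<^sub>t\<close> is only meaningful up to \<open>dt \<otimes> dP\<close>-null sets (as are the
  coefficients from which \<open>U\<close> is built), hence the almost-everywhere bound on it.\<close>

definition positive_family ::
  "'w measure \<Rightarrow> real \<Rightarrow> ('l \<Rightarrow> real \<Rightarrow> 'w \<Rightarrow> real) \<Rightarrow> ('l \<Rightarrow> real \<Rightarrow> 'w \<Rightarrow> real) \<Rightarrow> bool" where
  "positive_family P T X U \<longleftrightarrow> nonnegative_family P T X \<and>
     (\<exists>c>0. \<forall>i. ae_time P T (\<lambda>t \<omega>. c \<le> left_limit (\<lambda>u. X i u \<omega>) t + U i t \<omega>))"

definition glued_P ::
  "('w \<Rightarrow> ereal) \<Rightarrow> ('l, 'w, 'n::finite, 'm::finite) coefficients \<Rightarrow> ('l \<Rightarrow> real \<Rightarrow> 'w \<Rightarrow> real) \<Rightarrow>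
   'l \<Rightarrow> real \<Rightarrow> 'w \<Rightarrow> real" where
  "glued_P \<tau> c Pb i t \<omega> = Pb i t \<omega> * of_bool (ereal t < \<tau> \<omega>) +
     cGa c i (real_of_ereal (\<tau> \<omega>)) \<omega> * of_bool (\<tau> \<omega> \<le> ereal t)"

definition glued_L ::
  "('w \<Rightarrow> ereal) \<Rightarrow> ('l \<Rightarrow> real \<Rightarrow> 'w \<Rightarrow> real ^ 'n) \<Rightarrow> 'l \<Rightarrow> real \<Rightarrow> 'w \<Rightarrow> real ^ 'n" where
  "glued_L \<tau> Lb i t \<omega> = of_bool (ereal t \<le> \<tau> \<omega>) *\<^sub>R Lb i t \<omega>"

definition glued_U ::
  "('w \<Rightarrow> ereal) \<Rightarrow> ('l, 'w, 'n::finite, 'm::finite) coefficients \<Rightarrow> ('l \<Rightarrow> real \<Rightarrow> 'w \<Rightarrow> real) \<Rightarrow>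
   'l \<Rightarrow> real \<Rightarrow> 'w \<Rightarrow> real" where
  "glued_U \<tau> c Pb i t \<omega> = (cGa c i t \<omega> - Pb i t \<omega>) * of_bool (ereal t \<le> \<tau> \<omega>)"

end

(* Up to time \<tau> the left limit of P is the continuous path of P\<^sup>b, so P + U = G\<^sup>a there, and the drivers
   of (J) and (B) differ exactly by \<lambda> U, which is the compensator part of U dM. Hence (J) is the pathwise
   identity obtained from (B) on [0, \<tau> \<and> T], the jump U\<^sub>\<tau> carrying P\<^sup>b\<^sub>\<tau> to G\<^sup>a\<^sub>\<tau>. Two points need
   probability. First, G\<^sup>a\<^sub>\<tau> inherits essential bounds from G\<^sup>a: by the martingale property of M the law of
   (\<tau>, \<omega>) on predictable sets of positive times has density \<lambda> 1(s \<le> \<tau>) with respect to dt dP, so \<tau> avoids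
   null sets; at time 0 the \<sigma>-algebra of \<F> is trivial. Second, the Ito integral of \<Lambda> = \<Lambda>\<^sup>b 1(s \<le> \<tau>) in the
   enlarged filtration is the stopped integral of \<Lambda>\<^sup>b: simple integrands for \<Lambda>\<^sup>b are cut at dyadic upper
   approximations of \<tau>, and the errors are controlled because \<F>-martingales remain \<G>-martingales, so that
   W is still a Brownian motion and simple integrals are still martingales in \<G>. *)

theory Submission
  imports Defs
begin

section \<open>Lebesgue-Stieltjes measures\<close>

text \<open>The stochastic integral in (J) is accepted only as an L2 limit of integrals of simple
  integrands whose coefficients are known at the left end of their interval, so stopping at \<tau>
  must be realised by explicit simple \<G>-integrands. Rounding \<tau> \<and> T upwards to a dyadic
  grid makes this possible: whether a grid point lies strictly before \<tau> \<and> T is known at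
  that grid point. The price is an overshoot of at most \<open>1 / 2 ^ n\<close>, whose effect is
  bounded with a constant depending on the integrand; hence the diagonal choice in which the mesh is
  fixed after the integrand. The hypothesis on martingales is applied to two kinds of processes: the
  coordinates of W, and the closed martingales generated by a squared increment Z. The latter give
  E[(W_t - W_s)^2; A] = P(A) (t - s), coordinate by coordinate, for A in \<open>\<G> s\<close>.
  Every estimate at a random time is proved on the finitely many events where the dyadic time is
  constant, and carried over to \<tau> \<and> T by continuity of paths and Fatou's lemma.\<close>

lemma interval_measure_eqI:
  fixes M :: "real measure"
  assumes M: "sets M = sets borel"
    and F: "\<And>a b. a \<le> b \<Longrightarrow> F a \<le> F b" "\<And>a. continuous (at_right a) F"
    and eq: "\<And>a b. a \<le> b \<Longrightarrow> emeasure M {a<..b} = ennreal (F b - F a)"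
  shows "interval_measure F = M"
proof (rule measure_eqI_generator_eq[where E = "range (\<lambda>(a, b). {a<..b})" and \<Omega> = UNIV
      and A = "\<lambda>n. {- real n<..real n}"])
  show "Int_stable (range (\<lambda>(a, b). {a<..b::real}))"
    by (auto simp: Int_stable_def Int_greaterThanAtMost)
  have *: "emeasure (interval_measure F) {a<..b} = ennreal (F b - F a)" if "a \<le> b" for a b
    using that F by (intro emeasure_interval_measure_Ioc) auto
  show "emeasure (interval_measure F) X = emeasure M X" if Xin: "X \<in> range (\<lambda>(a, b). {a<..b})" for X
  proof -
    obtain a b where X: "X = {a<..b}" using Xin by auto
    show ?thesis
      by (cases "a \<le> b") (auto simp: X * eq)
  qed
  show "sets (interval_measure F) = sigma_sets UNIV (range (\<lambda>(a, b). {a<..b}))"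
    "sets M = sigma_sets UNIV (range (\<lambda>(a, b). {a<..b}))"
    by (simp_all add: M borel_sigma_sets_Ioc)
  show "(\<Union>i. {- real i<..real i}) = UNIV"
  proof safe
    fix x :: real
    obtain n where "\<bar>x\<bar> < real n" using reals_Archimedean2 by blast
    then show "x \<in> (\<Union>i. {- real i<..real i})" by (auto intro!: exI[of _ n])
  qed simp
  show "emeasure (interval_measure F) {- real i<..real i} \<noteq> \<infinity>" for i
    by (subst *) auto
qed auto

text \<open>This step function is the path of \<open>jump_process\<close>, so integration against it
  evaluates the integrand at \<tau>. For infinite r the path is constant and its measure vanishes:
  there is no jump term on \<tau> = \<infinity>.\<close>

lemma interval_measure_step:
  "interval_measure (\<lambda>u. of_bool (r \<le> ereal u)) =
    (if \<bar>r\<bar> = \<infinity> then null_measure borel else return borel (real_of_ereal r))"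
proof (cases r)
  case (real x)
  have "interval_measure (\<lambda>u. of_bool (x \<le> u)) = return borel x"
  proof (rule interval_measure_eqI)
    fix a
    show "continuous (at_right a) (\<lambda>u. of_bool (x \<le> u) :: real)"
    proof (cases "x \<le> a")
      case True
      have "eventually (\<lambda>u. of_bool (x \<le> a) = (of_bool (x \<le> u) :: real)) (at_right a)"
        using True by (auto simp: eventually_at_filter)
      then show ?thesis
        unfolding continuous_within by (rule Lim_transform_eventually[OF tendsto_const])
    next
      case False
      then have "eventually (\<lambda>u. u < x) (at_right a)"
        by (intro order_tendstoD(2)[OF tendsto_ident_at]) simp
      then have "eventually (\<lambda>u. of_bool (x \<le> a) = (of_bool (x \<le> u) :: real)) (at_right a)"
        by (rule eventually_mono) (use False in auto)
      then show ?thesis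
        unfolding continuous_within by (rule Lim_transform_eventually[OF tendsto_const])
    qed
  qed (auto simp: indicator_def)
  then show ?thesis by (simp add: real)
next
  case PInf
  have "interval_measure (\<lambda>u. 0::real) = null_measure borel"
    by (rule interval_measure_eqI) auto
  then show ?thesis by (simp add: PInf)
next
  case MInf
  have "interval_measure (\<lambda>u. 1::real) = null_measure borel"
    by (rule interval_measure_eqI) auto
  then show ?thesis by (simp add: MInf)
qed

lemma emeasure_Ioc_finite: "emeasure lborel {a<..b::real} < \<top>"
  by (cases "a \<le> b") auto

lemma set_integrable_bounded_Ioc:
  fixes f :: "real \<Rightarrow> real"
  assumes "f \<in> borel_measurable (restrict_space borel A)" "{a<..b} \<subseteq> A" "A \<in> sets borel"
    "\<And>x. x \<in> A \<Longrightarrow> \<bar>f x\<bar> \<le> K"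
  shows "set_integrable lborel {a<..b} f"
proof -
  have "(\<lambda>x. indicator {a<..b} x *\<^sub>R f x) \<in> borel_measurable lborel"
  proof -
    have "f \<in> borel_measurable (restrict_space borel {a<..b})"
      using assms(1,2) by (rule measurable_restrict_mono)
    then show ?thesis by (subst (asm) borel_measurable_restrict_space_iff) auto
  qed
  then show ?thesis unfolding set_integrable_def
    by (intro integrableI_bounded_set[of "{a<..b}" _ _ K]) (use assms in \<open>auto intro!: AE_I2 assms(4) emeasure_Ioc_finite\<close>)
qed

text \<open>For u \<le> 0 the interval \<open>{0<..u}\<close> is empty, so the distribution function
  vanishes there and its density carries the factor \<open>indicator {0<..}\<close>. Increments are
  integrals over \<open>{max 0 u<..v}\<close>; with 0 \<le> f \<le> K they lie between 0 and K (v -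
  u), which yields monotonicity and right continuity together.\<close>

lemma
  fixes f :: "real \<Rightarrow> real"
  assumes f[measurable]: "f \<in> borel_measurable borel" and b: "\<And>x. 0 \<le> f x" "\<And>x. f x \<le> K"
  shows interval_measure_density: "interval_measure (\<lambda>u. LINT s:{0<..u}|lborel. f s) =
      density lborel (\<lambda>s. ennreal (f s) * indicator {0<..} s)"
    and nn_integral_density_Ioc: "\<And>a b. a \<le> b \<Longrightarrow>
      (\<integral>\<^sup>+ s. ennreal (f s) * indicator {0<..} s * indicator {a<..b} s \<partial>lborel) =
        ennreal ((LINT s:{0<..b}|lborel. f s) - (LINT s:{0<..a}|lborel. f s))"
    and set_integral_Ioc_mono: "\<And>a b. a \<le> b \<Longrightarrow>
      (LINT s:{0<..a}|lborel. f s) \<le> (LINT s:{0<..b}|lborel. f s)"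
proof -
  define F where "F u = (LINT s:{0<..u}|lborel. f s)" for u
  have K: "0 \<le> K" using b[of 0] by linarith
  have int: "set_integrable lborel {a<..b} f" for a b
    by (rule set_integrable_bounded_Ioc[where A = UNIV and K = K]) (use b in \<open>auto simp: space_restrict_space\<close>)
  have diff: "F v - F u = (LINT s:{max 0 u<..v}|lborel. f s)" if "u \<le> v" for u v
  proof (cases "0 \<le> u")
    case True
    have "F v = F u + (LINT s:{u<..v}|lborel. f s)"
      unfolding F_def
      by (subst set_integral_Un[symmetric])
         (use True that int in \<open>auto intro!: arg_cong[where f = "\<lambda>A. LINT s:A|lborel. f s"]\<close>)
    then show ?thesis using True by (simp add: max_def)
  next
    case False
    then show ?thesis by (simp add: F_def max_def set_lebesgue_integral_def)
  qed
  have bd: "0 \<le> F v - F u \<and> F v - F u \<le> K * (v - u)" if "u \<le> v" for u v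
  proof -
    have "(LINT s:{max 0 u<..v}|lborel. f s) \<le> (LINT s:{max 0 u<..v}|lborel. K)"
      by (rule set_integral_mono) (use b int K in \<open>auto intro!: set_integrable_bounded_Ioc[where A = UNIV and K = K]\<close>)
    also have "\<dots> = K * measure lborel {max 0 u<..v}"
      by (simp add: set_lebesgue_integral_def)
    also have "\<dots> \<le> K * (v - u)"
      using K that by (cases "max 0 u \<le> v") (auto intro!: mult_left_mono)
    finally show ?thesis
      using diff[OF that] b by (auto simp: set_lebesgue_integral_def intro!: integral_nonneg_AE)
  qed
  have nn: "(\<integral>\<^sup>+ s. ennreal (f s) * indicator {0<..} s * indicator {a<..b} s \<partial>lborel) = ennreal (F b - F a)"
    if "a \<le> b" for a b
  proof -
    have "(\<integral>\<^sup>+ s. ennreal (f s) * indicator {0<..} s * indicator {a<..b} s \<partial>lborel) =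
      (\<integral>\<^sup>+ s. ennreal (indicator {max 0 a<..b} s *\<^sub>R f s) \<partial>lborel)"
      by (intro nn_integral_cong) (auto simp: indicator_def)
    also have "\<dots> = ennreal (LINT s:{max 0 a<..b}|lborel. f s)"
      unfolding set_lebesgue_integral_def
      by (rule nn_integral_eq_integral) (use int b in \<open>auto simp: set_integrable_def\<close>)
    finally show ?thesis using diff[OF that] by simp
  qed
  then show "\<And>a b. a \<le> b \<Longrightarrow>
      (\<integral>\<^sup>+ s. ennreal (f s) * indicator {0<..} s * indicator {a<..b} s \<partial>lborel) =
        ennreal ((LINT s:{0<..b}|lborel. f s) - (LINT s:{0<..a}|lborel. f s))"
    by (simp add: F_def)
  have mono: "F a \<le> F b" if "a \<le> b" for a b using bd[OF that] by linarith
  then show "\<And>a b. a \<le> b \<Longrightarrow> (LINT s:{0<..a}|lborel. f s) \<le> (LINT s:{0<..b}|lborel. f s)"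
    by (simp add: F_def)
  have "interval_measure F = density lborel (\<lambda>s. ennreal (f s) * indicator {0<..} s)"
  proof (rule interval_measure_eqI)
    show "F a \<le> F b" if "a \<le> b" for a b using mono[OF that] .
    show "continuous (at_right a) F" for a
      unfolding continuous_within
    proof (rule tendsto_sandwich[of "\<lambda>_. F a" _ _ "\<lambda>u. F a + K * (u - a)"])
      show "\<forall>\<^sub>F n in at_right a. F a \<le> F n" "\<forall>\<^sub>F n in at_right a. F n \<le> F a + K * (n - a)"
        unfolding eventually_at_filter using bd[of a] by (auto simp: algebra_simps intro!: always_eventually)
      show "((\<lambda>u. F a + K * (u - a)) \<longlongrightarrow> F a) (at_right a)"
        by (rule tendsto_eq_intros refl | simp)+
    qed simp
    show "emeasure (density lborel (\<lambda>s. ennreal (f s) * indicator {0<..} s)) {a<..b} = ennreal (F b - F a)"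
      if "a \<le> b" for a b
      by (subst emeasure_density) (use nn[OF that] in auto)
  qed simp
  then show "interval_measure (\<lambda>u. LINT s:{0<..u}|lborel. f s) =
      density lborel (\<lambda>s. ennreal (f s) * indicator {0<..} s)"
    by (simp add: F_def[abs_def])
qed


section \<open>Filtrations and martingales\<close>

text \<open>Both \<F> and \<G> are instances, so facts on martingales and predictable processes are
  available for each. Only nonnegative times are constrained.\<close>

locale filtered_prob_space = prob_space P for P :: "'w measure" +
  fixes H :: "real \<Rightarrow> 'w measure"
  assumes sub: "0 \<le> t \<Longrightarrow> subalgebra P (H t)"
    and mono: "0 \<le> s \<Longrightarrow> s \<le> t \<Longrightarrow> sets (H s) \<subseteq> sets (H t)"
begin

lemma sets_H: "0 \<le> t \<Longrightarrow> A \<in> sets (H t) \<Longrightarrow> A \<in> sets P"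
  using sub by (auto simp: subalgebra_def)

lemma space_H: "0 \<le> t \<Longrightarrow> space (H t) = space P"
  using sub by (auto simp: subalgebra_def)

lemma subalgebra_mono: "0 \<le> s \<Longrightarrow> s \<le> t \<Longrightarrow> subalgebra (H t) (H s)"
  using mono[of s t] space_H[of s] space_H[of t] by (auto simp: subalgebra_def)

lemma measurable_H_P: "0 \<le> t \<Longrightarrow> f \<in> measurable (H t) M \<Longrightarrow> f \<in> measurable P M"
  using measurable_from_subalg[OF sub] by blast

lemma measurable_H_mono: "0 \<le> s \<Longrightarrow> s \<le> t \<Longrightarrow> f \<in> measurable (H s) M \<Longrightarrow> f \<in> measurable (H t) M"
  using measurable_from_subalg[OF subalgebra_mono] by blast

lemma sigma_finite_subalgebra_H: "0 \<le> t \<Longrightarrow> sigma_finite_subalgebra P (H t)"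
  using sub by (intro finite_measure_subalgebra_is_sigma_finite
      finite_measure_subalgebra.intro finite_measure_axioms) (auto simp: finite_measure_subalgebra_axioms_def)

lemma martingale_set_integral:
  assumes "martingale P H X" "0 \<le> s" "s \<le> t" "A \<in> sets (H s)"
  shows "(LINT \<omega>:A|P. X t \<omega>) = (LINT \<omega>:A|P. X s \<omega>)"
proof -
  interpret sigma_finite_subalgebra P "H s" by (rule sigma_finite_subalgebra_H) fact
  have i: "integrable P (X t)" "integrable P (X s)" and ae: "AE \<omega> in P. real_cond_exp P (H s) (X t) \<omega> = X s \<omega>"
    using assms by (auto simp: martingale_def)
  have "(LINT \<omega>:A|P. X t \<omega>) = (LINT \<omega>:A|P. real_cond_exp P (H s) (X t) \<omega>)"
    using i assms by (intro real_cond_exp_intA) auto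
  also have "\<dots> = (LINT \<omega>:A|P. X s \<omega>)"
    unfolding set_lebesgue_integral_def using ae
    by (intro integral_cong_AE) (use i assms(2,4) sets_H[of s A] in auto)
  finally show ?thesis .
qed

lemma martingaleI:
  assumes "\<And>t. 0 \<le> t \<Longrightarrow> X t \<in> borel_measurable (H t)" "\<And>t. 0 \<le> t \<Longrightarrow> integrable P (X t)"
    "\<And>s t A. 0 \<le> s \<Longrightarrow> s \<le> t \<Longrightarrow> A \<in> sets (H s) \<Longrightarrow> (LINT \<omega>:A|P. X t \<omega>) = (LINT \<omega>:A|P. X s \<omega>)"
  shows "martingale P H X"
  unfolding martingale_def
proof (intro conjI allI impI)
  fix s t :: real assume st: "0 \<le> s \<and> s \<le> t"
  then interpret sigma_finite_subalgebra P "H s" by (intro sigma_finite_subalgebra_H) simp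
  show "AE \<omega> in P. real_cond_exp P (H s) (X t) \<omega> = X s \<omega>"
    by (rule real_cond_exp_charact) (use assms st in auto)
qed (use assms in auto)


section \<open>Predictable processes\<close>

lemma space_predictable: "space (predictable_algebra P H) = {0..} \<times> space P"
  by (simp add: predictable_algebra_def space_measure_of_conv)

lemma predictable_generator:
  "{{0::real} \<times> A |A. A \<in> sets (H 0)} \<union> {{s<..t} \<times> A |s t A. 0 \<le> s \<and> s \<le> t \<and> A \<in> sets (H s)}
    \<subseteq> Pow ({0..} \<times> space P)"
proof -
  have "A \<subseteq> space P" if "A \<in> sets (H s)" "0 \<le> s" for A s
    using sets_H[OF that(2,1)] sets.sets_into_space by blast
  then show ?thesis by fastforce
qed

lemma sets_predictable: "sets (predictable_algebra P H) = sigma_sets ({0..} \<times> space P)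
    ({{0} \<times> A |A. A \<in> sets (H 0)} \<union> {{s<..t} \<times> A |s t A. 0 \<le> s \<and> s \<le> t \<and> A \<in> sets (H s)})"
  unfolding predictable_algebra_def by (rule sets_measure_of[OF predictable_generator])

text \<open>The generator of the predictable \<sigma>-algebra, named because it also serves as the
  intersection-stable system on which two measures are compared.\<close>

definition predictable_rectangles :: "(real \<times> 'w) set set" where
  "predictable_rectangles = {{0::real} \<times> A |A. A \<in> sets (H 0)} \<union>
     {{s<..t} \<times> A |s t A. 0 \<le> s \<and> s \<le> t \<and> A \<in> sets (H s)}"

lemma rectangle_0: "A \<in> sets (H 0) \<Longrightarrow> {0} \<times> A \<in> predictable_rectangles"
  unfolding predictable_rectangles_def by (rule UnI1) blast

lemma rectangle_Ioc: "0 \<le> s \<Longrightarrow> s \<le> t \<Longrightarrow> A \<in> sets (H s) \<Longrightarrow> {s<..t} \<times> A \<in> predictable_rectangles"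
  unfolding predictable_rectangles_def by (rule UnI2) blast

lemma rectangle_cases:
  assumes "X \<in> predictable_rectangles"
  obtains A where "X = {0} \<times> A" "A \<in> sets (H 0)"
    | s t A where "X = {s<..t} \<times> A" "0 \<le> s" "s \<le> t" "A \<in> sets (H s)"
  using assms unfolding predictable_rectangles_def by (elim UnE CollectE exE conjE) blast+

text \<open>The intersection of two half-open intervals starts at the larger left endpoint, and by
  monotonicity of H both events are known there. A rectangle at time 0 never meets one over a
  half-open interval.\<close>

lemma Int_stable_rectangles: "Int_stable predictable_rectangles"
proof (rule Int_stableI)
  have e: "{} \<in> predictable_rectangles" using rectangle_0[of "{}"] by simp
  fix X Y assume X: "X \<in> predictable_rectangles" and Y: "Y \<in> predictable_rectangles"
  show "X \<inter> Y \<in> predictable_rectangles"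
  proof (cases rule: rectangle_cases[OF X]; cases rule: rectangle_cases[OF Y])
    fix A B assume *: "X = {0} \<times> A" "A \<in> sets (H 0)" "Y = {0} \<times> B" "B \<in> sets (H 0)"
    then have "X \<inter> Y = {0} \<times> (A \<inter> B)" by auto
    then show ?thesis using * rectangle_0[of "A \<inter> B"] by simp
  next
    fix A s t B assume "X = {0} \<times> A" "Y = {s<..t} \<times> B" "0 \<le> s"
    then have "X \<inter> Y = {}" by auto
    then show ?thesis using e by simp
  next
    fix A s t B assume "X = {s<..t} \<times> B" "0 \<le> s" "Y = {0} \<times> A"
    then have "X \<inter> Y = {}" by auto
    then show ?thesis using e by simp
  next
    fix s t A s' t' B assume *: "X = {s<..t} \<times> A" "0 \<le> s" "A \<in> sets (H s)"
      "Y = {s'<..t'} \<times> B" "0 \<le> s'" "B \<in> sets (H s')"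
    show ?thesis
    proof (cases "max s s' \<le> min t t'")
      case True
      have "A \<inter> B \<in> sets (H (max s s'))"
        using * mono[of s "max s s'"] mono[of s' "max s s'"] by (intro sets.Int) auto
      then have "{max s s'<..min t t'} \<times> (A \<inter> B) \<in> predictable_rectangles"
        using * True by (intro rectangle_Ioc) auto
      moreover have "X \<inter> Y = {max s s'<..min t t'} \<times> (A \<inter> B)" using * by auto
      ultimately show ?thesis by simp
    next
      case False
      then have "X \<inter> Y = {}" using * by auto
      then show ?thesis using e by simp
    qed
  qed
qed

lemma predictable_rectangles_cover:
  obtains R :: "nat \<Rightarrow> (real \<times> 'w) set"
  where "range R \<subseteq> predictable_rectangles" "(\<Union>n. R n) = {0..} \<times> space P"
proof
  define R where "R n = (if n = 0 then {0} \<times> space P else {0<..real n} \<times> space P)" for n :: nat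
  have "space P \<in> sets (H 0)" using sets.top[of "H 0"] by (simp add: space_H)
  then show "range R \<subseteq> predictable_rectangles"
    by (intro image_subsetI) (simp add: R_def rectangle_0 rectangle_Ioc)
  show "(\<Union>n. R n) = {0..} \<times> space P"
  proof (intro equalityI subsetI)
    fix x assume x: "x \<in> {0::real..} \<times> space P"
    obtain k where "fst x \<le> real k" using real_arch_simple by blast
    then have "x \<in> R (if fst x = 0 then 0 else Suc k)" using x by (cases x) (auto simp: R_def)
    then show "x \<in> (\<Union>n. R n)" by blast
  next
    fix x assume "x \<in> (\<Union>n. R n)"
    then obtain n where "x \<in> R n" by blast
    then show "x \<in> {0::real..} \<times> space P" by (cases "n = 0") (auto simp: R_def)
  qed
qed

lemma predictable_0I: "A \<in> sets (H 0) \<Longrightarrow> {0} \<times> A \<in> sets (predictable_algebra P H)"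
  unfolding sets_predictable by (rule sigma_sets.Basic) auto

lemma predictable_IocI: "0 \<le> s \<Longrightarrow> A \<in> sets (H s) \<Longrightarrow> {s<..t} \<times> A \<in> sets (predictable_algebra P H)"
proof (cases "s \<le> t")
  case True
  then show "0 \<le> s \<Longrightarrow> A \<in> sets (H s) \<Longrightarrow> {s<..t} \<times> A \<in> sets (predictable_algebra P H)"
    unfolding sets_predictable by (intro sigma_sets.Basic) auto
qed auto

lemma measurable_predictableI:
  assumes "\<And>x. x \<in> space M \<Longrightarrow> f x \<in> {0..} \<times> space P"
    "\<And>A. A \<in> sets (H 0) \<Longrightarrow> f -` ({0} \<times> A) \<inter> space M \<in> sets M"
    "\<And>s t A. 0 \<le> s \<Longrightarrow> s \<le> t \<Longrightarrow> A \<in> sets (H s) \<Longrightarrow> f -` ({s<..t} \<times> A) \<inter> space M \<in> sets M"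
  shows "f \<in> measurable M (predictable_algebra P H)"
  unfolding predictable_algebra_def
  by (rule measurable_measure_of[OF predictable_generator]) (use assms in auto)

text \<open>Predictable sets are product measurable. The clamp at 0 is there because the predictable
  \<sigma>-algebra lives on \<open>{0..} \<times> space P\<close>, whereas \<open>borel\<close>
  covers the whole line; negative times are sent to time 0.\<close>

lemma predictable_algebra_clamp:
  "(\<lambda>x. (max 0 (fst x), snd x)) \<in> measurable (borel \<Otimes>\<^sub>M P) (predictable_algebra P H)"
proof (rule measurable_predictableI)
  fix A assume "A \<in> sets (H 0)"
  then have A[measurable]: "A \<in> sets P" using sets_H[of 0 A] by simp
  have "(\<lambda>x. (max 0 (fst x), snd x)) -` ({0::real} \<times> A) \<inter> space (borel \<Otimes>\<^sub>M P) = {..0} \<times> A"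
    using sets.sets_into_space[OF A] by (auto simp: space_pair_measure)
  then show "(\<lambda>x. (max 0 (fst x), snd x)) -` ({0::real} \<times> A) \<inter> space (borel \<Otimes>\<^sub>M P) \<in> sets (borel \<Otimes>\<^sub>M P)"
    by simp
next
  fix s t A assume *: "(0::real) \<le> s" "s \<le> t" "A \<in> sets (H s)"
  then have A[measurable]: "A \<in> sets P" using sets_H[of s A] by simp
  have "(\<lambda>x. (max 0 (fst x), snd x)) -` ({s<..t} \<times> A) \<inter> space (borel \<Otimes>\<^sub>M P) = {s<..t} \<times> A"
    using sets.sets_into_space[OF A] * by (auto simp: space_pair_measure)
  then show "(\<lambda>x. (max 0 (fst x), snd x)) -` ({s<..t} \<times> A) \<inter> space (borel \<Otimes>\<^sub>M P) \<in> sets (borel \<Otimes>\<^sub>M P)"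
    by simp
qed (auto simp: space_pair_measure)

text \<open>Fixing the time t pulls \<open>{s<..u} \<times> A\<close> back to A or to the empty set,
  and A can remain only if s < t, when it already belongs to \<open>H t\<close>.\<close>

lemma predictable_algebra_slice:
  assumes "0 \<le> t"
  shows "(\<lambda>\<omega>. (t, \<omega>)) \<in> measurable (H t) (predictable_algebra P H)"
proof (rule measurable_predictableI)
  fix A assume "A \<in> sets (H 0)"
  then have "A \<in> sets (H t)" using mono[of 0 t] assms by auto
  then show "(\<lambda>\<omega>. (t, \<omega>)) -` ({0} \<times> A) \<inter> space (H t) \<in> sets (H t)"
    by (cases "t = 0") (auto simp: vimage_def intro: sets.Int)
next
  fix s u A assume *: "(0::real) \<le> s" "s \<le> u" "A \<in> sets (H s)"
  have "(\<lambda>\<omega>. (t, \<omega>)) -` ({s<..u} \<times> A) = (if s < t \<and> t \<le> u then A else {})" by auto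
  moreover have "A \<in> sets (H t)" if "s < t" using mono[of s t] * that by auto
  ultimately show "(\<lambda>\<omega>. (t, \<omega>)) -` ({s<..u} \<times> A) \<inter> space (H t) \<in> sets (H t)" by auto
qed (use assms space_H in auto)

lemma predictable_on_section:
  assumes "predictable_on P H J X" "t \<in> J" "0 \<le> t"
  shows "X t \<in> borel_measurable (H t)"
proof -
  have "(\<lambda>\<omega>. (t, \<omega>)) \<in> measurable (H t) (restrict_space (predictable_algebra P H) (J \<times> space P))"
    using assms space_H by (intro measurable_restrict_space2 predictable_algebra_slice) auto
  from measurable_compose[OF this assms(1)[unfolded predictable_on_def]] show ?thesis by simp
qed

lemma predictable_strip: "{0..T} \<times> space P \<in> sets (predictable_algebra P H)"
proof (cases "0 \<le> T")
  case True
  have "{0..T} \<times> space P = {0} \<times> space P \<union> {0<..T} \<times> space P" using True by auto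
  moreover have "space P \<in> sets (H 0)" using sets.top[of "H 0"] space_H[of 0] by simp
  ultimately show ?thesis by (auto intro!: predictable_0I predictable_IocI)
qed auto

lemma predictable_half_line: "{0..} \<times> space P \<in> sets (predictable_algebra P H)"
  using sets.top[of "predictable_algebra P H"] by (simp only: space_predictable)

text \<open>\<open>predictable_on\<close> leaves the values outside J free, so joint measurability
  can be claimed only after multiplication by the indicator of J.\<close>

lemma predictable_on_product:
  fixes X :: "real \<Rightarrow> 'w \<Rightarrow> 'b::{real_normed_vector, second_countable_topology}"
  assumes X: "predictable_on P H J X" and J: "J \<times> space P \<in> sets (predictable_algebra P H)" 
    "J \<in> sets borel" "J \<subseteq> {0..}"
  shows "(\<lambda>x. indicator J (fst x) *\<^sub>R X (fst x) (snd x)) \<in> borel_measurable (borel \<Otimes>\<^sub>M P)"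
proof -
  have "(\<lambda>x. indicator (J \<times> space P) x *\<^sub>R (case x of (t, \<omega>) \<Rightarrow> X t \<omega>)) \<in> borel_measurable (predictable_algebra P H)"
    using X unfolding predictable_on_def 
    by (subst (asm) borel_measurable_restrict_space_iff) (use J in \<open>auto intro!: sets.Int simp del: Times_Int_Times\<close>)
  note [measurable] = measurable_compose[OF predictable_algebra_clamp this] J(2)
  have "(\<lambda>x. indicator J (fst x) *\<^sub>R (indicator (J \<times> space P) (max 0 (fst x), snd x) *\<^sub>R
      (case (max 0 (fst x), snd x) of (t, \<omega>) \<Rightarrow> X t \<omega>))) \<in> borel_measurable (borel \<Otimes>\<^sub>M P)"
    by measurable
  also have "?this \<longleftrightarrow> ?thesis"
    by (intro measurable_cong) (use J in \<open>auto simp: space_pair_measure indicator_def max_def\<close>)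
  finally show ?thesis .
qed

lemma predictable_on_path:
  fixes X :: "real \<Rightarrow> 'w \<Rightarrow> 'b::{real_normed_vector, second_countable_topology}"
  assumes X: "predictable_on P H J X" and J: "J \<times> space P \<in> sets (predictable_algebra P H)" 
    "J \<in> sets borel" "J \<subseteq> {0..}" and \<omega>: "\<omega> \<in> space P"
  shows "(\<lambda>t. indicator J t *\<^sub>R X t \<omega>) \<in> borel_measurable borel"
  using measurable_compose[OF measurable_Pair2'[OF \<omega>] predictable_on_product[OF assms(1-4)]] by simp

end

section \<open>Change of filtration, and predictability of the interval up to a stopping
  time\<close>

lemma predictable_on_filtration_mono:
  assumes "filtered_prob_space P H" "filtered_prob_space P K" "\<And>t. 0 \<le> t \<Longrightarrow> sets (H t) \<subseteq> sets (K t)"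
    and X: "predictable_on P H J X"
  shows "predictable_on P K J X"
proof -
  interpret H: filtered_prob_space P H by fact
  interpret K: filtered_prob_space P K by fact
  have "(\<lambda>x. x) \<in> measurable (predictable_algebra P K) (predictable_algebra P H)"
  proof (rule H.measurable_predictableI)
    fix A assume *: "A \<in> sets (H 0)"
    then have "A \<subseteq> space P" using H.sets_H[of 0 A] sets.sets_into_space by blast
    then have "{0} \<times> A \<inter> {0::real..} \<times> space P = {0} \<times> A" by auto
    then show "(\<lambda>x. x) -` ({0} \<times> A) \<inter> space (predictable_algebra P K) \<in> sets (predictable_algebra P K)"
      using assms(3)[of 0] * K.predictable_0I by (auto simp: K.space_predictable)
  next
    fix s t A assume *: "0 \<le> s" "s \<le> t" "A \<in> sets (H s)"
    then have "A \<subseteq> space P" using H.sets_H[of s A] sets.sets_into_space by blast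
    then have "{s<..t} \<times> A \<inter> {0::real..} \<times> space P = {s<..t} \<times> A" using * by auto
    then show "(\<lambda>x. x) -` ({s<..t} \<times> A) \<inter> space (predictable_algebra P K) \<in> sets (predictable_algebra P K)"
      using assms(3)[of s] * K.predictable_IocI by (auto simp: K.space_predictable)
  qed (auto simp: K.space_predictable)
  then have "(\<lambda>x. x) \<in> measurable (restrict_space (predictable_algebra P K) (J \<times> space P))
      (restrict_space (predictable_algebra P H) (J \<times> space P))"
    by (rule measurable_restrict_space3) simp
  from measurable_compose[OF this X[unfolded predictable_on_def]] show ?thesis
    by (simp add: predictable_on_def)
qed

text \<open>The complement consists of the points with \<tau> < t. Some rational r satisfies \<tau>
  \<le> r < t, so it is a countable union of rectangles
  \<open>{r<..r + n} \<times> {\<tau> \<le> r}\<close>; the second index n is there because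
  generating intervals are bounded. The non-strict inequality in the statement is what produces the
  left-open intervals.\<close>

lemma (in filtered_prob_space) predictable_before:
  fixes \<tau> :: "'w \<Rightarrow> ereal"
  assumes \<tau>: "\<And>t. 0 \<le> t \<Longrightarrow> {\<omega>\<in>space P. \<tau> \<omega> \<le> ereal t} \<in> sets (H t)" "\<And>\<omega>. \<omega> \<in> space P \<Longrightarrow> 0 \<le> \<tau> \<omega>"
  shows "Measurable.pred (predictable_algebra P H) (\<lambda>x. ereal (fst x) \<le> \<tau> (snd x))"
proof -
  let ?B = "\<Union>r\<in>{r::rat. 0 \<le> r}. \<Union>n. {real_of_rat r<..real_of_rat r + real n} \<times> {\<omega>\<in>space P. \<tau> \<omega> \<le> ereal (real_of_rat r)}"
  have "{x \<in> space (predictable_algebra P H). \<not> ereal (fst x) \<le> \<tau> (snd x)} = ?B"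
  proof (intro equalityI subsetI)
    fix x assume x: "x \<in> {x \<in> space (predictable_algebra P H). \<not> ereal (fst x) \<le> \<tau> (snd x)}"
    then have lt: "\<tau> (snd x) < ereal (fst x)" and sp: "snd x \<in> space P" by (auto simp: space_predictable)
    have "0 \<le> \<tau> (snd x)" using \<tau>(2) sp by auto
    then obtain r where r: "\<tau> (snd x) = ereal r" "0 \<le> r" "r < fst x"
      using lt by (cases "\<tau> (snd x)") auto
    then obtain q where q: "r < real_of_rat q" "real_of_rat q < fst x"
      using of_rat_dense by blast
    then have "0 \<le> q" using r zero_less_of_rat_iff[of q, where ?'a = real] by linarith
    moreover obtain n where "fst x - real_of_rat q < real n" using reals_Archimedean2 by blast
    ultimately show "x \<in> ?B" using q r sp by (cases x) (auto intro!: bexI[of _ q] exI[of _ n])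
  next
    fix x assume "x \<in> ?B"
    then obtain q n where *: "0 \<le> q" "real_of_rat q < fst x" "snd x \<in> space P" "\<tau> (snd x) \<le> ereal (real_of_rat q)"
      by auto
    then have "0 \<le> real_of_rat q" by simp
    then have "0 \<le> fst x" using * by linarith
    moreover have "\<tau> (snd x) < ereal (fst x)"
      using *(4) by (rule le_less_trans) (simp add: *)
    ultimately show "x \<in> {x \<in> space (predictable_algebra P H). \<not> ereal (fst x) \<le> \<tau> (snd x)}"
      using * by (cases x) (auto simp: space_predictable)
  qed
  moreover have "?B \<in> sets (predictable_algebra P H)"
    by (intro sets.countable_UN' sets.countable_UN) (auto intro!: predictable_IocI \<tau>)
  ultimately have "{x \<in> space (predictable_algebra P H). \<not> ereal (fst x) \<le> \<tau> (snd x)} \<in> sets (predictable_algebra P H)"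
    by simp
  from sets.compl_sets[OF this] show ?thesis
    unfolding pred_def by (rule back_subst[of "\<lambda>A. A \<in> sets (predictable_algebra P H)"]) auto
qed


section \<open>The two filtrations\<close>

text \<open>The minimum with a finite time is finite unless r = -\<infinity>, where
  \<open>real_of_ereal\<close> would return the default 0; \<open>0 \<le> r\<close> excludes this.
  In this form questions about the truncated time reduce to comparisons with u and r
  separately.\<close>

lemma le_stopped_iff: "0 \<le> r \<Longrightarrow> s \<le> stopped u r \<longleftrightarrow> s \<le> u \<and> ereal s \<le> r"
  by (cases r) (auto simp: stopped_def min_def)

lemma stopped_nonneg: "0 \<le> r \<Longrightarrow> 0 \<le> u \<Longrightarrow> 0 \<le> stopped u r"
  using le_stopped_iff[of r 0 u] by (simp add: zero_ereal_def)

locale default_market =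
  fixes P :: "'w measure" and W :: "real \<Rightarrow> 'w \<Rightarrow> real ^ 'n" and \<tau> :: "'w \<Rightarrow> ereal"
    and lam :: "real \<Rightarrow> 'w \<Rightarrow> real"
  assumes setting: "default_setting P W \<tau> lam"

sublocale default_market \<subseteq> prob_space P
  using setting by (simp add: default_setting_def)

context default_market
begin

abbreviation "\<F> \<equiv> filt_F P W"
abbreviation "\<G> \<equiv> filt_G P W \<tau>"

lemma null_subset: "N \<in> null_sets P \<Longrightarrow> A \<subseteq> N \<Longrightarrow> A \<in> null_sets P"
  using setting complete_measure.complete2[of P A N] by (simp add: default_setting_def)

lemma W_measurable[measurable]: "0 \<le> t \<Longrightarrow> W t \<in> borel_measurable P"
  using setting by (simp add: default_setting_def standard_brownian_motion_def)

lemma W_cont: "AE \<omega> in P. continuous_on {0..} (\<lambda>t. W t \<omega>)"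
  using setting by (simp add: default_setting_def standard_brownian_motion_def)

lemma \<tau>_measurable[measurable]: "\<tau> \<in> borel_measurable P"
  using setting by (simp add: default_setting_def)

lemma \<tau>_nonneg: "\<omega> \<in> space P \<Longrightarrow> 0 \<le> \<tau> \<omega>"
  using setting by (simp add: default_setting_def)

lemma sets_natural: "sets (natural_filtration P W t) =
    sigma_sets (space P) {W s -` B \<inter> space P |s B. 0 \<le> s \<and> s \<le> t \<and> B \<in> sets borel}"
  unfolding natural_filtration_def by (rule sets_measure_of) auto

lemma sets_natural_P: "A \<in> sets (natural_filtration P W t) \<Longrightarrow> A \<in> sets P"
proof -
  have "sigma_sets (space P) {W s -` B \<inter> space P |s B. 0 \<le> s \<and> s \<le> t \<and> B \<in> sets borel} \<subseteq> sets P"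
    by (rule sets.sigma_sets_subset) (auto intro: measurable_sets W_measurable)
  then show "A \<in> sets (natural_filtration P W t) \<Longrightarrow> A \<in> sets P" by (auto simp: sets_natural)
qed

lemma natural_mono: "s \<le> t \<Longrightarrow> sets (natural_filtration P W s) \<subseteq> sets (natural_filtration P W t)"
  unfolding sets_natural by (rule sigma_sets_mono') (use order_trans in blast)

lemma sets_F: "sets (\<F> t) = sigma_sets (space P) (sets (natural_filtration P W t) \<union> null_sets P)"
  unfolding augmented_filtration_def
  by (rule sets_measure_of) (auto dest!: sets_natural_P sets.sets_into_space[where M = P])

lemma space_F: "space (\<F> t) = space P"
  by (simp add: augmented_filtration_def space_measure_of_conv)

lemma sets_F_P: "A \<in> sets (\<F> t) \<Longrightarrow> A \<in> sets P"
proof -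
  have "sets (\<F> t) \<subseteq> sets P"
    unfolding sets_F by (rule sets.sigma_sets_subset) (auto dest: sets_natural_P)
  then show "A \<in> sets (\<F> t) \<Longrightarrow> A \<in> sets P" by auto
qed

lemma F_mono: "s \<le> t \<Longrightarrow> sets (\<F> s) \<subseteq> sets (\<F> t)"
  unfolding sets_F by (rule sigma_sets_mono') (use natural_mono in blast)

lemma null_F: "N \<in> null_sets P \<Longrightarrow> N \<in> sets (\<F> t)"
  unfolding sets_F by (rule sigma_sets.Basic) simp

abbreviation raw_G :: "real \<Rightarrow> 'w set set" where
  "raw_G t \<equiv> sigma_sets (space P) (sets (\<F> t) \<union> {{\<omega> \<in> space P. \<tau> \<omega> \<le> ereal u} |u. 0 \<le> u \<and> u \<le> t})"

lemma raw_G_P: "raw_G t \<subseteq> sets P"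
  by (rule sets.sigma_sets_subset) (auto dest: sets_F_P)

text \<open>An intersection of \<sigma>-algebras is itself one and so equals what it generates.
  Membership in \<open>\<G> t\<close> can therefore be tested in each
  \<open>raw_G (t + \<epsilon>)\<close>.\<close>

lemma sets_G: "sets (\<G> t) = (\<Inter>\<epsilon>\<in>{0<..}. raw_G (t + \<epsilon>))"
proof -
  have s: "sigma_algebra (space P) (\<Inter>\<epsilon>\<in>{0<..}. raw_G (t + \<epsilon>))"
  proof -
    have *: "sigma_algebra (space P) (raw_G (t + \<epsilon>))" for \<epsilon>
      by (rule sigma_algebra_sigma_sets) (auto dest!: sets_F_P sets.sets_into_space[where M = P])
    have "raw_G (t + 1) \<subseteq> Pow (space P)" using *[of 1] by (simp add: sigma_algebra_iff2)
    then have 1: "(\<Inter>\<epsilon>\<in>{0<..}. raw_G (t + \<epsilon>)) \<subseteq> Pow (space P)"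
      by (intro subset_trans[OF INF_lower[of 1]]) auto
    show ?thesis
      unfolding sigma_algebra_iff2
    proof (intro conjI 1 ballI allI impI)
      show "{} \<in> (\<Inter>\<epsilon>\<in>{0<..}. raw_G (t + \<epsilon>))" by (auto intro: sigma_sets.Empty)
      show "space P - s \<in> (\<Inter>\<epsilon>\<in>{0<..}. raw_G (t + \<epsilon>))" if "s \<in> (\<Inter>\<epsilon>\<in>{0<..}. raw_G (t + \<epsilon>))" for s
        using that by (auto intro: sigma_sets.Compl)
      show "(\<Union>i. A i) \<in> (\<Inter>\<epsilon>\<in>{0<..}. raw_G (t + \<epsilon>))" if "range A \<subseteq> (\<Inter>\<epsilon>\<in>{0<..}. raw_G (t + \<epsilon>))" for A :: "nat \<Rightarrow> 'w set"
        using that by (intro INT_I sigma_sets.Union) blast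
    qed
  qed
  have "(\<Inter>\<epsilon>\<in>{0<..}. raw_G (t + \<epsilon>)) \<subseteq> Pow (space P)"
    using s unfolding sigma_algebra_iff2 by simp
  then have "sets (\<G> t) = sigma_sets (space P) (\<Inter>\<epsilon>\<in>{0<..}. raw_G (t + \<epsilon>))"
    unfolding enlarged_filtration_def by (rule sets_measure_of)
  then show ?thesis using sigma_algebra.sigma_sets_eq[OF s] by simp
qed

lemma space_G: "space (\<G> t) = space P"
  by (simp add: enlarged_filtration_def space_measure_of_conv)

lemma sets_G_P: "A \<in> sets (\<G> t) \<Longrightarrow> A \<in> sets P"
  using raw_G_P[of "t + 1"] by (auto simp: sets_G)

lemma F_G: "sets (\<F> t) \<subseteq> sets (\<G> t)"
    unfolding sets_G
proof (intro subsetI INT_I)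
  fix A and \<epsilon> :: real assume "A \<in> sets (\<F> t)" "\<epsilon> \<in> {0<..}"
  then have "A \<in> sets (\<F> (t + \<epsilon>))" using F_mono[of t "t + \<epsilon>"] by auto
  then show "A \<in> raw_G (t + \<epsilon>)" by (intro sigma_sets.Basic) simp
qed

lemma G_mono: "s \<le> t \<Longrightarrow> sets (\<G> s) \<subseteq> sets (\<G> t)"
proof -
  assume "s \<le> t"
  then have "raw_G (s + \<epsilon>) \<subseteq> raw_G (t + \<epsilon>)" for \<epsilon>
    using F_mono[of "s + \<epsilon>" "t + \<epsilon>"] by (intro sigma_sets_mono' Un_mono) (auto intro: order_trans)
  then show ?thesis unfolding sets_G by blast
qed

lemma \<tau>_stopping: "0 \<le> t \<Longrightarrow> {\<omega> \<in> space P. \<tau> \<omega> \<le> ereal t} \<in> sets (\<G> t)"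
  unfolding sets_G by (auto intro!: sigma_sets.Basic exI[of _ t])

lemma null_G: "N \<in> null_sets P \<Longrightarrow> N \<in> sets (\<G> t)"
  using null_F F_G by blast

end

sublocale default_market \<subseteq> F: filtered_prob_space P \<F>
proof (intro filtered_prob_space.intro filtered_prob_space_axioms.intro)
  show "prob_space P" by unfold_locales
  show "subalgebra P (\<F> t)" for t
    using sets_F_P[of _ t] space_F[of t] by (simp add: subalgebra_def subsetI)
qed (rule F_mono)

sublocale default_market \<subseteq> G: filtered_prob_space P \<G>
proof (intro filtered_prob_space.intro filtered_prob_space_axioms.intro)
  show "prob_space P" by unfold_locales
  show "subalgebra P (\<G> t)" for t
    using sets_G_P[of _ t] space_G[of t] by (simp add: subalgebra_def subsetI)
qed (rule G_mono)

section \<open>Transfer from \<F> to \<G>, and the initial \<sigma>-algebra\<close>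

context default_market
begin

lemma predictable_F_G: "predictable_on P \<F> J X \<Longrightarrow> predictable_on P \<G> J X"
  by (rule predictable_on_filtration_mono[OF F.filtered_prob_space_axioms G.filtered_prob_space_axioms F_G])

lemma measurable_F_G: "f \<in> measurable (\<F> t) M \<Longrightarrow> f \<in> measurable (\<G> t) M"
  by (rule measurable_from_subalg[of _ "\<F> t"]) (simp add: subalgebra_def space_F space_G F_G)

lemma martingale_F_G: "martingale P \<F> X \<Longrightarrow> martingale P \<G> X"
  using setting by (simp add: default_setting_def)

text \<open>Events that are almost surely true or almost surely false are closed under complements
  and countable unions, and include null sets and all events \<open>W 0 \<in> B\<close>, as W starts
  at 0 almost surely. No zero-one law is involved: \<F> at time 0 is not defined as a right
  limit.\<close>

lemma F0_trivial:
  assumes "A \<in> sets (\<F> 0)"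
  shows "(AE \<omega> in P. \<omega> \<in> A) \<or> (AE \<omega> in P. \<omega> \<notin> A)"
proof -
  have compl: "(AE \<omega> in P. \<omega> \<in> space P - A) \<or> (AE \<omega> in P. \<omega> \<notin> space P - A)"
    if "(AE \<omega> in P. \<omega> \<in> A) \<or> (AE \<omega> in P. \<omega> \<notin> A)" for A
    using that AE_space[of P] by (auto elim: AE_mp)
  have un: "(AE \<omega> in P. \<omega> \<in> (\<Union>i. A i)) \<or> (AE \<omega> in P. \<omega> \<notin> (\<Union>i. A i))"
    if "\<And>i. (AE \<omega> in P. \<omega> \<in> A i) \<or> (AE \<omega> in P. \<omega> \<notin> A i)" for A :: "nat \<Rightarrow> 'w set"
  proof (cases "\<exists>i. AE \<omega> in P. \<omega> \<in> A i")
    case True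
    then obtain i where "AE \<omega> in P. \<omega> \<in> A i" by blast
    then have "AE \<omega> in P. \<omega> \<in> (\<Union>i. A i)" by (auto elim: eventually_mono)
    then show ?thesis by simp
  next
    case False
    then have "\<forall>i. AE \<omega> in P. \<omega> \<notin> A i" using that by blast
    then have "AE \<omega> in P. \<forall>i. \<omega> \<notin> A i" by (simp add: AE_all_countable)
    then show ?thesis by auto
  qed
  have nat: "(AE \<omega> in P. \<omega> \<in> A) \<or> (AE \<omega> in P. \<omega> \<notin> A)"
    if "A \<in> sets (natural_filtration P W 0)" for A
    using that unfolding sets_natural
  proof (induction rule: sigma_sets.induct)
    case (Basic a)
    then obtain B where a: "a = W 0 -` B \<inter> space P" by auto
    have 0: "AE \<omega> in P. W 0 \<omega> = 0"
      using setting by (simp add: default_setting_def standard_brownian_motion_def)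
    show ?case
    proof (cases "0 \<in> B")
      case True
      have "AE \<omega> in P. \<omega> \<in> a" using 0 AE_space[of P] by eventually_elim (simp add: a True)
      then show ?thesis ..
    next
      case False
      have "AE \<omega> in P. \<omega> \<notin> a" using 0 by eventually_elim (simp add: a False)
      then show ?thesis ..
    qed
  qed (use compl un in auto)
  show ?thesis
    using assms unfolding sets_F
  proof (induction rule: sigma_sets.induct)
    case (Basic a)
    then show ?case using nat AE_not_in[of a P] by auto
  qed (use compl un in auto)
qed

text \<open>If no n bounds X almost surely, triviality makes every event \<bar>X\<bar> \<le> n null,
  although these events exhaust the space.\<close>

lemma F0_bounded:
  fixes X :: "'w \<Rightarrow> real"
  assumes "X \<in> borel_measurable (\<F> 0)"
  shows "\<exists>K. AE \<omega> in P. \<bar>X \<omega>\<bar> \<le> K"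
proof (rule ccontr)
  assume *: "\<not> ?thesis"
  have "{\<omega> \<in> space (\<F> 0). \<bar>X \<omega>\<bar> \<le> real n} \<in> sets (\<F> 0)" for n
    using assms by measurable
  from F0_trivial[OF this] have "AE \<omega> in P. \<not> \<bar>X \<omega>\<bar> \<le> real n" for n
    using * AE_space[of P] by (auto simp: space_F elim: AE_mp)
  then have "AE \<omega> in P. \<forall>n. \<not> \<bar>X \<omega>\<bar> \<le> real n" by (simp add: AE_all_countable)
  then have "AE \<omega> in P. False"
    by eventually_elim (use real_arch_simple in blast)
  then show False by simp
qed

end


section \<open>The compensator of the random time\<close>

context default_market
begin

lemma lam_predictable: "predictable_on P \<F> {0..} lam"
  using setting by (simp add: default_setting_def)

lemma lam_bounded: "\<exists>K. 0 \<le> K \<and> (\<forall>t\<ge>0. \<forall>\<omega>\<in>space P. 0 \<le> lam t \<omega> \<and> lam t \<omega> \<le> K)"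
proof -
  have "\<exists>K. \<forall>t\<ge>0. \<forall>\<omega>\<in>space P. 0 \<le> lam t \<omega> \<and> lam t \<omega> \<le> K"
    using setting by (simp add: default_setting_def)
  then obtain K where K: "\<forall>t\<ge>0. \<forall>\<omega>\<in>space P. 0 \<le> lam t \<omega> \<and> lam t \<omega> \<le> K" ..
  then have "\<forall>t\<ge>0. \<forall>\<omega>\<in>space P. 0 \<le> lam t \<omega> \<and> lam t \<omega> \<le> max K 0" by force
  then show ?thesis by (intro exI[of _ "max K 0"]) auto
qed

lemma lam_product[measurable]:
  "(\<lambda>x. lam (max 0 (fst x)) (snd x)) \<in> borel_measurable (borel \<Otimes>\<^sub>M P)"
proof -
  have "(\<lambda>x. indicator {0..} (fst x) *\<^sub>R lam (fst x) (snd x)) \<in> borel_measurable (borel \<Otimes>\<^sub>M P)"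
    by (rule F.predictable_on_product[OF lam_predictable F.predictable_half_line]) auto
  then have "(\<lambda>x. indicator {0..} (fst (max 0 (fst x), snd x)) *\<^sub>R lam (fst (max 0 (fst x), snd x)) (snd (max 0 (fst x), snd x)))
      \<in> borel_measurable (borel \<Otimes>\<^sub>M P)"
    by (rule measurable_compose[rotated]) measurable
  then show ?thesis by simp
qed

text \<open>The intensity \<open>\<lambda>\<^sup>G\<close> with its time clamped at 0. As
  \<open>lam\<close> is controlled at nonnegative times only, the clamp gives a bounded,
  nonnegative, jointly measurable function on the whole line, to which the density results for
  \<open>interval_measure\<close> apply.\<close>

definition rate :: "'w \<Rightarrow> real \<Rightarrow> real" where
  "rate \<omega> s = lam (max 0 s) \<omega> * of_bool (ereal s \<le> \<tau> \<omega>)"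

lemma rate_product[measurable]: "(\<lambda>x. rate (snd x) (fst x)) \<in> borel_measurable (borel \<Otimes>\<^sub>M P)"
  unfolding rate_def by measurable

lemma rate_measurable[measurable]: "\<omega> \<in> space P \<Longrightarrow> rate \<omega> \<in> borel_measurable borel"
  using measurable_compose[OF measurable_Pair2' rate_product, of \<omega>] by simp

lemma rate_bounds: "\<exists>K\<ge>0. \<forall>\<omega>\<in>space P. \<forall>s. 0 \<le> rate \<omega> s \<and> rate \<omega> s \<le> K"
  using lam_bounded by (auto simp: rate_def)

lemma compensator_eq: 
  assumes "\<omega> \<in> space P"
  shows "compensator \<tau> lam u \<omega> = (LINT s:{0<..u}|lborel. rate \<omega> s)"
  unfolding compensator_def set_lebesgue_integral_def
  by (intro Bochner_Integration.integral_cong)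
     (auto simp: rate_def indicator_def le_stopped_iff[OF \<tau>_nonneg[OF assms]])

lemma
  assumes \<omega>: "\<omega> \<in> space P"
  shows interval_measure_compensator:
      "interval_measure (\<lambda>u. compensator \<tau> lam u \<omega>) = density lborel (\<lambda>s. ennreal (rate \<omega> s) * indicator {0<..} s)"
    and nn_integral_rate: "\<And>a b. a \<le> b \<Longrightarrow>
      (\<integral>\<^sup>+ s. ennreal (rate \<omega> s) * indicator {0<..} s * indicator {a<..b} s \<partial>lborel) =
        ennreal (compensator \<tau> lam b \<omega> - compensator \<tau> lam a \<omega>)"
    and compensator_mono: "\<And>a b. a \<le> b \<Longrightarrow> compensator \<tau> lam a \<omega> \<le> compensator \<tau> lam b \<omega>"
proof -
  obtain K where K: "\<And>s. 0 \<le> rate \<omega> s" "\<And>s. rate \<omega> s \<le> K" using rate_bounds \<omega> by metis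
  note * = interval_measure_density[OF rate_measurable[OF \<omega>] K]
    nn_integral_density_Ioc[OF rate_measurable[OF \<omega>] K] set_integral_Ioc_mono[OF rate_measurable[OF \<omega>] K]
  show "interval_measure (\<lambda>u. compensator \<tau> lam u \<omega>) = density lborel (\<lambda>s. ennreal (rate \<omega> s) * indicator {0<..} s)"
    "\<And>a b. a \<le> b \<Longrightarrow> (\<integral>\<^sup>+ s. ennreal (rate \<omega> s) * indicator {0<..} s * indicator {a<..b} s \<partial>lborel) =
        ennreal (compensator \<tau> lam b \<omega> - compensator \<tau> lam a \<omega>)"
    "\<And>a b. a \<le> b \<Longrightarrow> compensator \<tau> lam a \<omega> \<le> compensator \<tau> lam b \<omega>"
    using * by (simp_all add: compensator_eq[OF \<omega>])
qed

section \<open>The law of \<tau> on predictable sets\<close>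

lemma compensated_martingale:
  "martingale P \<G> (\<lambda>t \<omega>. jump_process \<tau> t \<omega> - compensator \<tau> lam t \<omega>)"
  using setting by (simp add: default_setting_def)

lemma jump_process_measurable[measurable]: "jump_process \<tau> t \<in> borel_measurable P"
  unfolding jump_process_def by measurable

lemma integrable_jump_process: "integrable P (jump_process \<tau> t)"
  by (rule integrable_const_bound[of _ 1]) (auto simp: jump_process_def)

lemma integrable_compensator: "0 \<le> t \<Longrightarrow> integrable P (compensator \<tau> lam t)"
proof -
  assume "0 \<le> t"
  then have "integrable P (\<lambda>\<omega>. jump_process \<tau> t \<omega> - compensator \<tau> lam t \<omega>)"
    using compensated_martingale by (simp add: martingale_def)
  from Bochner_Integration.integrable_diff[OF integrable_jump_process[of t] this] show ?thesis by simp
qed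

text \<open>The image of P under the graph of \<tau>, on predictable sets. The increments of M see
  half-open time intervals in \<open>{0<..}\<close>, never time 0; this explains the restriction to
  0 < \<tau>. The cut at T corresponds to the time interval on which the coefficients are
  given.\<close>

definition jump_measure :: "real \<Rightarrow> (real \<times> 'w) measure" where
  "jump_measure T = distr (density P (\<lambda>\<omega>. indicator {\<omega>. 0 < \<tau> \<omega> \<and> \<tau> \<omega> \<le> ereal T} \<omega>))
     (predictable_algebra P \<G>) (\<lambda>\<omega>. (real_of_ereal (\<tau> \<omega>), \<omega>))"

text \<open>The counterpart of \<open>jump_measure\<close> for the compensator: density
  \<open>rate\<close> with respect to dt dP on \<open>{0<..T}\<close>, restricted to predictable
  sets through the clamping map.\<close>

definition rate_measure :: "real \<Rightarrow> (real \<times> 'w) measure" where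
  "rate_measure T = distr (density (lborel \<Otimes>\<^sub>M P) (\<lambda>x. ennreal (rate (snd x) (fst x)) * indicator {0<..T} (fst x)))
     (predictable_algebra P \<G>) (\<lambda>x. (max 0 (fst x), snd x))"

text \<open>\<open>real_of_ereal\<close> sends \<tau> = \<infinity> to time 0. This does not affect
  \<open>jump_measure\<close>, which is restricted to \<tau> \<le> T.\<close>

lemma graph_\<tau>: "(\<lambda>\<omega>. (real_of_ereal (\<tau> \<omega>), \<omega>)) \<in> measurable P (predictable_algebra P \<G>)"
proof -
  have "(\<lambda>\<omega>. (real_of_ereal (\<tau> \<omega>), \<omega>)) \<in> measurable P (borel \<Otimes>\<^sub>M P)" by measurable
  from measurable_compose[OF this G.predictable_algebra_clamp]
  have "(\<lambda>\<omega>. (max 0 (real_of_ereal (\<tau> \<omega>)), \<omega>)) \<in> measurable P (predictable_algebra P \<G>)" by simp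
  also have "?this \<longleftrightarrow> ?thesis"
    by (intro measurable_cong) (auto simp: max_def real_of_ereal_pos \<tau>_nonneg dest: antisym)
  finally show ?thesis .
qed

lemma emeasure_jump_measure:
  assumes [measurable]: "B \<in> sets (predictable_algebra P \<G>)"
  shows "emeasure (jump_measure T) B =
    emeasure P {\<omega>\<in>space P. 0 < \<tau> \<omega> \<and> \<tau> \<omega> \<le> ereal T \<and> (real_of_ereal (\<tau> \<omega>), \<omega>) \<in> B}"
proof -
  note [measurable] = graph_\<tau>
  have "emeasure (jump_measure T) B = (\<integral>\<^sup>+\<omega>. indicator {\<omega>. 0 < \<tau> \<omega> \<and> \<tau> \<omega> \<le> ereal T} \<omega> *
      indicator ((\<lambda>\<omega>. (real_of_ereal (\<tau> \<omega>), \<omega>)) -` B \<inter> space P) \<omega> \<partial>P)"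
    unfolding jump_measure_def by (subst emeasure_distr; simp) (subst emeasure_density; measurable)
  also have "\<dots> = (\<integral>\<^sup>+\<omega>. indicator {\<omega>\<in>space P. 0 < \<tau> \<omega> \<and> \<tau> \<omega> \<le> ereal T \<and> (real_of_ereal (\<tau> \<omega>), \<omega>) \<in> B} \<omega> \<partial>P)"
    by (intro nn_integral_cong) (auto simp: indicator_def)
  also have "\<dots> = emeasure P {\<omega>\<in>space P. 0 < \<tau> \<omega> \<and> \<tau> \<omega> \<le> ereal T \<and> (real_of_ereal (\<tau> \<omega>), \<omega>) \<in> B}"
    by (rule nn_integral_indicator) measurable
  finally show ?thesis .
qed

lemma emeasure_rate_measure:
  assumes [measurable]: "B \<in> sets (predictable_algebra P \<G>)"
  shows "emeasure (rate_measure T) B = (\<integral>\<^sup>+x. ennreal (rate (snd x) (fst x)) * indicator {0<..T} (fst x) *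
    indicator B (max 0 (fst x), snd x) \<partial>(lborel \<Otimes>\<^sub>M P))"
proof -
  note [measurable] = G.predictable_algebra_clamp
  have "emeasure (rate_measure T) B = (\<integral>\<^sup>+x. ennreal (rate (snd x) (fst x)) * indicator {0<..T} (fst x) *
    indicator ((\<lambda>x. (max 0 (fst x), snd x)) -` B \<inter> space (lborel \<Otimes>\<^sub>M P)) x \<partial>(lborel \<Otimes>\<^sub>M P))"
    unfolding rate_measure_def by (subst emeasure_distr; simp) (subst emeasure_density; measurable)
  also have "\<dots> = (\<integral>\<^sup>+x. ennreal (rate (snd x) (fst x)) * indicator {0<..T} (fst x) *
    indicator B (max 0 (fst x), snd x) \<partial>(lborel \<Otimes>\<^sub>M P))"
    by (intro nn_integral_cong) (auto simp: indicator_def)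
  finally show ?thesis .
qed

text \<open>On a rectangle over (s, t] with base A the two masses are the integrals over A of the
  increments of N and of its compensator, after truncation at T. They agree because M is a
  martingale and A is in \<open>\<G> s\<close>. Uniqueness of measures on the intersection-stable
  rectangles does the rest.\<close>

lemma jump_measure_eq: 
  assumes T: "0 < T"
  shows "jump_measure T = rate_measure T"
proof -
  interpret L: pair_sigma_finite lborel P ..
  have eq: "emeasure (jump_measure T) X = emeasure (rate_measure T) X" if "X \<in> G.predictable_rectangles" for X
  proof (cases rule: G.rectangle_cases[OF that])
    case X: (1 A)
    have XS: "X \<in> sets (predictable_algebra P \<G>)" using X G.predictable_0I by blast
    have "{\<omega>\<in>space P. 0 < \<tau> \<omega> \<and> \<tau> \<omega> \<le> ereal T \<and> (real_of_ereal (\<tau> \<omega>), \<omega>) \<in> X} = {}"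
      by (auto simp: X(1) real_of_ereal_eq_0)
    moreover have "(\<integral>\<^sup>+x. ennreal (rate (snd x) (fst x)) * indicator {0<..T} (fst x) *
        indicator X (max 0 (fst x), snd x) \<partial>(lborel \<Otimes>\<^sub>M P)) = (\<integral>\<^sup>+x. 0 \<partial>((lborel::real measure) \<Otimes>\<^sub>M P))"
      by (intro nn_integral_cong) (auto simp: X(1) indicator_def)
    ultimately show ?thesis
      unfolding emeasure_jump_measure[OF XS] emeasure_rate_measure[OF XS]
      by (simp only: emeasure_empty nn_integral_const mult_zero_left)
  next
    case (2 s t A)
    note X = 2(1) and st = 2(2,3) and A = 2(4)
    have XS: "X \<in> sets (predictable_algebra P \<G>)" using A X st G.predictable_IocI by blast
    have AP[measurable]: "A \<in> sets P" using sets_G_P[OF A] .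
    show ?thesis
    proof (cases "s \<le> T")
      case False
      have "real_of_ereal (\<tau> \<omega>) \<le> T" if "\<tau> \<omega> \<le> ereal T" "0 < \<tau> \<omega>" for \<omega>
        using that by (cases "\<tau> \<omega>") auto
      with False have "{\<omega>\<in>space P. 0 < \<tau> \<omega> \<and> \<tau> \<omega> \<le> ereal T \<and> (real_of_ereal (\<tau> \<omega>), \<omega>) \<in> X} = {}"
        by (force simp: X)
      moreover have "(\<integral>\<^sup>+x. ennreal (rate (snd x) (fst x)) * indicator {0<..T} (fst x) *
          indicator X (max 0 (fst x), snd x) \<partial>(lborel \<Otimes>\<^sub>M P)) = (\<integral>\<^sup>+x. 0 \<partial>((lborel::real measure) \<Otimes>\<^sub>M P))"
        using False by (intro nn_integral_cong) (auto simp: X indicator_def)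
      ultimately show ?thesis
        unfolding emeasure_jump_measure[OF XS] emeasure_rate_measure[OF XS] by (simp only: emeasure_empty nn_integral_const mult_zero_left)
    next
      case True
      \<comment> \<open>Both measures live on times up to T, so only the part of the rectangle
        before T counts; the case assumption s \<le> T ensures s \<le> u.\<close>
      define u where "u = min t T"
      have u: "s \<le> u" "0 \<le> u" using True st by (auto simp: u_def)
      define C where "C \<omega> = compensator \<tau> lam u \<omega> - compensator \<tau> lam s \<omega>" for \<omega>
      define N where "N \<omega> = jump_process \<tau> u \<omega> - jump_process \<tau> s \<omega>" for \<omega>
      have C_nonneg: "0 \<le> C \<omega>" if "\<omega> \<in> space P" for \<omega>
        using compensator_mono[OF that u(1)] by (simp add: C_def)
      have iC: "integrable P C" and iN: "integrable P N"
        unfolding C_def N_def using u st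
        by (auto intro!: Bochner_Integration.integrable_diff integrable_compensator integrable_jump_process)
      \<comment> \<open>N increases by 1 over (s, u] exactly when s < \<tau> \<le> u. Since s \<ge>
        0 and u = min t T, on A this says that the graph point lies in X and that 0 < \<tau> \<le>
        T.\<close>
      have N_ind: "indicator A \<omega> * N \<omega> =
          indicator {\<omega>\<in>space P. 0 < \<tau> \<omega> \<and> \<tau> \<omega> \<le> ereal T \<and> (real_of_ereal (\<tau> \<omega>), \<omega>) \<in> X} \<omega>"
        if "\<omega> \<in> space P" for \<omega>
        using that \<tau>_nonneg[OF that] st True
        by (cases "\<tau> \<omega>") (auto simp: N_def jump_process_def X indicator_def u_def)
      have "(LINT \<omega>:A|P. (jump_process \<tau> u \<omega> - compensator \<tau> lam u \<omega>)) =
          (LINT \<omega>:A|P. (jump_process \<tau> s \<omega> - compensator \<tau> lam s \<omega>))"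
        by (rule G.martingale_set_integral[OF compensated_martingale]) (use st u A in auto)
      then have "(\<integral>\<omega>. indicator A \<omega> * N \<omega> \<partial>P) = (\<integral>\<omega>. indicator A \<omega> * C \<omega> \<partial>P)"
        unfolding set_lebesgue_integral_def N_def C_def
        using integrable_compensator[of u] integrable_compensator[of s] integrable_jump_process st u
        by (simp add: right_diff_distrib Bochner_Integration.integral_diff integrable_real_mult_indicator
            mult.commute[of "indicator A _"])
      note NC = this
      have "emeasure (jump_measure T) X = (\<integral>\<^sup>+\<omega>. ennreal (indicator A \<omega> * N \<omega>) \<partial>P)"
        unfolding emeasure_jump_measure[OF XS]
      proof (subst nn_integral_indicator[symmetric])
        note [measurable] = graph_\<tau> XS
        show "{\<omega>\<in>space P. 0 < \<tau> \<omega> \<and> \<tau> \<omega> \<le> ereal T \<and> (real_of_ereal (\<tau> \<omega>), \<omega>) \<in> X} \<in> sets P"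
          by measurable
      qed (intro nn_integral_cong, simp only: N_ind ennreal_indicator)
      also have "\<dots> = ennreal (\<integral>\<omega>. indicator A \<omega> * N \<omega> \<partial>P)"
        by (rule nn_integral_eq_integral)
           (use iN N_ind in \<open>auto simp: mult.commute[of "indicator A _"] intro!: integrable_real_mult_indicator\<close>)
      also have "\<dots> = ennreal (\<integral>\<omega>. indicator A \<omega> * C \<omega> \<partial>P)" using NC by simp
      also have "\<dots> = (\<integral>\<^sup>+\<omega>. ennreal (indicator A \<omega> * C \<omega>) \<partial>P)"
        by (rule nn_integral_eq_integral[symmetric])
           (use iC C_nonneg in \<open>auto simp: mult.commute[of "indicator A _"] intro!: integrable_real_mult_indicator\<close>)
      also have "\<dots> = (\<integral>\<^sup>+\<omega>. (\<integral>\<^sup>+x. ennreal (rate \<omega> x) * indicator {0<..T} x * indicator X (max 0 x, \<omega>) \<partial>lborel) \<partial>P)"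
      proof (intro nn_integral_cong)
        fix \<omega> assume \<omega>: "\<omega> \<in> space P"
        have "(\<integral>\<^sup>+x. ennreal (rate \<omega> x) * indicator {0<..T} x * indicator X (max 0 x, \<omega>) \<partial>lborel) =
          (\<integral>\<^sup>+x. indicator A \<omega> * (ennreal (rate \<omega> x) * indicator {0<..} x * indicator {s<..u} x) \<partial>lborel)"
          using st True by (intro nn_integral_cong) (auto simp: X indicator_def u_def)
        also have "\<dots> = indicator A \<omega> * ennreal (C \<omega>)"
          using \<omega> nn_integral_rate[OF \<omega> u(1)] by (subst nn_integral_cmult) (auto simp: C_def)
        finally show "ennreal (indicator A \<omega> * C \<omega>) =
            (\<integral>\<^sup>+x. ennreal (rate \<omega> x) * indicator {0<..T} x * indicator X (max 0 x, \<omega>) \<partial>lborel)"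
          by (auto simp: indicator_def)
      qed
      also have "\<dots> = emeasure (rate_measure T) X"
        unfolding emeasure_rate_measure[OF XS]
      proof (subst L.nn_integral_snd[symmetric])
        note [measurable] = G.predictable_algebra_clamp XS
        show "(\<lambda>x. ennreal (rate (snd x) (fst x)) * indicator {0<..T} (fst x) * indicator X (max 0 (fst x), snd x))
          \<in> borel_measurable (lborel \<Otimes>\<^sub>M P)"
          by measurable
      qed simp
      finally show ?thesis .
    qed
  qed
  obtain R :: "nat \<Rightarrow> (real \<times> 'w) set" where R: "range R \<subseteq> G.predictable_rectangles" "(\<Union>n. R n) = {0..} \<times> space P"
    by (rule G.predictable_rectangles_cover)
  show ?thesis
  proof (rule measure_eqI_generator_eq[OF G.Int_stable_rectangles _ eq _ _ R])
    show "G.predictable_rectangles \<subseteq> Pow ({0..} \<times> space P)"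
      unfolding G.predictable_rectangles_def by (rule G.predictable_generator)
    show "sets (jump_measure T) = sigma_sets ({0..} \<times> space P) G.predictable_rectangles"
      "sets (rate_measure T) = sigma_sets ({0..} \<times> space P) G.predictable_rectangles"
      unfolding jump_measure_def rate_measure_def sets_distr G.predictable_rectangles_def
      by (rule G.sets_predictable)+
    show "emeasure (jump_measure T) (R n) \<noteq> \<infinity>" for n
    proof (cases "R n \<in> sets (predictable_algebra P \<G>)")
      case True
      show ?thesis unfolding emeasure_jump_measure[OF True] by simp
    next
      case False
      then have "emeasure (jump_measure T) (R n) = 0"
        by (intro emeasure_notin_sets) (simp add: jump_measure_def)
      then show ?thesis by simp
    qed
  qed
qed

text \<open>The exceptional set is predictable and null for dt dP, so \<open>rate_measure\<close>
  does not charge it, hence neither does \<open>jump_measure\<close>. Predictability is essential: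
  the graph of \<tau> is also null for dt dP, and \<tau> hits it at every finite value.\<close>

lemma ae_time_imp_at_\<tau>:
  fixes X :: "real \<Rightarrow> 'w \<Rightarrow> real"
  assumes T: "0 < T" and X: "predictable_on P \<F> {0..T} X" and C: "C \<in> sets borel"
    and ae: "ae_time P T (\<lambda>t \<omega>. X t \<omega> \<in> C)"
  shows "AE \<omega> in P. 0 < \<tau> \<omega> \<and> \<tau> \<omega> \<le> ereal T \<longrightarrow> X (real_of_ereal (\<tau> \<omega>)) \<omega> \<in> C"
proof -
  define B where "B = {x \<in> {0..T} \<times> space P. X (fst x) (snd x) \<notin> C}"
  have B: "B \<in> sets (predictable_algebra P \<G>)"
  proof -
    have "(\<lambda>(t, \<omega>). X t \<omega>) -` (- C) \<inter> space (restrict_space (predictable_algebra P \<G>) ({0..T} \<times> space P))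
        \<in> sets (restrict_space (predictable_algebra P \<G>) ({0..T} \<times> space P))"
      using predictable_F_G[OF X] C unfolding predictable_on_def by (intro measurable_sets) auto
    also have "(\<lambda>(t, \<omega>). X t \<omega>) -` (- C) \<inter> space (restrict_space (predictable_algebra P \<G>) ({0..T} \<times> space P)) = B"
      by (auto simp: B_def space_restrict_space G.space_predictable)
    finally show ?thesis
      using G.predictable_strip[of T] by (subst (asm) sets_restrict_space_iff) (auto intro: sets.Int)
  qed
  have "emeasure (rate_measure T) B = (\<integral>\<^sup>+x. 0 \<partial>((lborel::real measure) \<Otimes>\<^sub>M P))"
    unfolding emeasure_rate_measure[OF B]
    by (rule nn_integral_cong_AE) (use ae in \<open>auto simp: ae_time_def B_def indicator_def elim!: eventually_mono\<close>)
  then have "emeasure P {\<omega>\<in>space P. 0 < \<tau> \<omega> \<and> \<tau> \<omega> \<le> ereal T \<and> (real_of_ereal (\<tau> \<omega>), \<omega>) \<in> B} = 0"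
    unfolding emeasure_jump_measure[OF B, symmetric] jump_measure_eq[OF T] by simp
  moreover have "{\<omega>\<in>space P. 0 < \<tau> \<omega> \<and> \<tau> \<omega> \<le> ereal T \<and> (real_of_ereal (\<tau> \<omega>), \<omega>) \<in> B} \<in> sets P"
  proof -
    note [measurable] = graph_\<tau> B
    show ?thesis by measurable
  qed
  ultimately have "AE \<omega> in P. \<not> (0 < \<tau> \<omega> \<and> \<tau> \<omega> \<le> ereal T \<and> (real_of_ereal (\<tau> \<omega>), \<omega>) \<in> B)"
    by (intro AE_I'[of "{\<omega>\<in>space P. 0 < \<tau> \<omega> \<and> \<tau> \<omega> \<le> ereal T \<and> (real_of_ereal (\<tau> \<omega>), \<omega>) \<in> B}"]) auto
  then show ?thesis
    using AE_space
  proof eventually_elim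
    case (elim \<omega>)
    then show ?case by (cases "\<tau> \<omega>") (auto simp: B_def)
  qed
qed

end


section \<open>Square-integrable martingales\<close>

lemma sum_square_le: "(x + y)\<^sup>2 \<le> 2 * x\<^sup>2 + 2 * (y::real)\<^sup>2"
proof -
  have "0 \<le> (x - y)\<^sup>2" by simp
  then show ?thesis by (simp add: power2_eq_square algebra_simps)
qed

lemma integrable_square_add:
  fixes f g :: "'a \<Rightarrow> real"
  assumes [measurable]: "f \<in> borel_measurable M" "g \<in> borel_measurable M"
    and "integrable M (\<lambda>x. (f x)\<^sup>2)" "integrable M (\<lambda>x. (g x)\<^sup>2)"
  shows "integrable M (\<lambda>x. (f x + g x)\<^sup>2)"
  by (rule Bochner_Integration.integrable_bound[of _ "\<lambda>x. 2 * (f x)\<^sup>2 + 2 * (g x)\<^sup>2"])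
     (use assms sum_square_le in \<open>auto intro!: Bochner_Integration.integrable_add integrable_mult_right\<close>)

lemma integrable_bounded_mult:
  fixes f g :: "'a \<Rightarrow> real"
  assumes "f \<in> borel_measurable M" "integrable M g" "\<And>x. x \<in> space M \<Longrightarrow> \<bar>f x\<bar> \<le> K"
  shows "integrable M (\<lambda>x. f x * g x)"
proof (rule Bochner_Integration.integrable_bound[of _ "\<lambda>x. K * g x"])
  show "AE x in M. norm (f x * g x) \<le> norm (K * g x)"
  proof (intro AE_I2)
    fix x assume "x \<in> space M"
    then have "\<bar>f x\<bar> \<le> \<bar>K\<bar>" using assms(3)[of x] by linarith
    then show "norm (f x * g x) \<le> norm (K * g x)" by (simp add: abs_mult mult_right_mono)
  qed
qed (use assms in auto)

context filtered_prob_space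
begin

lemma martingale_measurable: "martingale P H X \<Longrightarrow> 0 \<le> t \<Longrightarrow> X t \<in> borel_measurable (H t)"
  and martingale_integrable: "martingale P H X \<Longrightarrow> 0 \<le> t \<Longrightarrow> integrable P (X t)"
  by (simp_all add: martingale_def)

lemma martingale_add:
  assumes X: "martingale P H X" and Y: "martingale P H Y"
  shows "martingale P H (\<lambda>t \<omega>. X t \<omega> + Y t \<omega>)"
proof (rule martingaleI)
  fix s t A assume *: "0 \<le> s" "s \<le> t" "A \<in> sets (H s)"
  have A: "A \<in> sets P" using * sets_H by blast
  have "(LINT \<omega>:A|P. X r \<omega> + Y r \<omega>) = (LINT \<omega>:A|P. X r \<omega>) + (LINT \<omega>:A|P. Y r \<omega>)" if "0 \<le> r" for r
    using martingale_integrable[OF X that] martingale_integrable[OF Y that] A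
    by (intro set_integral_add) (auto simp del: real_scaleR_def simp: set_integrable_def intro!: integrable_mult_indicator)
  then show "(LINT \<omega>:A|P. X t \<omega> + Y t \<omega>) = (LINT \<omega>:A|P. X s \<omega> + Y s \<omega>)"
    using * martingale_set_integral[OF X *] martingale_set_integral[OF Y *] by simp
qed (use martingale_measurable[OF X] martingale_measurable[OF Y] martingale_integrable[OF X] 
    martingale_integrable[OF Y] in auto)

lemma martingale_0: "martingale P H (\<lambda>t \<omega>. 0)"
  by (rule martingaleI) auto

lemma martingale_sum:
  assumes "\<And>i. i \<in> I \<Longrightarrow> martingale P H (X i)"
  shows "martingale P H (\<lambda>t \<omega>. \<Sum>i\<in>I. X i t \<omega>)"
  using assms
  by (induction I rule: infinite_finite_induct) (auto intro: martingale_0 martingale_add)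

lemma martingale_uminus:
  assumes X: "martingale P H X"
  shows "martingale P H (\<lambda>t \<omega>. - X t \<omega>)"
proof (rule martingaleI)
  fix s t A assume *: "0 \<le> s" "s \<le> t" "A \<in> sets (H s)"
  then show "(LINT \<omega>:A|P. - X t \<omega>) = (LINT \<omega>:A|P. - X s \<omega>)"
    using martingale_set_integral[OF X *] by (simp add: set_lebesgue_integral_def)
qed (use martingale_measurable[OF X] martingale_integrable[OF X] in auto)

lemma martingale_orthogonal:
  assumes X: "martingale P H X" and st: "0 \<le> s" "s \<le> t"
    and f: "f \<in> borel_measurable (H s)" "integrable P (\<lambda>\<omega>. f \<omega> * X t \<omega>)"
  shows "(\<integral>\<omega>. f \<omega> * X t \<omega> \<partial>P) = (\<integral>\<omega>. f \<omega> * X s \<omega> \<partial>P)"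
proof -
  interpret sigma_finite_subalgebra P "H s" by (rule sigma_finite_subalgebra_H) fact
  have ae: "AE \<omega> in P. real_cond_exp P (H s) (X t) \<omega> = X s \<omega>"
    using X st by (simp add: martingale_def)
  have m: "X t \<in> borel_measurable P" "X s \<in> borel_measurable P" "f \<in> borel_measurable P"
    using martingale_integrable[OF X, of t] martingale_integrable[OF X, of s] st measurable_H_P[OF st(1) f(1)]
    by (simp_all add: borel_measurable_integrable)
  have "(\<integral>\<omega>. f \<omega> * X t \<omega> \<partial>P) = (\<integral>\<omega>. f \<omega> * real_cond_exp P (H s) (X t) \<omega> \<partial>P)"
    using m f by (intro real_cond_exp_intg(2)[symmetric]) auto
  also have "\<dots> = (\<integral>\<omega>. f \<omega> * X s \<omega> \<partial>P)"
    using m ae by (intro integral_cong_AE) auto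
  finally show ?thesis .
qed

text \<open>The integral of the one-step integrand \<xi> on (a, b] against X. The minima with t
  cover all positions of t at once: the value is 0 up to a and constant from b on.\<close>

lemma martingale_transform:
  assumes X: "martingale P H X" and ab: "0 \<le> a" "a \<le> b"
    and \<xi>: "\<xi> \<in> borel_measurable (H a)" "\<And>\<omega>. \<omega> \<in> space P \<Longrightarrow> \<bar>\<xi> \<omega>\<bar> \<le> K"
  shows "martingale P H (\<lambda>t \<omega>. \<xi> \<omega> * (X (min b t) \<omega> - X (min a t) \<omega>))"
proof (rule martingaleI)
  have \<xi>P: "\<xi> \<in> borel_measurable P" by (rule measurable_H_P[OF ab(1) \<xi>(1)])
  have i: "integrable P (X t)" and mP: "X t \<in> borel_measurable P" if "0 \<le> t" for t
    using martingale_integrable[OF X that] by auto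
  fix t :: real assume t: "0 \<le> t"
  show "(\<lambda>\<omega>. \<xi> \<omega> * (X (min b t) \<omega> - X (min a t) \<omega>)) \<in> borel_measurable (H t)"
  proof (cases "t \<le> a")
    case True
    then show ?thesis using ab by (simp add: min_absorb2)
  next
    case False
    then have at: "a \<le> t" by simp
    have [measurable]: "\<xi> \<in> borel_measurable (H t)" by (rule measurable_H_mono[OF ab(1) at \<xi>(1)])
    have [measurable]: "X (min b t) \<in> borel_measurable (H t)"
      by (rule measurable_H_mono[OF _ _ martingale_measurable[OF X]]) (use ab t in auto)
    have [measurable]: "X (min a t) \<in> borel_measurable (H t)"
      by (rule measurable_H_mono[OF _ _ martingale_measurable[OF X]]) (use ab t in auto)
    show ?thesis by measurable
  qed
  show int: "integrable P (\<lambda>\<omega>. \<xi> \<omega> * (X (min b t) \<omega> - X (min a t) \<omega>))"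
    using ab t \<xi> \<xi>P by (intro integrable_bounded_mult[where K = K] Bochner_Integration.integrable_diff i) auto
next
  fix s t A assume *: "0 \<le> s" "s \<le> t" and A: "A \<in> sets (H s)"
  have i: "integrable P (X t)" if "0 \<le> t" for t
    using martingale_integrable[OF X that] by auto
  have \<xi>P: "\<xi> \<in> borel_measurable P" by (rule measurable_H_P[OF ab(1) \<xi>(1)])
  \<comment> \<open>From time a on, \<xi> times an indicator is a bounded known weight, against
    which X may be moved from \<open>min b t\<close> back to \<open>min b r\<close>.\<close>
  have key: "(\<integral>\<omega>. (indicator A \<omega> * \<xi> \<omega>) * X (min b t) \<omega> \<partial>P) = (\<integral>\<omega>. (indicator A \<omega> * \<xi> \<omega>) * X (min b r) \<omega> \<partial>P)"
    if r: "a \<le> r" "r \<le> t" and A: "A \<in> sets (H r)" for r A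
  proof (cases "b \<le> r")
    case True
    then show ?thesis using r by (simp add: min_absorb1)
  next
    case False
    have m: "(\<lambda>\<omega>. indicator A \<omega> * \<xi> \<omega>) \<in> borel_measurable (H r)"
      using A measurable_H_mono[OF ab(1) r(1) \<xi>(1)] by measurable
    then have mP: "(\<lambda>\<omega>. indicator A \<omega> * \<xi> \<omega>) \<in> borel_measurable P"
      by (rule measurable_H_P[rotated]) (use r ab in simp)
    have "integrable P (\<lambda>\<omega>. (indicator A \<omega> * \<xi> \<omega>) * X (min b t) \<omega>)"
      using i[of "min b t"] ab r \<xi> mP by (intro integrable_bounded_mult[where K = "max K 0"]) (auto simp: indicator_def intro: max.coboundedI1)
    from martingale_orthogonal[OF X _ _ m this] show ?thesis
      using ab r False by (simp add: min_absorb2)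
  qed
  have split: "(LINT \<omega>:A|P. \<xi> \<omega> * (X (min b r) \<omega> - X (min a r) \<omega>)) =
     (\<integral>\<omega>. (indicator A \<omega> * \<xi> \<omega>) * X (min b r) \<omega> \<partial>P) - (\<integral>\<omega>. (indicator A \<omega> * \<xi> \<omega>) * X (min a r) \<omega> \<partial>P)"
    if "0 \<le> r" "A \<in> sets P" for r A
  proof -
    have "integrable P (\<lambda>\<omega>. (indicator A \<omega> * \<xi> \<omega>) * X u \<omega>)" if "0 \<le> u" for u
      using i[OF that] \<xi> \<xi>P \<open>A \<in> sets P\<close> by (intro integrable_bounded_mult[where K = "max K 0"]) (auto simp: indicator_def intro: max.coboundedI1)
    then show ?thesis using ab that
      by (subst Bochner_Integration.integral_diff[symmetric])
         (auto simp: set_lebesgue_integral_def algebra_simps)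
  qed
  \<comment> \<open>Up to a both sides are 0. If a separates s from t, A already belongs to
    \<open>H a\<close> and \<open>key\<close> at r = a makes the left side 0 as well. Beyond a,
    \<open>key\<close> is applied at r = s.\<close>
  consider "t \<le> a" | "s \<le> a" "a < t" | "a < s" by linarith
  then show "(LINT \<omega>:A|P. \<xi> \<omega> * (X (min b t) \<omega> - X (min a t) \<omega>)) =
      (LINT \<omega>:A|P. \<xi> \<omega> * (X (min b s) \<omega> - X (min a s) \<omega>))"
  proof cases
    case 1
    then show ?thesis using ab * by (simp add: min_absorb2)
  next
    case 2
    have Aa: "A \<in> sets (H a)" using A mono[of s a] 2 * by auto
    then have "A \<in> sets P" using sets_H ab by blast
    then show ?thesis
      using key[of a A] 2 Aa ab * split[of t A] by (simp add: min_absorb1 min_absorb2 set_lebesgue_integral_def)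
  next
    case 3
    have "A \<in> sets P" using sets_H A * by blast
    then show ?thesis
      using key[of s A] 3 A ab * split[of t A] split[of s A] by (simp add: min_absorb1)
  qed
qed

text \<open>Conditional Jensen for the square, tested on A. Nonnegative integrals avoid a separate
  proof that the square at the earlier time is integrable.\<close>

lemma martingale_square_mono:
  assumes X: "martingale P H X" and st: "0 \<le> s" "s \<le> t" and A: "A \<in> sets (H s)"
    and sq: "integrable P (\<lambda>\<omega>. (X t \<omega>)\<^sup>2)"
  shows "(\<integral>\<^sup>+\<omega>. indicator A \<omega> * ennreal ((X s \<omega>)\<^sup>2) \<partial>P) \<le> (\<integral>\<^sup>+\<omega>. indicator A \<omega> * ennreal ((X t \<omega>)\<^sup>2) \<partial>P)"
proof -
  interpret S: sigma_finite_subalgebra P "H s" by (rule sigma_finite_subalgebra_H) fact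
  have AP[measurable]: "A \<in> sets P" using sets_H A st by blast
  have ae: "AE \<omega> in P. real_cond_exp P (H s) (X t) \<omega> = X s \<omega>"
    using X st by (simp add: martingale_def)
  have X_int: "integrable P (X t)" using martingale_integrable[OF X] st by simp
  have conv: "convex_on UNIV (\<lambda>x::real. x\<^sup>2)" by (rule convex_power2)
  have "AE \<omega> in P. (real_cond_exp P (H s) (X t) \<omega>)\<^sup>2 \<le> real_cond_exp P (H s) (\<lambda>\<omega>. (X t \<omega>)\<^sup>2) \<omega>"
    by (rule S.real_cond_exp_jensens_inequality(2)[where I = UNIV, OF X_int _ _ sq conv]) auto
  with ae have le: "AE \<omega> in P. (X s \<omega>)\<^sup>2 \<le> real_cond_exp P (H s) (\<lambda>\<omega>. (X t \<omega>)\<^sup>2) \<omega>"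
    by eventually_elim simp
  have ci: "integrable P (real_cond_exp P (H s) (\<lambda>\<omega>. (X t \<omega>)\<^sup>2))"
    using S.real_cond_exp_int(1)[OF sq] .
  have i: "integrable P (\<lambda>\<omega>. indicator A \<omega> * f \<omega>)" if "integrable P f" for f :: "'w \<Rightarrow> real"
    using integrable_mult_indicator[OF AP that] by simp
  have "(\<integral>\<^sup>+\<omega>. indicator A \<omega> * ennreal ((X s \<omega>)\<^sup>2) \<partial>P) \<le>
      (\<integral>\<^sup>+\<omega>. ennreal (indicator A \<omega> * real_cond_exp P (H s) (\<lambda>\<omega>. (X t \<omega>)\<^sup>2) \<omega>) \<partial>P)"
    using le by (intro nn_integral_mono_AE) (auto elim!: eventually_mono simp: indicator_def ennreal_leI)
  also have "\<dots> = ennreal (\<integral>\<omega>. indicator A \<omega> * real_cond_exp P (H s) (\<lambda>\<omega>. (X t \<omega>)\<^sup>2) \<omega> \<partial>P)"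
  proof (rule nn_integral_eq_integral[OF i[OF ci]])
    show "AE \<omega> in P. 0 \<le> indicator A \<omega> * real_cond_exp P (H s) (\<lambda>\<omega>. (X t \<omega>)\<^sup>2) \<omega>"
      using le by eventually_elim (auto simp: indicator_def intro: order_trans[OF zero_le_power2])
  qed
  also have "(\<integral>\<omega>. indicator A \<omega> * real_cond_exp P (H s) (\<lambda>\<omega>. (X t \<omega>)\<^sup>2) \<omega> \<partial>P) = (\<integral>\<omega>. indicator A \<omega> * (X t \<omega>)\<^sup>2 \<partial>P)"
    using S.real_cond_exp_intA[OF sq A] by (simp add: set_lebesgue_integral_def)
  also have "ennreal \<dots> = (\<integral>\<^sup>+\<omega>. ennreal (indicator A \<omega> * (X t \<omega>)\<^sup>2) \<partial>P)"
    by (rule nn_integral_eq_integral[OF i[OF sq], symmetric]) auto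
  also have "\<dots> = (\<integral>\<^sup>+\<omega>. indicator A \<omega> * ennreal ((X t \<omega>)\<^sup>2) \<partial>P)"
    by (intro nn_integral_cong) (auto simp: indicator_def)
  finally show ?thesis .
qed

text \<open>The hypothesis comparing \<F> and \<G> speaks of processes. Closing a martingale by Z
  turns it into a statement about conditioning a single random variable; Z will be a squared
  increment of W.\<close>

lemma martingale_cond_exp:
  assumes "integrable P Z"
  shows "martingale P H (\<lambda>t. real_cond_exp P (H t) Z)"
  unfolding martingale_def
proof (intro conjI allI impI)
  fix t :: real assume "0 \<le> t"
  then interpret sigma_finite_subalgebra P "H t" by (rule sigma_finite_subalgebra_H)
  show "integrable P (real_cond_exp P (H t) Z)" using real_cond_exp_int(1)[OF assms] .
next
  fix s t :: real assume st: "0 \<le> s \<and> s \<le> t"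
  then interpret sigma_finite_subalgebra P "H s" by (intro sigma_finite_subalgebra_H) simp
  show "AE \<omega> in P. real_cond_exp P (H s) (real_cond_exp P (H t) Z) \<omega> = real_cond_exp P (H s) Z \<omega>"
    using st by (intro real_cond_exp_nested_subalg sub subalgebra_mono assms) auto
qed simp

end


lemma borel_measurable_vec_nth [measurable]:
  fixes f :: "'a \<Rightarrow> real ^ 'n"
  assumes "f \<in> borel_measurable M"
  shows "(\<lambda>x. f x $ j) \<in> borel_measurable M"
proof -
  have "(\<lambda>v::real ^ 'n. v $ j) \<in> borel_measurable borel"
    by (intro borel_measurable_continuous_onI continuous_intros)
  from measurable_compose[OF assms this] show ?thesis .
qed


section \<open>The Brownian motion in the enlarged filtration\<close>

context default_market
begin

lemma W_measurable_F: "0 \<le> t \<Longrightarrow> W t \<in> borel_measurable (\<F> t)"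
proof (rule measurableI)
  fix B :: "(real ^ 'n) set" assume "0 \<le> t" "B \<in> sets borel"
  then have "W t -` B \<inter> space P \<in> sets (natural_filtration P W t)"
    unfolding sets_natural by (intro sigma_sets.Basic) auto
  then show "W t -` B \<inter> space (\<F> t) \<in> sets (\<F> t)"
    unfolding sets_F space_F by (intro sigma_sets.Basic) simp
qed simp

text \<open>Null sets are independent of everything, and by completeness a subset of a null set is
  null; so the natural \<sigma>-algebra together with the null sets is still intersection-stable and
  independent of the increment. Independence then passes to the generated \<sigma>-algebra.\<close>

lemma increment_indep:
  assumes st: "0 \<le> s" "s < t"
  shows "indep_set (sets (\<F> s)) (sets (vimage_algebra (space P) (\<lambda>\<omega>. W t \<omega> - W s \<omega>) borel))"
proof -
  let ?V = "sets (vimage_algebra (space P) (\<lambda>\<omega>. W t \<omega> - W s \<omega>) borel)"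
  have indep: "indep_set (sets (natural_filtration P W s)) ?V"
    using setting st by (simp add: default_setting_def standard_brownian_motion_def)
  then have V: "?V \<subseteq> sets P" and prod: "\<And>a b. a \<in> sets (natural_filtration P W s) \<Longrightarrow> b \<in> ?V \<Longrightarrow> prob (a \<inter> b) = prob a * prob b"
    by (auto simp: indep_sets2_eq)
  have "indep_set (sets (natural_filtration P W s) \<union> null_sets P) ?V"
  proof (rule indep_setI[OF _ V])
    show "sets (natural_filtration P W s) \<union> null_sets P \<subseteq> sets P"
      by (intro Un_least subsetI) (simp_all add: sets_natural_P null_setsD2)
    fix a b assume a: "a \<in> sets (natural_filtration P W s) \<union> null_sets P" and b: "b \<in> ?V"
    show "prob (a \<inter> b) = prob a * prob b"
    proof (cases "a \<in> null_sets P")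
      case True
      then have "a \<inter> b \<in> null_sets P" by (rule null_subset) simp
      then show ?thesis using True by (simp add: measure_eq_0_null_sets)
    qed (use a b prod in blast)
  qed
  moreover have "Int_stable (sets (natural_filtration P W s) \<union> null_sets P)"
  proof (rule Int_stableI)
    fix a b assume *: "a \<in> sets (natural_filtration P W s) \<union> null_sets P" "b \<in> sets (natural_filtration P W s) \<union> null_sets P"
    show "a \<inter> b \<in> sets (natural_filtration P W s) \<union> null_sets P"
    proof (cases "a \<in> null_sets P \<or> b \<in> null_sets P")
      case True
      then have "a \<inter> b \<in> null_sets P" using null_subset[of a "a \<inter> b"] null_subset[of b "a \<inter> b"] by auto
      then show ?thesis ..
    qed (use * in blast)
  qed
  ultimately have "indep_set (sigma_sets (space P) (sets (natural_filtration P W s) \<union> null_sets P)) (sigma_sets (space P) ?V)"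
    by (rule indep_set_sigma_sets[OF _ _ sets.Int_stable])
  moreover have "sigma_sets (space P) ?V = ?V"
    using sets.sigma_sets_eq[of "vimage_algebra (space P) (\<lambda>\<omega>. W t \<omega> - W s \<omega>) borel"] by simp
  ultimately show ?thesis by (simp add: sets_F)
qed

text \<open>Used with g the identity, for the martingale property of W, and with g the square, for
  the conditional variance.\<close>

lemma set_integral_increment:
  fixes g :: "real \<Rightarrow> real"
  assumes st: "0 \<le> s" "s < t" and A: "A \<in> sets (\<F> s)" and g: "g \<in> borel_measurable borel"
    and i: "integrable P (\<lambda>\<omega>. g (W t \<omega> $ j - W s \<omega> $ j))"
  shows "(LINT \<omega>:A|P. g (W t \<omega> $ j - W s \<omega> $ j)) = prob A * expectation (\<lambda>\<omega>. g (W t \<omega> $ j - W s \<omega> $ j))"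
proof -
  let ?V = "sets (vimage_algebra (space P) (\<lambda>\<omega>. W t \<omega> - W s \<omega>) borel)"
  let ?Y = "\<lambda>\<omega>. g (W t \<omega> $ j - W s \<omega> $ j)"
  have AP[measurable]: "A \<in> sets P" using sets_F_P[OF A] .
  have "indep_var borel (indicator A :: 'w \<Rightarrow> real) borel ?Y"
    unfolding indep_var_eq
  proof (intro conjI)
    show "random_variable borel (indicator A :: 'w \<Rightarrow> real)" by measurable
    show "random_variable borel ?Y" using i by auto
    have "sigma_sets (space P) {indicator A -` B \<inter> space P |B. B \<in> sets (borel :: real measure)} \<subseteq> sets (\<F> s)"
    proof -
      have "{indicator A -` B \<inter> space P |B. B \<in> sets (borel :: real measure)} \<subseteq> sets (\<F> s)"
      proof clarify
        fix B :: "real set" assume "B \<in> sets borel"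
        with borel_measurable_indicator[OF A] have "indicator A -` B \<inter> space (\<F> s) \<in> sets (\<F> s)"
          by (rule measurable_sets)
        then show "indicator A -` B \<inter> space P \<in> sets (\<F> s)" by (simp add: space_F)
      qed
      from sets.sigma_sets_subset[OF this] show ?thesis by (simp add: space_F)
    qed
    moreover have "sigma_sets (space P) {?Y -` B \<inter> space P |B. B \<in> sets borel} \<subseteq> ?V"
    proof -
      have "{?Y -` B \<inter> space P |B. B \<in> sets borel} \<subseteq> ?V"
      proof clarify
        fix B :: "real set" assume B: "B \<in> sets borel"
        have "(\<lambda>v. g (v $ j)) -` B \<inter> space borel \<in> sets borel"
          using measurable_compose[OF borel_measurable_vec_nth[OF measurable_ident_sets[OF refl]] g, of j] B
          by (intro measurable_sets) (simp_all add: id_def)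
        then have "(\<lambda>\<omega>. W t \<omega> - W s \<omega>) -` ((\<lambda>v. g (v $ j)) -` B) \<inter> space P \<in> ?V"
          by (intro in_vimage_algebra) simp
        then show "?Y -` B \<inter> space P \<in> ?V" by (simp add: vimage_def)
      qed
      from sets.sigma_sets_subset[OF this] show ?thesis by simp
    qed
    ultimately show "indep_set (sigma_sets (space P) {indicator A -` B \<inter> space P |B. B \<in> sets (borel :: real measure)})
        (sigma_sets (space P) {?Y -` B \<inter> space P |B. B \<in> sets borel})"
      using increment_indep[OF st] unfolding indep_sets2_eq by blast
  qed
  moreover have "integrable P (indicator A :: 'w \<Rightarrow> real)"
    using AP by (intro integrable_const_bound[of _ 1]) auto
  ultimately show ?thesis
    using indep_var_lebesgue_integral[of "indicator A :: 'w \<Rightarrow> real" ?Y] i by (simp add: set_lebesgue_integral_def)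
qed

lemma
  assumes st: "0 \<le> s" "s < t"
  shows integrable_increment: "integrable P (\<lambda>\<omega>. W t \<omega> $ j - W s \<omega> $ j)"
    and expectation_increment: "expectation (\<lambda>\<omega>. W t \<omega> $ j - W s \<omega> $ j) = 0"
    and integrable_increment_square: "integrable P (\<lambda>\<omega>. (W t \<omega> $ j - W s \<omega> $ j)\<^sup>2)"
    and expectation_increment_square: "expectation (\<lambda>\<omega>. (W t \<omega> $ j - W s \<omega> $ j)\<^sup>2) = t - s"
proof -
  have \<sigma>: "0 < sqrt (t - s)" using st by simp
  have D: "distributed P lborel (\<lambda>\<omega>. W t \<omega> $ j - W s \<omega> $ j) (normal_density 0 (sqrt (t - s)))"
    using setting st by (simp add: default_setting_def standard_brownian_motion_def)
  show "integrable P (\<lambda>\<omega>. W t \<omega> $ j - W s \<omega> $ j)"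
    using distributed_integrable[OF D, of "\<lambda>x. x"] integrable_normal_moment_nz_1[OF \<sigma>] by simp
  show E0: "expectation (\<lambda>\<omega>. W t \<omega> $ j - W s \<omega> $ j) = 0"
    by (rule normal_distributed_expectation[OF \<sigma> D])
  show "integrable P (\<lambda>\<omega>. (W t \<omega> $ j - W s \<omega> $ j)\<^sup>2)"
    using distributed_integrable[OF D, of "\<lambda>x. x\<^sup>2"] integrable_normal_moment[OF \<sigma>, of 0 2] by simp
  show "expectation (\<lambda>\<omega>. (W t \<omega> $ j - W s \<omega> $ j)\<^sup>2) = t - s"
    using normal_distributed_variance[OF \<sigma> D] E0 st by simp
qed

lemma W_0: "AE \<omega> in P. W 0 \<omega> = 0"
  using setting by (simp add: default_setting_def standard_brownian_motion_def)

lemma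
  assumes t: "0 \<le> t"
  shows integrable_W: "integrable P (\<lambda>\<omega>. W t \<omega> $ j)"
    and integrable_W_square: "integrable P (\<lambda>\<omega>. (W t \<omega> $ j)\<^sup>2)"
proof -
  have [measurable]: "W t \<in> borel_measurable P" "W 0 \<in> borel_measurable P" using t by measurable
  have "integrable P (\<lambda>\<omega>. W t \<omega> $ j - W 0 \<omega> $ j) \<and> integrable P (\<lambda>\<omega>. (W t \<omega> $ j - W 0 \<omega> $ j)\<^sup>2)"
    using integrable_increment[of 0 t j] integrable_increment_square[of 0 t j] t by (cases "t = 0") auto
  moreover have "integrable P (\<lambda>\<omega>. W t \<omega> $ j - W 0 \<omega> $ j) \<longleftrightarrow> integrable P (\<lambda>\<omega>. W t \<omega> $ j)"
    "integrable P (\<lambda>\<omega>. (W t \<omega> $ j - W 0 \<omega> $ j)\<^sup>2) \<longleftrightarrow> integrable P (\<lambda>\<omega>. (W t \<omega> $ j)\<^sup>2)"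
    by (rule integrable_cong_AE; use W_0 in \<open>auto elim!: eventually_mono\<close>)+
  ultimately show "integrable P (\<lambda>\<omega>. W t \<omega> $ j)" "integrable P (\<lambda>\<omega>. (W t \<omega> $ j)\<^sup>2)" by auto
qed

lemma W_martingale: "martingale P \<G> (\<lambda>t \<omega>. W t \<omega> $ j)"
proof (intro martingale_F_G F.martingaleI)
  show "(\<lambda>\<omega>. W t \<omega> $ j) \<in> borel_measurable (\<F> t)" if "0 \<le> t" for t
    using W_measurable_F[OF that] by measurable
  show "integrable P (\<lambda>\<omega>. W t \<omega> $ j)" if "0 \<le> t" for t using integrable_W[OF that] .
  fix s t A assume *: "0 \<le> s" "s \<le> t" "A \<in> sets (\<F> s)"
  show "(LINT \<omega>:A|P. W t \<omega> $ j) = (LINT \<omega>:A|P. W s \<omega> $ j)"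
  proof (cases "s = t")
    case False
    then have lt: "s < t" using * by simp
    have A: "A \<in> sets P" using sets_F_P * by blast
    have "(LINT \<omega>:A|P. W t \<omega> $ j - W s \<omega> $ j) = 0"
      using set_integral_increment[OF *(1) lt *(3) _ _, of "\<lambda>x. x" j] integrable_increment[OF *(1) lt]
        expectation_increment[OF *(1) lt] by simp
    moreover have "(LINT \<omega>:A|P. W t \<omega> $ j - W s \<omega> $ j) = (LINT \<omega>:A|P. W t \<omega> $ j) - (LINT \<omega>:A|P. W s \<omega> $ j)"
      using A * integrable_W[of t j] integrable_W[of s j]
      by (intro set_integral_diff) (auto simp del: real_scaleR_def simp: set_integrable_def intro!: integrable_mult_indicator)
    ultimately show ?thesis by simp
  qed simp
qed

text \<open>The conditional expectations of the squared increment given \<open>\<F> t\<close> form an \<open>\<F>\<close>-martingale, hence a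
  \<open>\<G>\<close>-martingale; so independence of \<open>\<F> s\<close> is as good as independence of \<open>\<G> s\<close>.\<close>

lemma increment_square_G:
  assumes st: "0 \<le> s" "s \<le> t" and A: "A \<in> sets (\<G> s)"
  shows "(LINT \<omega>:A|P. (W t \<omega> $ j - W s \<omega> $ j)\<^sup>2) = prob A * (t - s)"
proof (cases "s = t")
  case False
  then have lt: "s < t" using st by simp
  define Z where "Z = (\<lambda>\<omega>. (W t \<omega> $ j - W s \<omega> $ j)\<^sup>2)"
  have Z: "integrable P Z" unfolding Z_def by (rule integrable_increment_square[OF st(1) lt])
  have AP: "A \<in> sets P" using sets_G_P[OF A] .
  interpret Ft: sigma_finite_subalgebra P "\<F> t" by (rule F.sigma_finite_subalgebra_H) (use st in simp)
  interpret Fs: sigma_finite_subalgebra P "\<F> s" by (rule F.sigma_finite_subalgebra_H) fact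
  have m: "martingale P \<G> (\<lambda>t. real_cond_exp P (\<F> t) Z)"
    by (rule martingale_F_G[OF F.martingale_cond_exp[OF Z]])
  have [measurable]: "W t \<in> borel_measurable (\<F> t)" "W s \<in> borel_measurable (\<F> t)"
    using st by (auto intro!: W_measurable_F F.measurable_H_mono[OF st W_measurable_F])
  have "Z \<in> borel_measurable (\<F> t)" unfolding Z_def by measurable
  then have 1: "AE \<omega> in P. real_cond_exp P (\<F> t) Z \<omega> = Z \<omega>"
    by (rule Ft.real_cond_exp_F_meas[OF Z])
  have 2: "AE \<omega> in P. real_cond_exp P (\<F> s) Z \<omega> = t - s"
  proof (rule Fs.real_cond_exp_charact)
    fix B assume B: "B \<in> sets (\<F> s)"
    have "(LINT \<omega>:B|P. Z \<omega>) = prob B * (t - s)"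
      unfolding Z_def
      using set_integral_increment[OF st(1) lt B _ integrable_increment_square[OF st(1) lt], of j]
        expectation_increment_square[OF st(1) lt] by simp
    moreover have "(LINT \<omega>:B|P. (t - s)) = prob B * (t - s)"
      using sets_F_P[OF B] by (simp add: set_lebesgue_integral_def)
    ultimately show "(LINT \<omega>:B|P. Z \<omega>) = (LINT \<omega>:B|P. (t - s))" by simp
  qed (use Z in auto)
  \<comment> \<open>The closed martingale runs from the constant \<open>t - s\<close> at time s to Z
    at time t, so its \<G>-martingale property between these times gives the claim.\<close>
  have "(LINT \<omega>:A|P. Z \<omega>) = (LINT \<omega>:A|P. real_cond_exp P (\<F> t) Z \<omega>)"
    unfolding set_lebesgue_integral_def using 1 AP Z
    by (intro integral_cong_AE) (auto elim!: eventually_mono intro: borel_measurable_integrable)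
  also have "\<dots> = (LINT \<omega>:A|P. real_cond_exp P (\<F> s) Z \<omega>)"
    by (rule G.martingale_set_integral[OF m st A])
  also have "\<dots> = (LINT \<omega>:A|P. (t - s))"
    unfolding set_lebesgue_integral_def using 2 AP
    by (intro integral_cong_AE) (auto elim!: eventually_mono)
  also have "\<dots> = prob A * (t - s)" using AP by (simp add: set_lebesgue_integral_def)
  finally show ?thesis by (simp add: Z_def)
qed simp


subsection \<open>Integrals of simple integrands\<close>

lemma simple_integrand_F_G: "simple_integrand P \<F> T S \<Longrightarrow> simple_integrand P \<G> T S"
  unfolding simple_integrand_def by (auto dest: measurable_F_G)

lemma simple_integral_Cons:
  "simple_integral W ((a, b, \<xi>) # S) t \<omega> = \<xi> \<omega> \<bullet> (W (min b t) \<omega> - W (min a t) \<omega>) + simple_integral W S t \<omega>"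
  by (simp add: simple_integral_def)

lemma simple_integral_Nil: "simple_integral W [] t \<omega> = 0"
  by (simp add: simple_integral_def)

lemma simple_integral_append:
  "simple_integral W (S @ S') t \<omega> = simple_integral W S t \<omega> + simple_integral W S' t \<omega>"
  by (simp add: simple_integral_def)

lemma simple_integrand_Cons:
  "simple_integrand P H T ((a, b, \<xi>) # S) \<longleftrightarrow> 0 \<le> a \<and> a \<le> b \<and> b \<le> T \<and> \<xi> \<in> borel_measurable (H a) \<and>
    (\<exists>K. \<forall>\<omega>\<in>space P. norm (\<xi> \<omega>) \<le> K) \<and> simple_integrand P H T S"
  by (auto simp: simple_integrand_def)

text \<open>By induction on the list of pieces: each contributes a finite sum over coordinates of
  one-step martingale transforms. Only square integrability is claimed, not an isometry, so the
  intervals of different pieces may overlap.\<close>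

lemma
  assumes "simple_integrand P \<G> T S"
  shows simple_integral_martingale: "martingale P \<G> (simple_integral W S)"
    and simple_integral_square: "0 \<le> t \<Longrightarrow> integrable P (\<lambda>\<omega>. (simple_integral W S t \<omega>)\<^sup>2)"
proof -
  have "martingale P \<G> (simple_integral W S) \<and> (\<forall>t\<ge>0. integrable P (\<lambda>\<omega>. (simple_integral W S t \<omega>)\<^sup>2))"
    using assms
  proof (induction S)
    case Nil
    have "simple_integral W [] = (\<lambda>t \<omega>. 0)" by (simp add: fun_eq_iff simple_integral_Nil)
    then show ?case using G.martingale_0 by simp
  next
    case (Cons x S)
    obtain a b \<xi> where x: "x = (a, b, \<xi>)" by (cases x)
    from Cons.prems obtain K where ab: "0 \<le> a" "a \<le> b" and \<xi>: "\<xi> \<in> borel_measurable (\<G> a)"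
      and K: "\<And>\<omega>. \<omega> \<in> space P \<Longrightarrow> norm (\<xi> \<omega>) \<le> K" and S: "simple_integrand P \<G> T S"
      by (auto simp: x simple_integrand_Cons)
    define Y where "Y t \<omega> = (\<Sum>j\<in>UNIV. \<xi> \<omega> $ j * (W (min b t) \<omega> $ j - W (min a t) \<omega> $ j))" for t \<omega>
    have eq: "simple_integral W (x # S) = (\<lambda>t \<omega>. Y t \<omega> + simple_integral W S t \<omega>)"
      by (simp add: fun_eq_iff x simple_integral_Cons Y_def inner_vec_def)
    have \<xi>j: "(\<lambda>\<omega>. \<xi> \<omega> $ j) \<in> borel_measurable (\<G> a)" for j using \<xi> by measurable
    have Kj: "\<bar>\<xi> \<omega> $ j\<bar> \<le> K" if "\<omega> \<in> space P" for \<omega> j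
      using K[OF that] component_le_norm_cart[of "\<xi> \<omega>" j] by simp
    have mj: "martingale P \<G> (\<lambda>t \<omega>. \<xi> \<omega> $ j * (W (min b t) \<omega> $ j - W (min a t) \<omega> $ j))" for j
      by (rule G.martingale_transform[OF W_martingale ab \<xi>j Kj])
    have mY: "martingale P \<G> Y"
      unfolding Y_def[abs_def] by (rule G.martingale_sum) (rule mj)
    have m: "martingale P \<G> (simple_integral W S)" and sq: "\<And>t. 0 \<le> t \<Longrightarrow> integrable P (\<lambda>\<omega>. (simple_integral W S t \<omega>)\<^sup>2)"
      using Cons.IH[OF S] by auto
    have sqY: "integrable P (\<lambda>\<omega>. (Y t \<omega>)\<^sup>2)" if t: "0 \<le> t" for t
    proof -
      have s1: "integrable P (\<lambda>\<omega>. (\<xi> \<omega> $ j * (W (min b t) \<omega> $ j - W (min a t) \<omega> $ j))\<^sup>2)" for j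
      proof -
        have [measurable]: "(\<lambda>\<omega>. \<xi> \<omega> $ j) \<in> borel_measurable P" using G.measurable_H_P[OF ab(1) \<xi>j] .
        have [measurable]: "W (min b t) \<in> borel_measurable P" "W (min a t) \<in> borel_measurable P"
          using W_measurable ab t by auto
        have "integrable P (\<lambda>\<omega>. (W (min b t) \<omega> $ j + - W (min a t) \<omega> $ j)\<^sup>2)"
          using integrable_W_square ab t by (intro integrable_square_add) auto
        then have "integrable P (\<lambda>\<omega>. (\<xi> \<omega> $ j)\<^sup>2 * (W (min b t) \<omega> $ j + - W (min a t) \<omega> $ j)\<^sup>2)"
          using power_mono[OF Kj abs_ge_zero, of _ j 2] by (intro integrable_bounded_mult[where K = "K\<^sup>2"]) auto
        then show ?thesis by (simp add: power_mult_distrib)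
      qed
      have mm: "(\<lambda>\<omega>. \<xi> \<omega> $ j * (W (min b t) \<omega> $ j - W (min a t) \<omega> $ j)) \<in> borel_measurable P" for j
        using G.martingale_integrable[OF mj t] by auto
      have "integrable P (\<lambda>\<omega>. (\<Sum>j\<in>J. \<xi> \<omega> $ j * (W (min b t) \<omega> $ j - W (min a t) \<omega> $ j))\<^sup>2)" if "finite J" for J
        using that
      proof induction
        case (insert j J)
        have "integrable P (\<lambda>\<omega>. (\<xi> \<omega> $ j * (W (min b t) \<omega> $ j - W (min a t) \<omega> $ j) +
            (\<Sum>j\<in>J. \<xi> \<omega> $ j * (W (min b t) \<omega> $ j - W (min a t) \<omega> $ j)))\<^sup>2)"
          by (rule integrable_square_add[OF mm _ s1 insert.IH]) (intro borel_measurable_sum mm)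
        then show ?case using insert.hyps by simp
      qed simp
      then show ?thesis by (simp add: Y_def)
    qed
    show ?case
      unfolding eq
      using G.martingale_add[OF mY m] integrable_square_add[OF _ _ sqY sq]
        borel_measurable_integrable[OF G.martingale_integrable[OF mY]]
        borel_measurable_integrable[OF G.martingale_integrable[OF m]] by simp
  qed
  then show "martingale P \<G> (simple_integral W S)" "0 \<le> t \<Longrightarrow> integrable P (\<lambda>\<omega>. (simple_integral W S t \<omega>)\<^sup>2)"
    by auto
qed

end


section \<open>Discretising the random time\<close>

text \<open>The least multiple of \<open>1 / 2 ^ n\<close> that is at least x; grid points stay
  fixed, and the sets of constancy are left-open and right-closed intervals.\<close>

definition dyadic :: "nat \<Rightarrow> real \<Rightarrow> real" where
  "dyadic n x = of_int \<lceil>2 ^ n * x\<rceil> / 2 ^ n"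

lemma dyadic_ge: "x \<le> dyadic n x"
  using le_of_int_ceiling[of "2 ^ n * x"] by (simp add: dyadic_def field_simps)

lemma dyadic_le: "dyadic n x \<le> x + 1 / 2 ^ n"
proof -
  have "of_int \<lceil>2 ^ n * x\<rceil> \<le> 2 ^ n * x + 1" by linarith
  then show ?thesis by (simp add: dyadic_def field_simps)
qed

lemma dyadic_nonneg: "0 \<le> x \<Longrightarrow> 0 \<le> dyadic n x"
  using dyadic_ge[of x n] by linarith

lemma dyadic_dyadic: "n \<le> m \<Longrightarrow> dyadic n (dyadic m x) = dyadic n x"
proof -
  assume "n \<le> m"
  then obtain k where m: "m = n + k" using le_Suc_ex by blast
  have "\<lceil>2 ^ n * (real_of_int \<lceil>2 ^ m * x\<rceil> / 2 ^ m)\<rceil> \<le> j \<longleftrightarrow> \<lceil>2 ^ n * x\<rceil> \<le> j" for j :: int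
  proof -
    have "\<lceil>2 ^ n * (real_of_int \<lceil>2 ^ m * x\<rceil> / 2 ^ m)\<rceil> \<le> j \<longleftrightarrow> real_of_int \<lceil>2 ^ m * x\<rceil> \<le> real_of_int (j * 2 ^ k)"
      by (simp add: ceiling_le_iff m power_add field_simps)
    also have "\<dots> \<longleftrightarrow> 2 ^ m * x \<le> real_of_int (j * 2 ^ k)"
      unfolding of_int_le_iff ceiling_le_iff ..
    also have "\<dots> \<longleftrightarrow> \<lceil>2 ^ n * x\<rceil> \<le> j"
      by (simp add: ceiling_le_iff m power_add field_simps)
    finally show ?thesis .
  qed
  then show ?thesis unfolding dyadic_def by (metis order.antisym order_refl)
qed

lemma dyadic_tendsto: "(\<lambda>n. dyadic n x) \<longlonglongrightarrow> x"
proof (rule tendsto_sandwich[of "\<lambda>_. x" _ _ "\<lambda>n. x + (1 / 2) ^ n"])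
  show "(\<lambda>n. x + (1 / 2) ^ n) \<longlonglongrightarrow> x"
    using tendsto_add[OF tendsto_const LIMSEQ_power_zero[of "1 / 2 :: real"], of x] by simp
qed (use dyadic_ge dyadic_le in \<open>auto simp: power_one_over\<close>)

text \<open>If x exceeds t, rounding up stays above t on both sides. The point is that the truncated
  dyadic time depends on x only through \<open>min t x\<close>, which is known at time t when x is a
  stopping time.\<close>

lemma min_dyadic_min: "min t (dyadic n (min t x)) = min t (dyadic n x)"
proof (cases "x \<le> t")
  case False
  then show ?thesis using dyadic_ge[of t n] dyadic_ge[of x n] by (simp add: min_def)
qed (simp add: min_absorb2)

lemma ceiling_le_nat_iff: "0 \<le> x \<Longrightarrow> nat \<lceil>2 ^ n * x\<rceil> \<le> j \<longleftrightarrow> x \<le> real j / 2 ^ n"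
  by (simp add: nat_le_iff ceiling_le_iff field_simps)

lemma dyadic_eq_nat: "0 \<le> x \<Longrightarrow> dyadic n x = real (nat \<lceil>2 ^ n * x\<rceil>) / 2 ^ n"
  by (simp add: dyadic_def)

text \<open>The bound is asked only eventually, because a dyadic approximation can be compared with
  finer ones only.\<close>

lemma nn_integral_Fatou_square:
  fixes f :: "nat \<Rightarrow> 'a \<Rightarrow> real"
  assumes [measurable]: "\<And>m. f m \<in> borel_measurable M"
    and lim: "AE x in M. (\<lambda>m. f m x) \<longlonglongrightarrow> g x"
    and le: "\<forall>\<^sub>F m in sequentially. (\<integral>\<^sup>+x. ennreal ((f m x)\<^sup>2) \<partial>M) \<le> c"
  shows "(\<integral>\<^sup>+x. ennreal ((g x)\<^sup>2) \<partial>M) \<le> c"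
proof -
  have "AE x in M. ennreal ((g x)\<^sup>2) = liminf (\<lambda>m. ennreal ((f m x)\<^sup>2))"
    using lim
  proof eventually_elim
    case (elim x)
    then have "(\<lambda>m. ennreal ((f m x)\<^sup>2)) \<longlonglongrightarrow> ennreal ((g x)\<^sup>2)"
      by (intro tendsto_ennrealI tendsto_power)
    from lim_imp_Liminf[OF _ this] show ?case by simp
  qed
  then have "(\<integral>\<^sup>+x. ennreal ((g x)\<^sup>2) \<partial>M) = (\<integral>\<^sup>+x. liminf (\<lambda>m. ennreal ((f m x)\<^sup>2)) \<partial>M)"
    by (rule nn_integral_cong_AE)
  also have "\<dots> \<le> liminf (\<lambda>m. \<integral>\<^sup>+x. ennreal ((f m x)\<^sup>2) \<partial>M)"
    by (intro nn_integral_liminf) measurable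
  also have "\<dots> \<le> c" by (rule Liminf_le[OF _ le]) simp
  finally show ?thesis .
qed

text \<open>On the cell k = j the random index may be replaced by j. This reduces integrals at a
  random time with finitely many values to integrals at fixed times.\<close>

lemma nn_integral_partition:
  fixes k :: "'a \<Rightarrow> nat" and f :: "nat \<Rightarrow> 'a \<Rightarrow> ennreal"
  assumes k: "\<And>x. x \<in> space M \<Longrightarrow> k x \<le> J" and A: "\<And>j. {x \<in> space M. k x = j} \<in> sets M"
    and f: "\<And>j. f j \<in> borel_measurable M"
  shows "(\<integral>\<^sup>+x. f (k x) x \<partial>M) = (\<Sum>j\<le>J. \<integral>\<^sup>+x. indicator {x \<in> space M. k x = j} x * f j x \<partial>M)"
proof -
  have "(\<integral>\<^sup>+x. f (k x) x \<partial>M) = (\<integral>\<^sup>+x. (\<Sum>j\<le>J. indicator {x \<in> space M. k x = j} x * f j x) \<partial>M)"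
  proof (intro nn_integral_cong)
    fix x assume x: "x \<in> space M"
    have "(\<Sum>j\<le>J. indicator {x \<in> space M. k x = j} x * f j x) = (\<Sum>j\<le>J. if j = k x then f j x else 0)"
      using x by (intro sum.cong) (auto simp: indicator_def)
    also have "\<dots> = f (k x) x" using k[OF x] by simp
    finally show "f (k x) x = (\<Sum>j\<le>J. indicator {x \<in> space M. k x = j} x * f j x)" ..
  qed
  also have "\<dots> = (\<Sum>j\<le>J. \<integral>\<^sup>+x. indicator {x \<in> space M. k x = j} x * f j x \<partial>M)"
    by (rule nn_integral_sum) (use A f in auto)
  finally show ?thesis .
qed

section \<open>Stopping at the discretised random time\<close>

context default_market
begin

text \<open>The real-valued time \<tau> \<and> T; being bounded, it has only finitely many dyadic
  indices at each level.\<close>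

definition cut_time :: "real \<Rightarrow> 'w \<Rightarrow> real" where
  "cut_time T \<omega> = stopped T (\<tau> \<omega>)"

lemma cut_time_bounds:
  assumes "0 \<le> T" "\<omega> \<in> space P"
  shows "0 \<le> cut_time T \<omega>" "cut_time T \<omega> \<le> T"
  using stopped_nonneg[OF \<tau>_nonneg[OF assms(2)] assms(1)] le_stopped_iff[OF \<tau>_nonneg[OF assms(2)], of "stopped T (\<tau> \<omega>)" T]
  by (simp_all add: cut_time_def)

lemma le_cut_time_iff: "\<omega> \<in> space P \<Longrightarrow> t \<le> T \<Longrightarrow> t \<le> cut_time T \<omega> \<longleftrightarrow> ereal t \<le> \<tau> \<omega>"
  by (simp add: cut_time_def le_stopped_iff[OF \<tau>_nonneg])

lemma stopped_eq_min: 
  assumes "\<omega> \<in> space P" "t \<le> T"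
  shows "stopped t (\<tau> \<omega>) = min t (cut_time T \<omega>)"
  using \<tau>_nonneg[OF assms(1)] assms(2) by (cases "\<tau> \<omega>") (auto simp: cut_time_def stopped_def min_def)

lemma cut_time_le_sets:
  assumes "0 \<le> s"
  shows "{\<omega> \<in> space P. cut_time T \<omega> \<le> s} \<in> sets (\<G> s)"
proof (cases "T \<le> s")
  case True
  then have "{\<omega> \<in> space P. cut_time T \<omega> \<le> s} = space (\<G> s)"
    using le_stopped_iff[OF \<tau>_nonneg, of _ "stopped T (\<tau> _)" T]
    by (force simp: cut_time_def space_G)
  then show ?thesis by simp
next
  case False
  have "cut_time T \<omega> \<le> s \<longleftrightarrow> \<tau> \<omega> \<le> ereal s" if "\<omega> \<in> space P" for \<omega>
    using \<tau>_nonneg[OF that] False by (cases "\<tau> \<omega>") (auto simp: cut_time_def stopped_def min_def)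
  then have "{\<omega> \<in> space P. cut_time T \<omega> \<le> s} = {\<omega> \<in> space P. \<tau> \<omega> \<le> ereal s}" by auto
  then show ?thesis using \<tau>_stopping[OF assms] by simp
qed

lemma min_cut_time_measurable:
  assumes "0 \<le> T" "0 \<le> t"
  shows "(\<lambda>\<omega>. min t (cut_time T \<omega>)) \<in> borel_measurable (\<G> t)"
proof (subst borel_measurable_iff_le, intro allI)
  fix a
  consider "a < 0" | "0 \<le> a" "a < t" | "t \<le> a" by linarith
  then show "{w \<in> space (\<G> t). min t (cut_time T w) \<le> a} \<in> sets (\<G> t)"
  proof cases
    case 1
    then have "{w \<in> space (\<G> t). min t (cut_time T w) \<le> a} = {}"
      using cut_time_bounds(1)[OF assms(1)] assms(2) by (fastforce simp: space_G min_le_iff_disj)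
    then show ?thesis by (simp only: sets.empty_sets)
  next
    case 2
    then have "{w \<in> space (\<G> t). min t (cut_time T w) \<le> a} = {w \<in> space P. cut_time T w \<le> a}"
      by (auto simp: space_G min_def)
    then show ?thesis using cut_time_le_sets[OF 2(1), of T] G_mono[of a t] 2 by auto
  next
    case 3
    then have "{w \<in> space (\<G> t). min t (cut_time T w) \<le> a} = space (\<G> t)" by (auto simp: min_def)
    then show ?thesis by simp
  qed
qed

text \<open>Index j means that \<tau> \<and> T lies between the grid points j - 1 and j, the latter
  included, and this is decided at j. It is here that rounding up, not down, matters. For j = 0 the
  cell is \<tau> \<and> T = 0.\<close>

lemma dyadic_cell:
  assumes T: "0 \<le> T"
  shows "{\<omega> \<in> space P. nat \<lceil>2 ^ n * cut_time T \<omega>\<rceil> = j} \<in> sets (\<G> (real j / 2 ^ n))"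
proof -
  have le: "{\<omega> \<in> space P. nat \<lceil>2 ^ n * cut_time T \<omega>\<rceil> \<le> i} \<in> sets (\<G> (real j / 2 ^ n))" if "i \<le> j" for i
  proof -
    have "{\<omega> \<in> space P. nat \<lceil>2 ^ n * cut_time T \<omega>\<rceil> \<le> i} = {\<omega> \<in> space P. cut_time T \<omega> \<le> real i / 2 ^ n}"
      using ceiling_le_nat_iff[OF cut_time_bounds(1)[OF T]] by blast
    moreover have "{\<omega> \<in> space P. cut_time T \<omega> \<le> real i / 2 ^ n} \<in> sets (\<G> (real i / 2 ^ n))"
      by (rule cut_time_le_sets) simp
    moreover have "sets (\<G> (real i / 2 ^ n)) \<subseteq> sets (\<G> (real j / 2 ^ n))"
      by (rule G_mono) (use that in \<open>simp add: divide_right_mono\<close>)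
    ultimately show ?thesis by (simp only: subsetD)
  qed
  have "{\<omega> \<in> space P. f \<omega> = j} = {\<omega> \<in> space P. f \<omega> \<le> j} - (if j = 0 then {} else {\<omega> \<in> space P. f \<omega> \<le> j - 1})"
    for f :: "'w \<Rightarrow> nat"
    by auto
  from this[of "\<lambda>\<omega>. nat \<lceil>2 ^ n * cut_time T \<omega>\<rceil>"] show ?thesis using le[of j] le[of "j - 1"] by (simp only: split: if_split) auto
qed

lemma dyadic_index_le:
  assumes "0 \<le> T" "\<omega> \<in> space P"
  shows "nat \<lceil>2 ^ n * cut_time T \<omega>\<rceil> \<le> nat \<lceil>2 ^ n * T\<rceil>"
  using cut_time_bounds[OF assms] by (intro nat_mono ceiling_mono) simp

text \<open>The index of \<open>min t (cut_time T \<omega>)\<close> has countably many values and is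
  known at time t, so it suffices to treat each value, where the process is taken at a fixed time in
  [0, t].\<close>

lemma dyadic_stopped_measurable:
  assumes T: "0 \<le> T" and t: "0 \<le> t" and X: "\<And>s. 0 \<le> s \<Longrightarrow> s \<le> t \<Longrightarrow> X s \<in> measurable (\<G> s) N"
  shows "(\<lambda>\<omega>. X (min t (dyadic n (cut_time T \<omega>))) \<omega>) \<in> measurable (\<G> t) N"
proof -
  have "(\<lambda>\<omega>. \<lceil>2 ^ n * min t (cut_time T \<omega>)\<rceil>) \<in> measurable (\<G> t) (count_space UNIV)"
    using min_cut_time_measurable[OF T t] by measurable
  \<comment> \<open>The index type contains negative integers, which do not occur as indices;
    \<open>max 0\<close> keeps the time admissible for them too.\<close>
  moreover have "(\<lambda>\<omega>. X (max 0 (min t (real_of_int i / 2 ^ n))) \<omega>) \<in> measurable (\<G> t) N" for i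
    by (rule G.measurable_H_mono[OF _ _ X]) (use t in auto)
  ultimately have "(\<lambda>\<omega>. X (max 0 (min t (real_of_int \<lceil>2 ^ n * min t (cut_time T \<omega>)\<rceil> / 2 ^ n))) \<omega>) \<in> measurable (\<G> t) N"
    by (rule measurable_compose_countable[rotated])
  also have "?this \<longleftrightarrow> ?thesis"
  proof (intro measurable_cong)
    fix \<omega> assume "\<omega> \<in> space (\<G> t)"
    then have "0 \<le> dyadic n (cut_time T \<omega>)" by (simp add: space_G dyadic_nonneg cut_time_bounds[OF T])
    then have "max 0 (min t (real_of_int \<lceil>2 ^ n * min t (cut_time T \<omega>)\<rceil> / 2 ^ n)) = min t (dyadic n (cut_time T \<omega>))"
      using t by (simp add: dyadic_def[symmetric] min_dyadic_min)
    then show "X (max 0 (min t (real_of_int \<lceil>2 ^ n * min t (cut_time T \<omega>)\<rceil> / 2 ^ n))) \<omega> = X (min t (dyadic n (cut_time T \<omega>))) \<omega>"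
      by simp
  qed
  finally show ?thesis .
qed

text \<open>Off the exceptional null set the limit is everywhere; on it every subset is null by
  completeness and thus belongs to \<open>\<G> t\<close>, so arbitrary values of g there are
  allowed.\<close>

lemma AE_limit_measurable_G:
  fixes f :: "nat \<Rightarrow> 'w \<Rightarrow> 'b::{metric_space, zero}"
  assumes f: "\<And>n. f n \<in> borel_measurable (\<G> t)" and lim: "AE \<omega> in P. (\<lambda>n. f n \<omega>) \<longlonglongrightarrow> g \<omega>"
  shows "g \<in> borel_measurable (\<G> t)"
proof -
  obtain N where N: "{\<omega> \<in> space P. \<not> (\<lambda>n. f n \<omega>) \<longlonglongrightarrow> g \<omega>} \<subseteq> N" "N \<in> null_sets P"
    using lim by (rule AE_E3) (auto simp: Collect_conj_eq)
  have NG[measurable]: "N \<in> sets (\<G> t)" using null_G[OF N(2)] .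
  have "(\<lambda>\<omega>. if \<omega> \<in> N then 0 else g \<omega>) \<in> borel_measurable (\<G> t)"
  proof (rule borel_measurable_LIMSEQ_metric[of "\<lambda>n \<omega>. if \<omega> \<in> N then 0 else f n \<omega>"])
    show "(\<lambda>\<omega>. if \<omega> \<in> N then 0 else f n \<omega>) \<in> borel_measurable (\<G> t)" for n
      using f[of n] by measurable
    show "(\<lambda>n. if \<omega> \<in> N then 0 else f n \<omega>) \<longlonglongrightarrow> (if \<omega> \<in> N then 0 else g \<omega>)" if "\<omega> \<in> space (\<G> t)" for \<omega>
      using that N(1) by (auto simp: space_G)
  qed
  note g' = measurable_sets[OF this]
  show ?thesis
  proof (rule measurableI)
    fix B :: "'b set" assume B: "B \<in> sets borel"
    have "((\<lambda>\<omega>. if \<omega> \<in> N then 0 else g \<omega>) -` B \<inter> space (\<G> t) - N) \<union> (g -` B \<inter> space (\<G> t) \<inter> N) \<in> sets (\<G> t)"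
    proof (intro sets.Un sets.Diff g'[OF B] NG)
      show "g -` B \<inter> space (\<G> t) \<inter> N \<in> sets (\<G> t)"
        by (rule null_G[OF null_subset[OF N(2)]]) blast
    qed
    also have "((\<lambda>\<omega>. if \<omega> \<in> N then 0 else g \<omega>) -` B \<inter> space (\<G> t) - N) \<union> (g -` B \<inter> space (\<G> t) \<inter> N) =
        g -` B \<inter> space (\<G> t)"
      by auto
    finally show "g -` B \<inter> space (\<G> t) \<in> sets (\<G> t)" .
  qed simp
qed

lemma dyadic_stopped_tendsto:
  fixes X :: "real \<Rightarrow> 'w \<Rightarrow> 'b::topological_space"
  assumes T: "0 \<le> T" and t: "0 \<le> t" "t \<le> T" and cont: "AE \<omega> in P. continuous_on {0..T} (\<lambda>s. X s \<omega>)"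
  shows "AE \<omega> in P. (\<lambda>n. X (min t (dyadic n (cut_time T \<omega>))) \<omega>) \<longlonglongrightarrow> X (min t (cut_time T \<omega>)) \<omega>"
  using cont AE_space
proof eventually_elim
  case (elim \<omega>)
  note b = cut_time_bounds[OF T elim(2)]
  show ?case
  proof (rule continuous_on_tendsto_compose[OF elim(1)])
    show "(\<lambda>n. min t (dyadic n (cut_time T \<omega>))) \<longlonglongrightarrow> min t (cut_time T \<omega>)"
      by (intro tendsto_min tendsto_const dyadic_tendsto)
  qed (use b t in \<open>auto intro!: always_eventually dyadic_nonneg min.coboundedI1\<close>)
qed

text \<open>Path continuity and dyadic approximation take the place of progressive
  measurability.\<close>

lemma stopped_measurable:
  fixes X :: "real \<Rightarrow> 'w \<Rightarrow> 'b::{metric_space, zero}"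
  assumes T: "0 \<le> T" and t: "0 \<le> t" "t \<le> T" and cont: "AE \<omega> in P. continuous_on {0..T} (\<lambda>s. X s \<omega>)"
    and X: "\<And>s. 0 \<le> s \<Longrightarrow> s \<le> t \<Longrightarrow> X s \<in> borel_measurable (\<G> s)"
  shows "(\<lambda>\<omega>. X (min t (cut_time T \<omega>)) \<omega>) \<in> borel_measurable (\<G> t)"
  by (rule AE_limit_measurable_G[OF dyadic_stopped_measurable[OF T t(1) X] dyadic_stopped_tendsto[OF T t cont]])

text \<open>Optional stopping for squares that grow in mean up to a factor C, a weakened
  submartingale property. On a cell whose grid point is at most t the hypothesis \<open>le\<close>
  applies; beyond t the truncated time is t itself, and \<open>1 \<le> C\<close> pays. Fatou's lemma
  then removes the rounding.\<close>

lemma stopped_square_le: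
  fixes Z :: "real \<Rightarrow> 'w \<Rightarrow> real"
  assumes T: "0 \<le> T" and t: "0 \<le> t" "t \<le> T" and cont: "AE \<omega> in P. continuous_on {0..T} (\<lambda>s. Z s \<omega>)"
    and Z: "\<And>s. 0 \<le> s \<Longrightarrow> s \<le> t \<Longrightarrow> Z s \<in> borel_measurable (\<G> s)" and C: "1 \<le> C"
    and le: "\<And>s A. 0 \<le> s \<Longrightarrow> s \<le> t \<Longrightarrow> A \<in> sets (\<G> s) \<Longrightarrow>
      (\<integral>\<^sup>+\<omega>. indicator A \<omega> * ennreal ((Z s \<omega>)\<^sup>2) \<partial>P) \<le> C * (\<integral>\<^sup>+\<omega>. indicator A \<omega> * ennreal ((Z t \<omega>)\<^sup>2) \<partial>P)"
  shows "(\<integral>\<^sup>+\<omega>. ennreal ((Z (min t (cut_time T \<omega>)) \<omega>)\<^sup>2) \<partial>P) \<le> C * (\<integral>\<^sup>+\<omega>. ennreal ((Z t \<omega>)\<^sup>2) \<partial>P)"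
proof (rule nn_integral_Fatou_square[OF _ dyadic_stopped_tendsto[OF T t cont] always_eventually, OF _ allI])
  show "(\<lambda>\<omega>. Z (min t (dyadic n (cut_time T \<omega>))) \<omega>) \<in> borel_measurable P" for n
    by (rule G.measurable_H_P[OF t(1) dyadic_stopped_measurable[OF T t(1) Z]])
  fix n
  define k where "k \<omega> = nat \<lceil>2 ^ n * cut_time T \<omega>\<rceil>" for \<omega>
  let ?J = "nat \<lceil>2 ^ n * T\<rceil>"
  have A: "{\<omega> \<in> space P. k \<omega> = j} \<in> sets (\<G> (real j / 2 ^ n))" for j
    unfolding k_def by (rule dyadic_cell[OF T])
  then have AP: "{\<omega> \<in> space P. k \<omega> = j} \<in> sets P" for j by (rule sets_G_P)
  have k: "k \<omega> \<le> ?J" if "\<omega> \<in> space P" for \<omega> unfolding k_def by (rule dyadic_index_le[OF T that])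
  have ZP[measurable]: "Z s \<in> borel_measurable P" if "0 \<le> s" "s \<le> t" for s
    by (rule G.measurable_H_P[OF that(1) Z[OF that]])
  have "(\<integral>\<^sup>+\<omega>. ennreal ((Z (min t (dyadic n (cut_time T \<omega>))) \<omega>)\<^sup>2) \<partial>P) =
      (\<integral>\<^sup>+\<omega>. ennreal ((Z (min t (real (k \<omega>) / 2 ^ n)) \<omega>)\<^sup>2) \<partial>P)"
    by (intro nn_integral_cong) (simp add: k_def dyadic_eq_nat cut_time_bounds[OF T])
  also have "\<dots> = (\<Sum>j\<le>?J. \<integral>\<^sup>+\<omega>. indicator {\<omega> \<in> space P. k \<omega> = j} \<omega> * ennreal ((Z (min t (real j / 2 ^ n)) \<omega>)\<^sup>2) \<partial>P)"
    by (rule nn_integral_partition[OF k AP]) (use ZP t in simp_all)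
  also have "\<dots> \<le> (\<Sum>j\<le>?J. C * (\<integral>\<^sup>+\<omega>. indicator {\<omega> \<in> space P. k \<omega> = j} \<omega> * ennreal ((Z t \<omega>)\<^sup>2) \<partial>P))"
  proof (intro sum_mono)
    fix j
    show "(\<integral>\<^sup>+\<omega>. indicator {\<omega> \<in> space P. k \<omega> = j} \<omega> * ennreal ((Z (min t (real j / 2 ^ n)) \<omega>)\<^sup>2) \<partial>P)
      \<le> C * (\<integral>\<^sup>+\<omega>. indicator {\<omega> \<in> space P. k \<omega> = j} \<omega> * ennreal ((Z t \<omega>)\<^sup>2) \<partial>P)"
    proof (cases "real j / 2 ^ n \<le> t")
      case True
      then show ?thesis using le[OF _ True A] by (simp add: min_absorb2)
    next
      case False
      then show ?thesis using mult_right_mono[OF C, of "\<integral>\<^sup>+\<omega>. indicator {\<omega> \<in> space P. k \<omega> = j} \<omega> * ennreal ((Z t \<omega>)\<^sup>2) \<partial>P"]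
        by (simp add: min_absorb1)
    qed
  qed
  also have "\<dots> = C * (\<Sum>j\<le>?J. \<integral>\<^sup>+\<omega>. indicator {\<omega> \<in> space P. k \<omega> = j} \<omega> * ennreal ((Z t \<omega>)\<^sup>2) \<partial>P)"
    by (simp add: sum_distrib_left)
  also have "(\<Sum>j\<le>?J. \<integral>\<^sup>+\<omega>. indicator {\<omega> \<in> space P. k \<omega> = j} \<omega> * ennreal ((Z t \<omega>)\<^sup>2) \<partial>P) = (\<integral>\<^sup>+\<omega>. ennreal ((Z t \<omega>)\<^sup>2) \<partial>P)"
    by (rule nn_integral_partition[OF k AP, symmetric]) (use ZP t in simp_all)
  finally show "(\<integral>\<^sup>+\<omega>. ennreal ((Z (min t (dyadic n (cut_time T \<omega>))) \<omega>)\<^sup>2) \<partial>P) \<le> C * (\<integral>\<^sup>+\<omega>. ennreal ((Z t \<omega>)\<^sup>2) \<partial>P)" .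
qed

section \<open>Brownian increments between dyadic approximations of the random time\<close>

lemma W_cont_interval: "AE \<omega> in P. continuous_on {0..T} (\<lambda>t. W t \<omega> $ j)"
  using W_cont by eventually_elim (auto intro!: continuous_intros elim: continuous_on_subset)

text \<open>On a cell of the finer index both times are constant. The finer one is the earlier, so
  the cell is an event of \<G> at the start of the increment, and the interval has length at most
  \<open>1 / 2 ^ n\<close>; \<open>increment_square_G\<close> gives P(cell) times this length, and
  the cells sum to probability 1. If the finer time is beyond s, both truncated times equal
  s.\<close>

lemma W_dyadic_dyadic:
  assumes T: "0 \<le> T" and nm: "n \<le> m" and s: "0 \<le> s"
  shows "(\<integral>\<^sup>+\<omega>. ennreal ((W (min s (dyadic n (cut_time T \<omega>))) \<omega> $ j - W (min s (dyadic m (cut_time T \<omega>))) \<omega> $ j)\<^sup>2) \<partial>P)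
    \<le> ennreal (1 / 2 ^ n)"
proof -
  define k where "k \<omega> = nat \<lceil>2 ^ m * cut_time T \<omega>\<rceil>" for \<omega>
  let ?J = "nat \<lceil>2 ^ m * T\<rceil>"
  have A: "{\<omega> \<in> space P. k \<omega> = i} \<in> sets (\<G> (real i / 2 ^ m))" for i
    unfolding k_def by (rule dyadic_cell[OF T])
  then have AP: "{\<omega> \<in> space P. k \<omega> = i} \<in> sets P" for i by (rule sets_G_P)
  have k: "k \<omega> \<le> ?J" if "\<omega> \<in> space P" for \<omega> unfolding k_def by (rule dyadic_index_le[OF T that])
  let ?f = "\<lambda>i \<omega>. ennreal ((W (min s (dyadic n (real i / 2 ^ m))) \<omega> $ j - W (min s (real i / 2 ^ m)) \<omega> $ j)\<^sup>2)"
  have f[measurable]: "?f i \<in> borel_measurable P" for i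
  proof -
    have [measurable]: "W (min s (dyadic n (real i / 2 ^ m))) \<in> borel_measurable P" "W (min s (real i / 2 ^ m)) \<in> borel_measurable P"
      using s by (auto intro!: W_measurable dyadic_nonneg)
    show ?thesis by measurable
  qed
  have "(\<integral>\<^sup>+\<omega>. ennreal ((W (min s (dyadic n (cut_time T \<omega>))) \<omega> $ j - W (min s (dyadic m (cut_time T \<omega>))) \<omega> $ j)\<^sup>2) \<partial>P) =
      (\<integral>\<^sup>+\<omega>. ?f (k \<omega>) \<omega> \<partial>P)"
  proof (intro nn_integral_cong)
    fix \<omega> assume "\<omega> \<in> space P"
    then have "real (k \<omega>) / 2 ^ m = dyadic m (cut_time T \<omega>)"
      by (simp add: k_def dyadic_eq_nat cut_time_bounds[OF T])
    then show "ennreal ((W (min s (dyadic n (cut_time T \<omega>))) \<omega> $ j - W (min s (dyadic m (cut_time T \<omega>))) \<omega> $ j)\<^sup>2) = ?f (k \<omega>) \<omega>"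
      by (simp add: dyadic_dyadic[OF nm])
  qed
  also have "\<dots> = (\<Sum>i\<le>?J. \<integral>\<^sup>+\<omega>. indicator {\<omega> \<in> space P. k \<omega> = i} \<omega> * ?f i \<omega> \<partial>P)"
    by (rule nn_integral_partition[OF k AP f])
  also have "\<dots> \<le> (\<Sum>i\<le>?J. \<integral>\<^sup>+\<omega>. indicator {\<omega> \<in> space P. k \<omega> = i} \<omega> * ennreal (1 / 2 ^ n) \<partial>P)"
  proof (intro sum_mono)
    fix i
    let ?r = "real i / 2 ^ m" and ?A = "{\<omega> \<in> space P. k \<omega> = i}"
    show "(\<integral>\<^sup>+\<omega>. indicator ?A \<omega> * ?f i \<omega> \<partial>P) \<le> (\<integral>\<^sup>+\<omega>. indicator ?A \<omega> * ennreal (1 / 2 ^ n) \<partial>P)"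
    proof (cases "?r \<le> s")
      case False
      then have "min s (dyadic n ?r) = min s ?r" using dyadic_ge[of ?r n] by linarith
      then show ?thesis by simp
    next
      case True
      define u where "u = min s (dyadic n ?r)"
      have u: "?r \<le> u" "u \<le> ?r + 1 / 2 ^ n" "0 \<le> ?r"
        using True dyadic_ge[of ?r n] dyadic_le[of n ?r] by (auto simp: u_def)
      have i: "integrable P (\<lambda>\<omega>. indicator ?A \<omega> * (W u \<omega> $ j - W ?r \<omega> $ j)\<^sup>2)"
      proof -
        have [measurable]: "W u \<in> borel_measurable P" "W ?r \<in> borel_measurable P"
          using u by (auto intro!: W_measurable intro: order_trans[OF u(3)])
        have "integrable P (\<lambda>\<omega>. (W u \<omega> $ j + - W ?r \<omega> $ j)\<^sup>2)"
          using integrable_W_square[of u j] integrable_W_square[of ?r j] order_trans[OF u(3,1)] u(3)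
          by (intro integrable_square_add) simp_all
        from integrable_mult_indicator[OF AP this] show ?thesis by simp
      qed
      have "(\<integral>\<^sup>+\<omega>. indicator ?A \<omega> * ?f i \<omega> \<partial>P) = (\<integral>\<^sup>+\<omega>. ennreal (indicator ?A \<omega> * (W u \<omega> $ j - W ?r \<omega> $ j)\<^sup>2) \<partial>P)"
        using True by (intro nn_integral_cong) (auto simp: indicator_def u_def min_absorb2)
      also have "\<dots> = ennreal (LINT \<omega>:?A|P. (W u \<omega> $ j - W ?r \<omega> $ j)\<^sup>2)"
        using nn_integral_eq_integral[OF i] by (simp add: set_lebesgue_integral_def)
      also have "\<dots> = ennreal (prob ?A * (u - ?r))"
        using increment_square_G[OF u(3,1) A] by simp
      also have "\<dots> \<le> ennreal (prob ?A * (1 / 2 ^ n))"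
        using u by (intro ennreal_leI mult_left_mono) auto
      also have "\<dots> = (\<integral>\<^sup>+\<omega>. indicator ?A \<omega> * ennreal (1 / 2 ^ n) \<partial>P)"
        using AP[of i] by (simp add: nn_integral_multc emeasure_eq_measure ennreal_mult[symmetric])
      finally show ?thesis .
    qed
  qed
  also have "\<dots> = (\<integral>\<^sup>+\<omega>. ennreal (1 / 2 ^ n) \<partial>P)"
    by (rule nn_integral_partition[where f = "\<lambda>_ _. ennreal (1 / 2 ^ n)", OF k AP, symmetric]) simp_all
  finally show ?thesis by (simp add: emeasure_space_1)
qed

lemma W_stopped_measurable:
  assumes T: "0 \<le> T" and s: "0 \<le> s" "s \<le> T"
  shows "(\<lambda>\<omega>. W (min s (cut_time T \<omega>)) \<omega>) \<in> borel_measurable P"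
proof (rule G.measurable_H_P[OF s(1) stopped_measurable[OF T s]])
  show "AE \<omega> in P. continuous_on {0..T} (\<lambda>s. W s \<omega>)"
    using W_cont by eventually_elim (auto elim: continuous_on_subset)
qed (intro measurable_F_G W_measurable_F)

lemma W_dyadic_measurable:
  assumes T: "0 \<le> T" and s: "0 \<le> s"
  shows "(\<lambda>\<omega>. W (min s (dyadic n (cut_time T \<omega>))) \<omega>) \<in> borel_measurable P"
  by (rule G.measurable_H_P[OF s(1) dyadic_stopped_measurable[OF T s]]) (intro measurable_F_G W_measurable_F)

text \<open>The time \<open>cut_time T\<close> may take uncountably many values, so it is reached as
  the limit of the finer levels m \<ge> n, for which the bound does not depend on m.\<close>

lemma W_dyadic_stopped:
  assumes T: "0 \<le> T" and s: "0 \<le> s" "s \<le> T"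
  shows "(\<integral>\<^sup>+\<omega>. ennreal ((W (min s (dyadic n (cut_time T \<omega>))) \<omega> $ j - W (min s (cut_time T \<omega>)) \<omega> $ j)\<^sup>2) \<partial>P)
    \<le> ennreal (1 / 2 ^ n)"
proof (rule nn_integral_Fatou_square[of "\<lambda>m \<omega>. W (min s (dyadic n (cut_time T \<omega>))) \<omega> $ j - W (min s (dyadic m (cut_time T \<omega>))) \<omega> $ j"])
  note [measurable] = W_dyadic_measurable[OF T s(1)]
  show "(\<lambda>\<omega>. W (min s (dyadic n (cut_time T \<omega>))) \<omega> $ j - W (min s (dyadic m (cut_time T \<omega>))) \<omega> $ j) \<in> borel_measurable P" for m
    by measurable
  show "AE \<omega> in P. (\<lambda>m. W (min s (dyadic n (cut_time T \<omega>))) \<omega> $ j - W (min s (dyadic m (cut_time T \<omega>))) \<omega> $ j) \<longlonglongrightarrow>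
      W (min s (dyadic n (cut_time T \<omega>))) \<omega> $ j - W (min s (cut_time T \<omega>)) \<omega> $ j"
    using dyadic_stopped_tendsto[OF T s W_cont_interval, of j]
    by eventually_elim (intro tendsto_diff tendsto_const)
  show "\<forall>\<^sub>F m in sequentially. (\<integral>\<^sup>+\<omega>. ennreal ((W (min s (dyadic n (cut_time T \<omega>))) \<omega> $ j - W (min s (dyadic m (cut_time T \<omega>))) \<omega> $ j)\<^sup>2) \<partial>P)
      \<le> ennreal (1 / 2 ^ n)"
    using eventually_ge_at_top[of n] by eventually_elim (rule W_dyadic_dyadic[OF T _ s(1)])
qed

end


section \<open>The stopped Ito integral\<close>

text \<open>The condition on the grid point j selects the steps up to \<open>dyadic n x\<close>, so
  the increments of g telescope. Steps starting beyond b contribute nothing, as g is constant there,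
  and may be filtered out. An abstract g serves both the integrals and the values of cut
  integrands.\<close>

lemma dyadic_telescope:
  fixes g :: "real \<Rightarrow> 'b::real_vector"
  assumes x: "0 \<le> x" "x \<le> T" and g: "\<And>y. b \<le> y \<Longrightarrow> g y = g b"
  shows "(\<Sum>j\<leftarrow>filter (\<lambda>j. real j / 2 ^ n \<le> b) [0..<nat \<lceil>2 ^ n * T\<rceil>].
      of_bool (real j / 2 ^ n < x) *\<^sub>R (g (real (Suc j) / 2 ^ n) - g (real j / 2 ^ n))) = g (dyadic n x) - g 0"
    (is "(\<Sum>j\<leftarrow>filter ?P ?xs. ?f j) = _")
proof -
  define k K where "k = nat \<lceil>2 ^ n * x\<rceil>" and "K = nat \<lceil>2 ^ n * T\<rceil>"
  have k: "k \<le> K" unfolding k_def K_def using x by (intro nat_mono ceiling_mono) simp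
  have less: "real j / 2 ^ n < x \<longleftrightarrow> j < k" for j
    unfolding k_def using ceiling_le_nat_iff[OF x(1), of n j] by linarith
  have "?f j = 0" if "\<not> ?P j" for j
  proof -
    have le: "real j / 2 ^ n \<le> real (Suc j) / 2 ^ n" by (simp add: divide_right_mono)
    have "g (real (Suc j) / 2 ^ n) = g b" "g (real j / 2 ^ n) = g b"
      using that le by (intro g; linarith)+
    then show ?thesis by simp
  qed
  then have "(\<Sum>j\<leftarrow>filter ?P ?xs. ?f j) = (\<Sum>j\<leftarrow>?xs. ?f j)"
    by (intro sum_list_map_filter) auto
  also have "\<dots> = (\<Sum>j<K. ?f j)"
    unfolding K_def by (simp add: interv_sum_list_conv_sum_set_nat atLeast0LessThan)
  also have "\<dots> = (\<Sum>j<K. of_bool (j < k) *\<^sub>R (g (real (Suc j) / 2 ^ n) - g (real j / 2 ^ n)))"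
    by (simp only: less)
  also have "\<dots> = (\<Sum>j<k. of_bool (j < k) *\<^sub>R (g (real (Suc j) / 2 ^ n) - g (real j / 2 ^ n)))"
    by (rule sum.mono_neutral_right) (use k in auto)
  also have "\<dots> = (\<Sum>j<k. g (real (Suc j) / 2 ^ n) - g (real j / 2 ^ n))"
    by (intro sum.cong refl) simp
  also have "\<dots> = g (real k / 2 ^ n) - g (real 0 / 2 ^ n)"
    by (rule sum_lessThan_telescope)
  finally show ?thesis using dyadic_eq_nat[OF x(1)] by (simp add: k_def)
qed

text \<open>The restriction of a simple integrand to \<open>(0, dyadic n \<sigma>]\<close>. A piece starting at \<open>max a (j / 2\<^sup>n)\<close>
  is adapted because the event \<open>j / 2\<^sup>n < \<sigma>\<close> is already decided at the grid point; grid points beyond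
  \<open>b\<close> have to be left out, since their pieces would be empty but start too early.\<close>

definition dyadic_cut ::
  "('w \<Rightarrow> real) \<Rightarrow> real \<Rightarrow> nat \<Rightarrow> ('w, 'n::finite) simple_integrand \<Rightarrow> ('w, 'n) simple_integrand" where
  "dyadic_cut \<sigma> T n S = concat (map (\<lambda>(a, b, \<xi>).
     map (\<lambda>j. (max a (min b (real j / 2 ^ n)), max a (min b (real (Suc j) / 2 ^ n)),
         \<lambda>\<omega>. of_bool (real j / 2 ^ n < \<sigma> \<omega>) *\<^sub>R \<xi> \<omega>))
       (filter (\<lambda>j. real j / 2 ^ n \<le> b) [0..<nat \<lceil>2 ^ n * T\<rceil>])) S)"

lemma dyadic_cut_Cons:
  "dyadic_cut \<sigma> T n ((a, b, \<xi>) # S) =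
     map (\<lambda>j. (max a (min b (real j / 2 ^ n)), max a (min b (real (Suc j) / 2 ^ n)),
         \<lambda>\<omega>. of_bool (real j / 2 ^ n < \<sigma> \<omega>) *\<^sub>R \<xi> \<omega>))
       (filter (\<lambda>j. real j / 2 ^ n \<le> b) [0..<nat \<lceil>2 ^ n * T\<rceil>]) @ dyadic_cut \<sigma> T n S"
  by (simp add: dyadic_cut_def)

lemma dyadic_cut_Nil: "dyadic_cut \<sigma> T n [] = []"
  by (simp add: dyadic_cut_def)

lemma simple_value_Cons:
  "simple_value ((a, b, \<xi>) # S) t \<omega> = indicator {a<..b} t *\<^sub>R \<xi> \<omega> + simple_value S t \<omega>"
  by (simp add: simple_value_def)

lemma simple_value_append: "simple_value (S @ S') t \<omega> = simple_value S t \<omega> + simple_value S' t \<omega>"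
  by (simp add: simple_value_def)

lemma simple_value_Nil: "simple_value [] t \<omega> = 0"
  by (simp add: simple_value_def)

lemma norm_square_sum: "(norm (v :: real ^ 'n))\<^sup>2 = (\<Sum>j\<in>UNIV. (v $ j)\<^sup>2)"
  unfolding power2_norm_eq_inner inner_vec_def by (simp add: power2_eq_square)

lemma norm_add_square_le: "(norm (x + y))\<^sup>2 \<le> 2 * (norm x)\<^sup>2 + 2 * (norm y)\<^sup>2"
  for x y :: "'b::real_normed_vector"
proof -
  have "(norm (x + y))\<^sup>2 \<le> (norm x + norm y)\<^sup>2" by (intro power_mono norm_triangle_ineq) simp
  also have "\<dots> \<le> 2 * (norm x)\<^sup>2 + 2 * (norm y)\<^sup>2" by (rule sum_square_le)
  finally show ?thesis .
qed

section \<open>Simple integrands cut at the dyadic times\<close>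

context default_market
begin

lemma simple_integral_dyadic_cut:
  assumes "simple_integrand P H T S" "0 \<le> \<sigma> \<omega>" "\<sigma> \<omega> \<le> T"
  shows "simple_integral W (dyadic_cut \<sigma> T n S) t \<omega> = simple_integral W S (min t (dyadic n (\<sigma> \<omega>))) \<omega>"
  using assms(1)
proof (induction S)
  case Nil
  show ?case by (simp add: dyadic_cut_Nil simple_integral_Nil)
next
  case (Cons x S)
  obtain a b \<xi> where x: "x = (a, b, \<xi>)" by (cases x)
  have ab: "0 \<le> a" "a \<le> b" and S: "simple_integrand P H T S"
    using Cons.prems by (auto simp: x simple_integrand_Cons)
  let ?d = "dyadic n (\<sigma> \<omega>)"
  \<comment> \<open>As y runs over the grid, the argument of W runs through the endpoints of the cut
    pieces of (a, b], stopped at t; each piece contributes one increment of g.\<close>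
  define g where "g y = \<xi> \<omega> \<bullet> W (min (max a (min b y)) t) \<omega>" for y
  have g: "g y = g b" if "b \<le> y" for y using that by (simp add: g_def)
  have "simple_integral W (map (\<lambda>j. (max a (min b (real j / 2 ^ n)), max a (min b (real (Suc j) / 2 ^ n)),
         \<lambda>\<omega>. of_bool (real j / 2 ^ n < \<sigma> \<omega>) *\<^sub>R \<xi> \<omega>))
       (filter (\<lambda>j. real j / 2 ^ n \<le> b) [0..<nat \<lceil>2 ^ n * T\<rceil>])) t \<omega> =
    (\<Sum>j\<leftarrow>filter (\<lambda>j. real j / 2 ^ n \<le> b) [0..<nat \<lceil>2 ^ n * T\<rceil>].
      of_bool (real j / 2 ^ n < \<sigma> \<omega>) *\<^sub>R (g (real (Suc j) / 2 ^ n) - g (real j / 2 ^ n)))"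
    unfolding simple_integral_def map_map
    by (intro arg_cong[where f = sum_list] map_cong refl) (simp add: g_def inner_diff_right)
  also have "\<dots> = g ?d - g 0"
    by (rule dyadic_telescope[where g = g, OF assms(2,3) g])
  also have "\<dots> = \<xi> \<omega> \<bullet> (W (min b (min t ?d)) \<omega> - W (min a (min t ?d)) \<omega>)"
  proof (cases "?d < a")
    case True
    then have "max a (min b ?d) = a" "min b (min t ?d) = min t ?d" "min a (min t ?d) = min t ?d" using ab by auto
    then show ?thesis using ab by (simp add: g_def)
  next
    case False
    then have "min (max a (min b ?d)) t = min b (min t ?d)" "min a (min t ?d) = min a t" using ab by auto
    then show ?thesis using ab by (simp add: g_def inner_diff_right)
  qed
  finally show ?case
    using Cons.IH[OF S] by (simp add: x dyadic_cut_Cons simple_integral_append simple_integral_Cons)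
qed

lemma simple_value_dyadic_cut:
  assumes "simple_integrand P H T S" "0 \<le> \<sigma> \<omega>" "\<sigma> \<omega> \<le> T"
  shows "simple_value (dyadic_cut \<sigma> T n S) t \<omega> = of_bool (t \<le> dyadic n (\<sigma> \<omega>)) *\<^sub>R simple_value S t \<omega>"
  using assms(1)
proof (induction S)
  case Nil
  show ?case by (simp add: dyadic_cut_Nil simple_value_Nil)
next
  case (Cons x S)
  obtain a b \<xi> where x: "x = (a, b, \<xi>)" by (cases x)
  have ab: "0 \<le> a" "a \<le> b" and S: "simple_integrand P H T S"
    using Cons.prems by (auto simp: x simple_integrand_Cons)
  let ?d = "dyadic n (\<sigma> \<omega>)"
  \<comment> \<open>The same endpoints as for the integral, but now with the indicator of times up
    to the endpoint: increments of g are indicators of half-open intervals times \<xi>.\<close>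
  define g where "g y = (of_bool (t \<le> max a (min b y)) :: real) *\<^sub>R \<xi> \<omega>" for y
  have g: "g y = g b" if "b \<le> y" for y using that by (simp add: g_def)
  have ind: "indicator {max a (min b y)<..max a (min b z)} t *\<^sub>R (of_bool B *\<^sub>R \<xi> \<omega>) = of_bool B *\<^sub>R (g z - g y)"
    if "y \<le> z" for y z B
    using that by (auto simp: g_def indicator_def max_def min_def)
  have "simple_value (map (\<lambda>j. (max a (min b (real j / 2 ^ n)), max a (min b (real (Suc j) / 2 ^ n)),
         \<lambda>\<omega>. of_bool (real j / 2 ^ n < \<sigma> \<omega>) *\<^sub>R \<xi> \<omega>))
       (filter (\<lambda>j. real j / 2 ^ n \<le> b) [0..<nat \<lceil>2 ^ n * T\<rceil>])) t \<omega> =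
    (\<Sum>j\<leftarrow>filter (\<lambda>j. real j / 2 ^ n \<le> b) [0..<nat \<lceil>2 ^ n * T\<rceil>].
      of_bool (real j / 2 ^ n < \<sigma> \<omega>) *\<^sub>R (g (real (Suc j) / 2 ^ n) - g (real j / 2 ^ n)))"
  proof -
    have "real j / 2 ^ n \<le> real (Suc j) / 2 ^ n" for j by (simp add: divide_right_mono)
    then show ?thesis
      unfolding simple_value_def map_map
      by (intro arg_cong[where f = sum_list] map_cong refl) (simp only: o_apply split_conv ind)
  qed
  also have "\<dots> = g ?d - g 0"
    by (rule dyadic_telescope[where g = g, OF assms(2,3) g])
  also have "\<dots> = of_bool (t \<le> ?d) *\<^sub>R (indicator {a<..b} t *\<^sub>R \<xi> \<omega>)"
    using ab by (auto simp: g_def indicator_def)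
  finally show ?case
    using Cons.IH[OF S] by (simp add: x dyadic_cut_Cons simple_value_append simple_value_Cons scaleR_add_right)
qed

lemma simple_integrand_dyadic_cut:
  fixes S :: "('w, 'n) simple_integrand"
  assumes T: "0 \<le> T" and S: "simple_integrand P \<G> T S"
  shows "simple_integrand P \<G> T (dyadic_cut (cut_time T) T n S)"
  unfolding simple_integrand_def
proof clarify
  fix a' b' and \<xi>' :: "'w \<Rightarrow> real ^ 'n" assume "(a', b', \<xi>') \<in> set (dyadic_cut (cut_time T) T n S)"
  then obtain a b \<xi> j where mem: "(a, b, \<xi>) \<in> set S" and j: "real j / 2 ^ n \<le> b"
    and eq: "a' = max a (min b (real j / 2 ^ n))" "b' = max a (min b (real (Suc j) / 2 ^ n))"
      "\<xi>' = (\<lambda>\<omega>. of_bool (real j / 2 ^ n < cut_time T \<omega>) *\<^sub>R \<xi> \<omega>)"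
    unfolding dyadic_cut_def by auto
  from S mem obtain K where ab: "0 \<le> a" "a \<le> b" "b \<le> T" and \<xi>: "\<xi> \<in> borel_measurable (\<G> a)"
    and K: "\<And>\<omega>. \<omega> \<in> space P \<Longrightarrow> norm (\<xi> \<omega>) \<le> K"
    unfolding simple_integrand_def by fastforce
  have le: "real j / 2 ^ n \<le> real (Suc j) / 2 ^ n" by (simp add: divide_right_mono)
  have a': "0 \<le> a'" "real j / 2 ^ n \<le> a'" "a \<le> a'" using ab j by (auto simp: eq)
  have [measurable]: "\<xi> \<in> borel_measurable (\<G> a')" by (rule G.measurable_H_mono[OF ab(1) a'(3) \<xi>])
  have "{\<omega> \<in> space P. cut_time T \<omega> \<le> real j / 2 ^ n} \<in> sets (\<G> a')"
    by (rule subsetD[OF G_mono[OF a'(2)] cut_time_le_sets]) simp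
  then have "Measurable.pred (\<G> a') (\<lambda>\<omega>. cut_time T \<omega> \<le> real j / 2 ^ n)"
    by (simp add: pred_def space_G)
  then have [measurable]: "Measurable.pred (\<G> a') (\<lambda>\<omega>. real j / 2 ^ n < cut_time T \<omega>)"
    unfolding not_le[symmetric] by measurable
  have m: "\<xi>' \<in> borel_measurable (\<G> a')" unfolding eq(3) by measurable
  have n: "norm (\<xi>' \<omega>) \<le> K" if "\<omega> \<in> space P" for \<omega>
    using K[OF that] order_trans[OF norm_ge_zero K[OF that]] by (simp add: eq)
  have "a' \<le> b'" "b' \<le> T" using ab le by (auto simp: eq min_le_iff_disj le_max_iff_disj)
  then show "0 \<le> a' \<and> a' \<le> b' \<and> b' \<le> T \<and> \<xi>' \<in> borel_measurable (\<G> a') \<and> (\<exists>K. \<forall>\<omega>\<in>space P. norm (\<xi>' \<omega>) \<le> K)"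
    using a'(1) m n by blast
qed

lemma simple_value_bounded:
  assumes "simple_integrand P H T S"
  shows "\<exists>K\<ge>0. \<forall>t. \<forall>\<omega>\<in>space P. norm (simple_value S t \<omega>) \<le> K"
  using assms
proof (induction S)
  case Nil
  show ?case by (intro exI[of _ 0]) (simp add: simple_value_Nil)
next
  case (Cons x S)
  obtain a b \<xi> where x: "x = (a, b, \<xi>)" by (cases x)
  obtain K where K: "\<And>\<omega>. \<omega> \<in> space P \<Longrightarrow> norm (\<xi> \<omega>) \<le> K" and S: "simple_integrand P H T S"
    using Cons.prems by (auto simp: x simple_integrand_Cons)
  obtain L where L: "0 \<le> L" "\<And>t \<omega>. \<omega> \<in> space P \<Longrightarrow> norm (simple_value S t \<omega>) \<le> L"
    using Cons.IH[OF S] by auto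
  show ?case
  proof (intro exI[of _ "\<bar>K\<bar> + L"] conjI allI ballI)
    fix t \<omega> assume \<omega>: "\<omega> \<in> space P"
    have "norm (indicator {a<..b} t *\<^sub>R \<xi> \<omega>) \<le> \<bar>K\<bar>"
      using K[OF \<omega>] by (auto simp: indicator_def)
    then show "norm (simple_value (x # S) t \<omega>) \<le> \<bar>K\<bar> + L"
      unfolding x simple_value_Cons using L(2)[OF \<omega>, of t] norm_triangle_mono by blast
  qed (use L in auto)
qed

lemma simple_value_measurable:
  assumes "simple_integrand P \<G> T S"
  shows "(\<lambda>x. simple_value S (fst x) (snd x)) \<in> borel_measurable (borel \<Otimes>\<^sub>M P)"
  using assms
proof (induction S)
  case Nil
  show ?case by (simp add: simple_value_Nil)
next
  case (Cons x S)
  obtain a b \<xi> where x: "x = (a, b, \<xi>)" by (cases x)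
  have a: "0 \<le> a" and \<xi>: "\<xi> \<in> borel_measurable (\<G> a)" and S: "simple_integrand P \<G> T S"
    using Cons.prems by (auto simp: x simple_integrand_Cons)
  have [measurable]: "\<xi> \<in> borel_measurable P" by (rule G.measurable_H_P[OF a \<xi>])
  note [measurable] = Cons.IH[OF S]
  show ?case unfolding x simple_value_Cons by measurable
qed

text \<open>General coefficients c and d allow both uses: 2 and 2 for splitting a sum, and
  \<open>2 * K\<^sup>2\<close> twice for an inner product with a vector bounded by K. The weight A
  is needed for estimates localised to an event.\<close>

lemma nn_integral_square_add_le:
  fixes f g h :: "'w \<Rightarrow> real"
  assumes [measurable]: "f \<in> borel_measurable P" "g \<in> borel_measurable P"
    and le: "\<And>\<omega>. \<omega> \<in> space P \<Longrightarrow> h \<omega> \<le> c * (f \<omega>)\<^sup>2 + d * (g \<omega>)\<^sup>2" and cd: "0 \<le> c" "0 \<le> d"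
    and A[measurable]: "A \<in> sets P"
  shows "(\<integral>\<^sup>+\<omega>. indicator A \<omega> * ennreal (h \<omega>) \<partial>P) \<le>
    ennreal c * (\<integral>\<^sup>+\<omega>. indicator A \<omega> * ennreal ((f \<omega>)\<^sup>2) \<partial>P) + ennreal d * (\<integral>\<^sup>+\<omega>. indicator A \<omega> * ennreal ((g \<omega>)\<^sup>2) \<partial>P)"
proof -
  have "(\<integral>\<^sup>+\<omega>. indicator A \<omega> * ennreal (h \<omega>) \<partial>P) \<le>
      (\<integral>\<^sup>+\<omega>. ennreal c * (indicator A \<omega> * ennreal ((f \<omega>)\<^sup>2)) + ennreal d * (indicator A \<omega> * ennreal ((g \<omega>)\<^sup>2)) \<partial>P)"
  proof (intro nn_integral_mono)
    fix \<omega> assume "\<omega> \<in> space P"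
    from ennreal_leI[OF le[OF this]] have "ennreal (h \<omega>) \<le> ennreal c * ennreal ((f \<omega>)\<^sup>2) + ennreal d * ennreal ((g \<omega>)\<^sup>2)"
      using cd by (simp add: ennreal_mult)
    then show "indicator A \<omega> * ennreal (h \<omega>) \<le>
        ennreal c * (indicator A \<omega> * ennreal ((f \<omega>)\<^sup>2)) + ennreal d * (indicator A \<omega> * ennreal ((g \<omega>)\<^sup>2))"
      by (auto simp: indicator_def)
  qed
  also have "\<dots> = ennreal c * (\<integral>\<^sup>+\<omega>. indicator A \<omega> * ennreal ((f \<omega>)\<^sup>2) \<partial>P) + ennreal d * (\<integral>\<^sup>+\<omega>. indicator A \<omega> * ennreal ((g \<omega>)\<^sup>2) \<partial>P)"
    by (simp add: nn_integral_add nn_integral_cmult)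
  finally show ?thesis .
qed

lemmas nn_integral_square_add_le_space =
  nn_integral_square_add_le[where A = "space P", OF _ _ _ _ _ sets.top]

lemma nn_integral_space_indicator:
  "(\<integral>\<^sup>+\<omega>. indicator (space P) \<omega> * f \<omega> \<partial>P) = (\<integral>\<^sup>+\<omega>. f \<omega> \<partial>P)"
  by (intro nn_integral_cong) simp

lemma simple_integral_stopped_measurable:
  assumes T: "0 \<le> T" and S: "simple_integrand P \<G> T S" and t: "0 \<le> t" "t \<le> T"
  shows "(\<lambda>\<omega>. simple_integral W S (min t (cut_time T \<omega>)) \<omega>) \<in> borel_measurable P"
    and "(\<lambda>\<omega>. simple_integral W S (min t (dyadic n (cut_time T \<omega>))) \<omega>) \<in> borel_measurable P"
    and "AE \<omega> in P. continuous_on {0..T} (\<lambda>s. simple_integral W S s \<omega>)"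
proof -
  have m: "simple_integral W S s \<in> borel_measurable (\<G> s)" if "0 \<le> s" for s
    by (rule G.martingale_measurable[OF simple_integral_martingale[OF S] that])
  show "AE \<omega> in P. continuous_on {0..T} (\<lambda>s. simple_integral W S s \<omega>)"
    using W_cont
  proof eventually_elim
    case (elim \<omega>)
    show ?case
      using S
    proof (induction S)
      case Nil
      show ?case by (simp add: simple_integral_Nil)
    next
      case (Cons x S)
      obtain a b \<xi> where x: "x = (a, b, \<xi>)" by (cases x)
      have ab: "0 \<le> a" "a \<le> b" and S: "simple_integrand P \<G> T S"
        using Cons.prems by (auto simp: x simple_integrand_Cons)
      have "continuous_on {0..T} (\<lambda>s. W (min c s) \<omega>)" if "0 \<le> c" for c
        by (rule continuous_on_compose2[OF elim]) (use that in \<open>auto intro!: continuous_intros\<close>)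
      then show ?case
        unfolding x simple_integral_Cons using ab Cons.IH[OF S] by (intro continuous_intros) auto
    qed
  qed
  from stopped_measurable[OF T t this m] 
  show "(\<lambda>\<omega>. simple_integral W S (min t (cut_time T \<omega>)) \<omega>) \<in> borel_measurable P"
    by (rule G.measurable_H_P[OF t(1)])
  show "(\<lambda>\<omega>. simple_integral W S (min t (dyadic n (cut_time T \<omega>))) \<omega>) \<in> borel_measurable P"
    by (rule G.measurable_H_P[OF t(1) dyadic_stopped_measurable[OF T t(1) m]])
qed

text \<open>For one piece, replacing the dyadic time by the exact one changes W only at the two
  endpoints a and b, each by an increment with second moment of order \<open>1 / 2 ^ n\<close>. The
  constant C is uniform in n and t but depends on the bounds and the number of the pieces of
  S.\<close>

lemma simple_integral_dyadic_error:
  assumes T: "0 \<le> T" and S: "simple_integrand P \<G> T S"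
  shows "\<exists>C\<ge>0. \<forall>n. \<forall>t\<in>{0..T}.
    (\<integral>\<^sup>+\<omega>. ennreal ((simple_integral W S (min t (dyadic n (cut_time T \<omega>))) \<omega> -
      simple_integral W S (min t (cut_time T \<omega>)) \<omega>)\<^sup>2) \<partial>P) \<le> ennreal (C / 2 ^ n)"
  using S
proof (induction S)
  case Nil
  show ?case by (intro exI[of _ 0]) (simp add: simple_integral_Nil)
next
  case (Cons x S)
  obtain a b \<xi> where x: "x = (a, b, \<xi>)" by (cases x)
  obtain K where K: "\<And>\<omega>. \<omega> \<in> space P \<Longrightarrow> norm (\<xi> \<omega>) \<le> K" and S: "simple_integrand P \<G> T S"
    and ab: "0 \<le> a" "a \<le> b" "b \<le> T" and \<xi>: "\<xi> \<in> borel_measurable (\<G> a)"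
    using Cons.prems by (auto simp: x simple_integrand_Cons)
  have [measurable]: "\<xi> \<in> borel_measurable P" by (rule G.measurable_H_P[OF ab(1) \<xi>])
  obtain C where C: "0 \<le> C" "\<And>n t. t \<in> {0..T} \<Longrightarrow> (\<integral>\<^sup>+\<omega>. ennreal ((simple_integral W S (min t (dyadic n (cut_time T \<omega>))) \<omega> -
      simple_integral W S (min t (cut_time T \<omega>)) \<omega>)\<^sup>2) \<partial>P) \<le> ennreal (C / 2 ^ n)"
    using Cons.IH[OF S] by auto
  define N where "N = real CARD('n)"
  \<comment> \<open>Two endpoints, each with factor \<open>2 * K\<^sup>2\<close> and the N
    coordinates of W, give \<open>4 * K\<^sup>2 * N\<close> for the new piece; the outer factors 2
    come from adding it to the remaining pieces.\<close>
  define D where "D = 2 * (4 * K\<^sup>2 * N) + 2 * C"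
  show ?case
  proof (intro exI[of _ D] conjI allI ballI)
    show "0 \<le> D" using C by (simp add: D_def N_def)
    fix n t assume t: "t \<in> {0..T}"
    define w where "w e \<omega> = W (min (min e t) (dyadic n (cut_time T \<omega>))) \<omega> - W (min (min e t) (cut_time T \<omega>)) \<omega>" for e \<omega>
    have wm: "w e \<in> borel_measurable P" if "0 \<le> e" for e
    proof -
      have [measurable]: "(\<lambda>\<omega>. W (min (min e t) (dyadic n (cut_time T \<omega>))) \<omega>) \<in> borel_measurable P"
        by (rule W_dyadic_measurable[OF T]) (use that t in auto)
      have [measurable]: "(\<lambda>\<omega>. W (min (min e t) (cut_time T \<omega>)) \<omega>) \<in> borel_measurable P"
        by (rule W_stopped_measurable[OF T]) (use that t in auto)
      show ?thesis unfolding w_def[abs_def] by measurable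
    qed
    have wle: "(\<integral>\<^sup>+\<omega>. ennreal ((norm (w e \<omega>))\<^sup>2) \<partial>P) \<le> ennreal (N / 2 ^ n)" if "0 \<le> e" for e
    proof -
      have "(\<integral>\<^sup>+\<omega>. ennreal ((norm (w e \<omega>))\<^sup>2) \<partial>P) = (\<integral>\<^sup>+\<omega>. (\<Sum>j\<in>UNIV. ennreal ((w e \<omega> $ j)\<^sup>2)) \<partial>P)"
        by (intro nn_integral_cong) (simp add: norm_square_sum sum_ennreal)
      also have "\<dots> = (\<Sum>j\<in>UNIV. \<integral>\<^sup>+\<omega>. ennreal ((w e \<omega> $ j)\<^sup>2) \<partial>P)"
      proof (intro nn_integral_sum)
        note [measurable] = wm[OF that]
        show "(\<lambda>\<omega>. ennreal ((w e \<omega> $ j)\<^sup>2)) \<in> borel_measurable P" for j by measurable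
      qed
      also have "\<dots> \<le> (\<Sum>j\<in>(UNIV :: 'n set). ennreal (1 / 2 ^ n))"
        unfolding w_def vector_minus_component
        by (intro sum_mono W_dyadic_stopped[OF T]) (use that t in auto)
      also have "\<dots> = ennreal (N / 2 ^ n)" by (simp add: N_def ennreal_of_nat_eq_real_of_nat ennreal_mult[symmetric])
      finally show ?thesis .
    qed
    define p where "p \<omega> = \<xi> \<omega> \<bullet> (w b \<omega> - w a \<omega>)" for \<omega>
    define r where "r \<omega> = simple_integral W S (min t (dyadic n (cut_time T \<omega>))) \<omega> - simple_integral W S (min t (cut_time T \<omega>)) \<omega>" for \<omega>
    have pm[measurable]: "p \<in> borel_measurable P" 
    proof -
      have [measurable]: "w a \<in> borel_measurable P" "w b \<in> borel_measurable P" using wm ab by auto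
      show ?thesis unfolding p_def[abs_def] by measurable
    qed
    have rm[measurable]: "r \<in> borel_measurable P"
      unfolding r_def[abs_def]
      using t by (intro borel_measurable_diff simple_integral_stopped_measurable(1,2)[OF T S]) auto
    have p_le: "(\<integral>\<^sup>+\<omega>. ennreal ((p \<omega>)\<^sup>2) \<partial>P) \<le> ennreal (4 * K\<^sup>2 * N / 2 ^ n)"
    proof -
      have "(\<integral>\<^sup>+\<omega>. indicator (space P) \<omega> * ennreal ((p \<omega>)\<^sup>2) \<partial>P) \<le>
        ennreal (2 * K\<^sup>2) * (\<integral>\<^sup>+\<omega>. indicator (space P) \<omega> * ennreal ((norm (w b \<omega>))\<^sup>2) \<partial>P) +
        ennreal (2 * K\<^sup>2) * (\<integral>\<^sup>+\<omega>. indicator (space P) \<omega> * ennreal ((norm (w a \<omega>))\<^sup>2) \<partial>P)"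
      proof (rule nn_integral_square_add_le_space)
        fix \<omega> assume \<omega>: "\<omega> \<in> space P"
        have "\<bar>p \<omega>\<bar> \<le> norm (\<xi> \<omega>) * norm (w b \<omega> - w a \<omega>)"
          unfolding p_def by (rule Cauchy_Schwarz_ineq2)
        also have "\<dots> \<le> K * norm (w b \<omega> - w a \<omega>)" by (intro mult_right_mono K[OF \<omega>]) simp
        finally have "\<bar>p \<omega>\<bar>\<^sup>2 \<le> (K * norm (w b \<omega> - w a \<omega>))\<^sup>2"
          by (rule power_mono) simp
        then have "(p \<omega>)\<^sup>2 \<le> K\<^sup>2 * (norm (w b \<omega> - w a \<omega>))\<^sup>2"
          by (simp add: power_mult_distrib)
        also have "\<dots> \<le> K\<^sup>2 * (2 * (norm (w b \<omega>))\<^sup>2 + 2 * (norm (w a \<omega>))\<^sup>2)"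
          using norm_add_square_le[of "w b \<omega>" "- w a \<omega>"] by (intro mult_left_mono) auto
        finally show "(p \<omega>)\<^sup>2 \<le> 2 * K\<^sup>2 * (norm (w b \<omega>))\<^sup>2 + 2 * K\<^sup>2 * (norm (w a \<omega>))\<^sup>2"
          by (simp add: algebra_simps)
      qed (use wm[of a] wm[of b] ab in auto)
      also have "\<dots> \<le> ennreal (2 * K\<^sup>2) * ennreal (N / 2 ^ n) + ennreal (2 * K\<^sup>2) * ennreal (N / 2 ^ n)"
        unfolding nn_integral_space_indicator using ab by (intro add_mono mult_left_mono wle) auto
      also have "\<dots> = ennreal (4 * K\<^sup>2 * N / 2 ^ n)"
        by (simp add: N_def ennreal_mult[symmetric] ennreal_plus[symmetric] del: ennreal_plus)
      finally show ?thesis unfolding nn_integral_space_indicator .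
    qed
    have "(\<integral>\<^sup>+\<omega>. indicator (space P) \<omega> * ennreal ((simple_integral W (x # S) (min t (dyadic n (cut_time T \<omega>))) \<omega> -
      simple_integral W (x # S) (min t (cut_time T \<omega>)) \<omega>)\<^sup>2) \<partial>P) \<le>
      ennreal 2 * (\<integral>\<^sup>+\<omega>. indicator (space P) \<omega> * ennreal ((p \<omega>)\<^sup>2) \<partial>P) + ennreal 2 * (\<integral>\<^sup>+\<omega>. indicator (space P) \<omega> * ennreal ((r \<omega>)\<^sup>2) \<partial>P)"
    proof (rule nn_integral_square_add_le_space)
      fix \<omega>
      have "simple_integral W (x # S) (min t (dyadic n (cut_time T \<omega>))) \<omega> -
          simple_integral W (x # S) (min t (cut_time T \<omega>)) \<omega> = p \<omega> + r \<omega>"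
        by (simp add: x simple_integral_Cons p_def r_def w_def inner_diff_right min.assoc)
      then show "(simple_integral W (x # S) (min t (dyadic n (cut_time T \<omega>))) \<omega> -
          simple_integral W (x # S) (min t (cut_time T \<omega>)) \<omega>)\<^sup>2 \<le> 2 * (p \<omega>)\<^sup>2 + 2 * (r \<omega>)\<^sup>2"
        using sum_square_le by simp
    qed simp_all
    also have "\<dots> \<le> ennreal 2 * ennreal (4 * K\<^sup>2 * N / 2 ^ n) + ennreal 2 * ennreal (C / 2 ^ n)"
      unfolding nn_integral_space_indicator using C(2)[OF t, of n] p_le by (intro add_mono mult_left_mono) (auto simp: r_def)
    also have "\<dots> = ennreal (D / 2 ^ n)"
    proof -
      have "ennreal 2 * ennreal y + ennreal 2 * ennreal z = ennreal (2 * y + 2 * z)" if "0 \<le> y" "0 \<le> z" for y z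
        using that by (simp add: ennreal_mult)
      then show ?thesis using C(1) by (simp add: D_def N_def add_divide_distrib del: ennreal_plus)
    qed
    finally show "(\<integral>\<^sup>+\<omega>. ennreal ((simple_integral W (x # S) (min t (dyadic n (cut_time T \<omega>))) \<omega> -
      simple_integral W (x # S) (min t (cut_time T \<omega>)) \<omega>)\<^sup>2) \<partial>P) \<le> ennreal (D / 2 ^ n)"
      unfolding nn_integral_space_indicator .
  qed
qed

end


section \<open>Passage to the limit in the Ito integral\<close>

context default_market
begin

text \<open>Passing to the limit in the martingales \<open>simple_integral W S' - simple_integral W (S k)\<close> by means of
  \<open>(x + y)\<^sup>2 \<le> 2 x\<^sup>2 + 2 y\<^sup>2\<close> costs the factor 4 and avoids showing that \<open>I\<close> is a martingale.\<close>

lemma approximation_error_square_le: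
  fixes S :: "nat \<Rightarrow> ('w, 'n) simple_integrand"
  assumes S: "\<And>k. simple_integrand P \<G> T (S k)" and S': "simple_integrand P \<G> T S'"
    and I: "\<And>t. t \<in> {0..T} \<Longrightarrow> I t \<in> borel_measurable P"
    and lim: "\<And>t. t \<in> {0..T} \<Longrightarrow> (\<lambda>k. \<integral>\<^sup>+\<omega>. ennreal ((simple_integral W (S k) t \<omega> - I t \<omega>)\<^sup>2) \<partial>P) \<longlonglongrightarrow> 0"
    and st: "0 \<le> s" "s \<le> t" "t \<le> T" and A: "A \<in> sets (\<G> s)"
  shows "(\<integral>\<^sup>+\<omega>. indicator A \<omega> * ennreal ((simple_integral W S' s \<omega> - I s \<omega>)\<^sup>2) \<partial>P) \<le>
    4 * (\<integral>\<^sup>+\<omega>. indicator A \<omega> * ennreal ((simple_integral W S' t \<omega> - I t \<omega>)\<^sup>2) \<partial>P)"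
proof -
  have AP[measurable]: "A \<in> sets P" using sets_G_P[OF A] .
  have t: "s \<in> {0..T}" "t \<in> {0..T}" "0 \<le> t" using st by auto
  have Im[measurable]: "I s \<in> borel_measurable P" "I t \<in> borel_measurable P" using I t by auto
  have Ym: "simple_integral W X u \<in> borel_measurable P" if "simple_integrand P \<G> T X" "0 \<le> u" for X :: "('w, 'n) simple_integrand" and u
    by (rule borel_measurable_integrable[OF G.martingale_integrable[OF simple_integral_martingale[OF that(1)] that(2)]])
  note [measurable] = Ym[OF S st(1)] Ym[OF S t(3)] Ym[OF S' st(1)] Ym[OF S' t(3)]
  define e where "e u k = (\<integral>\<^sup>+\<omega>. ennreal ((simple_integral W (S k) u \<omega> - I u \<omega>)\<^sup>2) \<partial>P)" for u k
  define d where "d u k = (\<integral>\<^sup>+\<omega>. indicator A \<omega> * ennreal ((simple_integral W S' u \<omega> - simple_integral W (S k) u \<omega>)\<^sup>2) \<partial>P)" for u k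
  define f where "f u = (\<integral>\<^sup>+\<omega>. indicator A \<omega> * ennreal ((simple_integral W S' u \<omega> - I u \<omega>)\<^sup>2) \<partial>P)" for u
  have eA: "(\<integral>\<^sup>+\<omega>. indicator A \<omega> * ennreal ((simple_integral W (S k) u \<omega> - I u \<omega>)\<^sup>2) \<partial>P) \<le> e u k" for u k
    unfolding e_def by (intro nn_integral_mono) (auto simp: indicator_def)
  have 1: "f s \<le> ennreal 2 * d s k + ennreal 2 * e s k" for k
  proof -
    have "f s \<le> ennreal 2 * d s k + ennreal 2 * (\<integral>\<^sup>+\<omega>. indicator A \<omega> * ennreal ((simple_integral W (S k) s \<omega> - I s \<omega>)\<^sup>2) \<partial>P)"
      unfolding f_def d_def
    proof (rule nn_integral_square_add_le)
      show "(simple_integral W S' s \<omega> - I s \<omega>)\<^sup>2 \<le> 2 * (simple_integral W S' s \<omega> - simple_integral W (S k) s \<omega>)\<^sup>2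
          + 2 * (simple_integral W (S k) s \<omega> - I s \<omega>)\<^sup>2" for \<omega>
        using sum_square_le[of "simple_integral W S' s \<omega> - simple_integral W (S k) s \<omega>" "simple_integral W (S k) s \<omega> - I s \<omega>"] by simp
    qed (simp_all, measurable)
    also have "\<dots> \<le> ennreal 2 * d s k + ennreal 2 * e s k" by (intro add_left_mono mult_left_mono eA) simp
    finally show ?thesis .
  qed
  have 2: "d s k \<le> d t k" for k
  proof -
    have "martingale P \<G> (\<lambda>u \<omega>. simple_integral W S' u \<omega> + - simple_integral W (S k) u \<omega>)"
      by (intro G.martingale_add G.martingale_uminus simple_integral_martingale[OF S] simple_integral_martingale[OF S'])
    moreover have "integrable P (\<lambda>\<omega>. (simple_integral W S' t \<omega> + - simple_integral W (S k) t \<omega>)\<^sup>2)"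
      using simple_integral_square[OF S t(3), of k] simple_integral_square[OF S' t(3)]
      by (intro integrable_square_add) simp_all
    ultimately show ?thesis
      unfolding d_def using G.martingale_square_mono[OF _ st(1,2) A] by simp
  qed
  have 3: "d t k \<le> ennreal 2 * f t + ennreal 2 * e t k" for k
  proof -
    have "d t k \<le> ennreal 2 * f t + ennreal 2 * (\<integral>\<^sup>+\<omega>. indicator A \<omega> * ennreal ((simple_integral W (S k) t \<omega> - I t \<omega>)\<^sup>2) \<partial>P)"
      unfolding f_def d_def
    proof (rule nn_integral_square_add_le)
      show "(simple_integral W S' t \<omega> - simple_integral W (S k) t \<omega>)\<^sup>2 \<le> 2 * (simple_integral W S' t \<omega> - I t \<omega>)\<^sup>2
          + 2 * (simple_integral W (S k) t \<omega> - I t \<omega>)\<^sup>2" for \<omega>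
        using sum_square_le[of "simple_integral W S' t \<omega> - I t \<omega>" "- (simple_integral W (S k) t \<omega> - I t \<omega>)"] by (simp add: power2_commute)
    qed (simp_all, measurable)
    also have "\<dots> \<le> ennreal 2 * f t + ennreal 2 * e t k" by (intro add_left_mono mult_left_mono eA) simp
    finally show ?thesis .
  qed
  \<comment> \<open>Neither f s nor f t depends on k, so the errors e can be sent to 0.\<close>
  have "f s \<le> 4 * f t + 4 * e t k + 2 * e s k" for k
  proof -
    have "f s \<le> ennreal 2 * (ennreal 2 * f t + ennreal 2 * e t k) + ennreal 2 * e s k"
      using 1[of k] order_trans[OF 2 3, of k] by (meson add_right_mono mult_left_mono order_trans zero_le)
    also have "\<dots> = 4 * f t + 4 * e t k + 2 * e s k"
      by (simp add: distrib_left mult.assoc[symmetric])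
    finally show ?thesis .
  qed
  moreover have "(\<lambda>k. 4 * f t + 4 * e t k + 2 * e s k) \<longlonglongrightarrow> 4 * f t + 4 * 0 + 2 * 0"
    using lim[OF t(1)] lim[OF t(2)] unfolding e_def[symmetric]
    by (intro tendsto_add tendsto_const ennreal_tendsto_cmult) auto
  ultimately have "f s \<le> 4 * f t + 4 * 0 + 2 * 0" by (intro LIMSEQ_le_const) auto
  then show ?thesis by (simp add: f_def)
qed

text \<open>Up to \<tau> the two integrands are S and H; beyond the dyadic time both vanish. In
  between only S remains, bounded by K on an interval of length at most
  \<open>1 / 2 ^ n\<close>.\<close>

lemma L2_norm2_dyadic_cut:
  fixes S :: "('w, 'n) simple_integrand"
  assumes T: "0 \<le> T" and S: "simple_integrand P \<G> T S" and H: "predictable_on P \<G> {0..T} H"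
    and K: "0 \<le> K" "\<And>t \<omega>. \<omega> \<in> space P \<Longrightarrow> norm (simple_value S t \<omega>) \<le> K"
  shows "L2_norm2 P T (\<lambda>t \<omega>. simple_value (dyadic_cut (cut_time T) T n S) t \<omega> - of_bool (ereal t \<le> \<tau> \<omega>) *\<^sub>R H t \<omega>)
    \<le> L2_norm2 P T (\<lambda>t \<omega>. simple_value S t \<omega> - H t \<omega>) + ennreal (K\<^sup>2 / 2 ^ n)"
proof -
  let ?D = "\<lambda>t \<omega>. ennreal ((norm (simple_value S t \<omega> - H t \<omega>))\<^sup>2) * indicator {0..T} t"
  let ?s = "cut_time T" and ?d = "\<lambda>\<omega>. dyadic n (cut_time T \<omega>)"
  have Dm: "(\<lambda>x. ?D (fst x) (snd x)) \<in> borel_measurable (borel \<Otimes>\<^sub>M P)"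
  proof -
    note [measurable] = simple_value_measurable[OF S]
    have [measurable]: "(\<lambda>x. indicator {0..T} (fst x) *\<^sub>R H (fst x) (snd x)) \<in> borel_measurable (borel \<Otimes>\<^sub>M P)"
      by (rule G.predictable_on_product[OF H G.predictable_strip]) auto
    have "(\<lambda>x. ennreal ((norm (indicator {0..T} (fst x) *\<^sub>R simple_value S (fst x) (snd x) - indicator {0..T} (fst x) *\<^sub>R H (fst x) (snd x)))\<^sup>2))
        \<in> borel_measurable (borel \<Otimes>\<^sub>M P)"
      by measurable
    also have "?this \<longleftrightarrow> ?thesis"
      by (intro measurable_cong) (auto simp: indicator_def)
    finally show ?thesis .
  qed
  have Dt: "(\<lambda>t. ?D t \<omega>) \<in> borel_measurable borel" if "\<omega> \<in> space P" for \<omega>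
    using measurable_compose[OF measurable_Pair2'[OF that] Dm] by simp
  have D\<omega>: "(\<lambda>\<omega>. \<integral>\<^sup>+t. ?D t \<omega> \<partial>lborel) \<in> borel_measurable P"
  proof -
    have "(\<lambda>x. ?D (snd x) (fst x)) \<in> borel_measurable (P \<Otimes>\<^sub>M lborel)"
      using measurable_pair_swap[OF Dm] by (simp add: case_prod_beta) measurable
    then show ?thesis by (intro lborel.borel_measurable_nn_integral) (simp add: case_prod_beta)
  qed
  have "L2_norm2 P T (\<lambda>t \<omega>. simple_value (dyadic_cut (cut_time T) T n S) t \<omega> - of_bool (ereal t \<le> \<tau> \<omega>) *\<^sub>R H t \<omega>)
    \<le> (\<integral>\<^sup>+\<omega>. (\<integral>\<^sup>+t. ?D t \<omega> \<partial>lborel) + ennreal (K\<^sup>2 / 2 ^ n) \<partial>P)"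
    unfolding L2_norm2_def
  proof (intro nn_integral_mono)
    fix \<omega> assume \<omega>: "\<omega> \<in> space P"
    note b = cut_time_bounds[OF T \<omega>]
    have "(\<integral>\<^sup>+t. ennreal ((norm (simple_value (dyadic_cut (cut_time T) T n S) t \<omega> - of_bool (ereal t \<le> \<tau> \<omega>) *\<^sub>R H t \<omega>))\<^sup>2) * indicator {0..T} t \<partial>lborel)
      \<le> (\<integral>\<^sup>+t. ?D t \<omega> + ennreal (K\<^sup>2) * indicator {?s \<omega><..?d \<omega>} t \<partial>lborel)"
    proof (intro nn_integral_mono)
      fix t :: real
      have v: "simple_value (dyadic_cut (cut_time T) T n S) t \<omega> = of_bool (t \<le> ?d \<omega>) *\<^sub>R simple_value S t \<omega>"
        by (rule simple_value_dyadic_cut[where \<sigma> = "cut_time T", OF S b])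
      have Kv: "ennreal ((norm (simple_value S t \<omega>))\<^sup>2) \<le> ennreal (K\<^sup>2)"
        by (intro ennreal_leI power_mono K(2)[OF \<omega>]) simp
      show "ennreal ((norm (simple_value (dyadic_cut (cut_time T) T n S) t \<omega> - of_bool (ereal t \<le> \<tau> \<omega>) *\<^sub>R H t \<omega>))\<^sup>2) * indicator {0..T} t
        \<le> ?D t \<omega> + ennreal (K\<^sup>2) * indicator {?s \<omega><..?d \<omega>} t"
      proof (cases "t \<in> {0..T}")
        case True
        then have le: "ereal t \<le> \<tau> \<omega> \<longleftrightarrow> t \<le> ?s \<omega>" using le_cut_time_iff[OF \<omega>, of t T] by simp
        consider "t \<le> ?s \<omega>" | "?s \<omega> < t" "t \<le> ?d \<omega>" | "?s \<omega> < t" "?d \<omega> < t" by linarith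
        then show ?thesis
        proof cases
          case 1
          then have "t \<le> ?d \<omega>" using dyadic_ge[of "?s \<omega>" n] by linarith
          then show ?thesis using 1 by (simp add: v le)
        next
          case 2
          then show ?thesis using True Kv by (simp add: v le add_increasing)
        next
          case 3
          then show ?thesis by (simp add: v le)
        qed
      qed simp
    qed
    also have "\<dots> = (\<integral>\<^sup>+t. ?D t \<omega> \<partial>lborel) + (\<integral>\<^sup>+t. ennreal (K\<^sup>2) * indicator {?s \<omega><..?d \<omega>} t \<partial>lborel)"
      using Dt[OF \<omega>] by (intro nn_integral_add) auto
    also have "(\<integral>\<^sup>+t. ennreal (K\<^sup>2) * indicator {?s \<omega><..?d \<omega>} t \<partial>lborel) = ennreal (K\<^sup>2 * (?d \<omega> - ?s \<omega>))"
      using dyadic_ge[of "?s \<omega>" n] by (simp add: nn_integral_cmult_indicator ennreal_mult)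
    also have "\<dots> \<le> ennreal (K\<^sup>2 / 2 ^ n)"
    proof (rule ennreal_leI)
      have "K\<^sup>2 * (?d \<omega> - ?s \<omega>) \<le> K\<^sup>2 * (1 / 2 ^ n)"
        using dyadic_le[of n "?s \<omega>"] by (intro mult_left_mono) auto
      then show "K\<^sup>2 * (?d \<omega> - ?s \<omega>) \<le> K\<^sup>2 / 2 ^ n" by simp
    qed
    finally show "(\<integral>\<^sup>+t. ennreal ((norm (simple_value (dyadic_cut (cut_time T) T n S) t \<omega> - of_bool (ereal t \<le> \<tau> \<omega>) *\<^sub>R H t \<omega>))\<^sup>2) * indicator {0..T} t \<partial>lborel)
      \<le> (\<integral>\<^sup>+t. ?D t \<omega> \<partial>lborel) + ennreal (K\<^sup>2 / 2 ^ n)"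
      by (simp add: add_left_mono)
  qed
  also have "\<dots> = L2_norm2 P T (\<lambda>t \<omega>. simple_value S t \<omega> - H t \<omega>) + ennreal (K\<^sup>2 / 2 ^ n)"
    unfolding L2_norm2_def using D\<omega> by (subst nn_integral_add) (simp_all add: emeasure_space_1)
  finally show ?thesis .
qed

text \<open>The error of the cut integrals splits into the overshoot p of the dyadic time, small by
  the choice of the level, and the error r of the uncut simple integral at \<tau> \<and> t, which is
  at most 4 times its error at t in mean square. No uniform control over the integrands S k is
  available, and none is required by this diagonal choice.\<close>

theorem has_ito_integral_stopped:
  assumes T: "0 < T" and I: "has_ito_integral P \<F> W T H I"
  shows "has_ito_integral P \<G> W T (\<lambda>t \<omega>. of_bool (ereal t \<le> \<tau> \<omega>) *\<^sub>R H t \<omega>) (\<lambda>t \<omega>. I (stopped t (\<tau> \<omega>)) \<omega>)"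
proof -
  have T0: "0 \<le> T" using T by simp
  from I obtain S where HF: "predictable_on P \<F> {0..T} H" and HL: "L2_norm2 P T H < \<infinity>"
    and Iad: "adapted_on \<F> {0..T} I" and Ic: "AE \<omega> in P. continuous_on {0..T} (\<lambda>t. I t \<omega>)"
    and SF: "\<And>k. simple_integrand P \<F> T (S k)"
    and SH: "(\<lambda>k::nat. L2_norm2 P T (\<lambda>t \<omega>. simple_value (S k) t \<omega> - H t \<omega>)) \<longlonglongrightarrow> 0"
    and SI: "\<And>t. t \<in> {0..T} \<Longrightarrow> (\<lambda>k. \<integral>\<^sup>+\<omega>. ennreal ((simple_integral W (S k) t \<omega> - I t \<omega>)\<^sup>2) \<partial>P) \<longlonglongrightarrow> 0"
    unfolding has_ito_integral_def by blast
  have SG: "simple_integrand P \<G> T (S k)" for k by (rule simple_integrand_F_G[OF SF])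
  have HG: "predictable_on P \<G> {0..T} H" by (rule predictable_F_G[OF HF])
  have IF: "I t \<in> borel_measurable (\<F> t)" if "0 \<le> t" "t \<le> T" for t
    using Iad that by (simp add: adapted_on_def)
  have IG: "I t \<in> borel_measurable (\<G> t)" if "0 \<le> t" "t \<le> T" for t
    by (rule measurable_F_G[OF IF[OF that]])
  have IP: "I t \<in> borel_measurable P" if "t \<in> {0..T}" for t
  proof -
    have "0 \<le> t" "t \<le> T" using that by auto
    show ?thesis by (rule F.measurable_H_P[OF \<open>0 \<le> t\<close> IF]) fact+
  qed
  have "\<forall>k. \<exists>K. 0 \<le> K \<and> (\<forall>t. \<forall>\<omega>\<in>space P. norm (simple_value (S k) t \<omega>) \<le> K)"
    by (rule allI) (rule simple_value_bounded[OF SG])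
  from choice[OF this] obtain K where "\<forall>k. 0 \<le> K k \<and> (\<forall>t. \<forall>\<omega>\<in>space P. norm (simple_value (S k) t \<omega>) \<le> K k)" ..
  then have K: "0 \<le> K k" "\<omega> \<in> space P \<Longrightarrow> norm (simple_value (S k) t \<omega>) \<le> K k" for k t \<omega>
    by (simp_all only:)
  have "\<forall>k. \<exists>C. 0 \<le> C \<and> (\<forall>n. \<forall>t\<in>{0..T}.
    (\<integral>\<^sup>+\<omega>. ennreal ((simple_integral W (S k) (min t (dyadic n (cut_time T \<omega>))) \<omega> -
      simple_integral W (S k) (min t (cut_time T \<omega>)) \<omega>)\<^sup>2) \<partial>P) \<le> ennreal (C / 2 ^ n))"
    by (rule allI) (rule simple_integral_dyadic_error[OF T0 SG])
  from choice[OF this] obtain C where C': "\<forall>k. 0 \<le> C k \<and> (\<forall>n. \<forall>t\<in>{0..T}.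
    (\<integral>\<^sup>+\<omega>. ennreal ((simple_integral W (S k) (min t (dyadic n (cut_time T \<omega>))) \<omega> -
      simple_integral W (S k) (min t (cut_time T \<omega>)) \<omega>)\<^sup>2) \<partial>P) \<le> ennreal (C k / 2 ^ n))" ..
  then have C: "0 \<le> C k" "t \<in> {0..T} \<Longrightarrow>
    (\<integral>\<^sup>+\<omega>. ennreal ((simple_integral W (S k) (min t (dyadic n (cut_time T \<omega>))) \<omega> -
      simple_integral W (S k) (min t (cut_time T \<omega>)) \<omega>)\<^sup>2) \<partial>P) \<le> ennreal (C k / 2 ^ n)" for k n t
    by (simp_all only:)
  \<comment> \<open>One level serves both errors: K k controls the overshoot of the integrand, C k
    that of its integral. The \<open>+ 1\<close> in B keeps the divisor positive if both constants
    vanish.\<close>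
  have "\<exists>n. ((K k)\<^sup>2 + C k) / 2 ^ n \<le> (1 / 2) ^ k" for k
  proof -
    define B where "B = (K k)\<^sup>2 + C k + 1"
    have B: "0 < B" using C(1)[of k] zero_le_power2[of "K k"] unfolding B_def by linarith
    obtain n where n: "(1 / 2 :: real) ^ n < (1 / 2) ^ k / B"
      using real_arch_pow_inv[of "(1 / 2) ^ k / B" "1 / 2"] B by auto
    have "((K k)\<^sup>2 + C k) / 2 ^ n \<le> B * (1 / 2) ^ n"
      by (simp add: B_def power_one_over divide_right_mono)
    also have "\<dots> \<le> (1 / 2) ^ k" using n B by (simp add: field_simps)
    finally show ?thesis by blast
  qed
  then obtain n where n: "\<And>k. ((K k)\<^sup>2 + C k) / 2 ^ n k \<le> (1 / 2) ^ k" by metis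
  have nK: "ennreal ((K k)\<^sup>2 / 2 ^ n k) \<le> ennreal ((1 / 2) ^ k)" and nC: "ennreal (C k / 2 ^ n k) \<le> ennreal ((1 / 2) ^ k)" for k
  proof -
    have "(K k)\<^sup>2 / 2 ^ n k \<le> ((K k)\<^sup>2 + C k) / 2 ^ n k" "C k / 2 ^ n k \<le> ((K k)\<^sup>2 + C k) / 2 ^ n k"
      using C(1)[of k] by (auto intro!: divide_right_mono)
    then show "ennreal ((K k)\<^sup>2 / 2 ^ n k) \<le> ennreal ((1 / 2) ^ k)" "ennreal (C k / 2 ^ n k) \<le> ennreal ((1 / 2) ^ k)"
      using n[of k] by (auto intro: ennreal_leI order_trans)
  qed
  have half: "(\<lambda>k. ennreal ((1 / 2) ^ k)) \<longlonglongrightarrow> 0"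
    using tendsto_ennrealI[OF LIMSEQ_power_zero[of "1 / 2 :: real"]] by simp
  define S' where "S' k = dyadic_cut (cut_time T) T (n k) (S k)" for k
  have S': "simple_integrand P \<G> T (S' k)" for k
    unfolding S'_def by (rule simple_integrand_dyadic_cut[OF T0 SG])
  show ?thesis
    unfolding has_ito_integral_def
  proof (intro conjI exI[of _ S'] allI ballI)
    show "predictable_on P \<G> {0..T} (\<lambda>t \<omega>. of_bool (ereal t \<le> \<tau> \<omega>) *\<^sub>R H t \<omega>)"
    proof -
      have p: "Measurable.pred (predictable_algebra P \<G>) (\<lambda>x. ereal (fst x) \<le> \<tau> (snd x))"
        by (rule G.predictable_before[OF \<tau>_stopping \<tau>_nonneg])
      have [measurable]: "Measurable.pred (restrict_space (predictable_algebra P \<G>) ({0..T} \<times> space P)) (\<lambda>x. ereal (fst x) \<le> \<tau> (snd x))"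
        by (rule measurable_restrict_space1[OF p])
      have [measurable]: "(\<lambda>x. H (fst x) (snd x)) \<in> borel_measurable (restrict_space (predictable_algebra P \<G>) ({0..T} \<times> space P))"
        using HG by (simp add: predictable_on_def case_prod_beta')
      show ?thesis unfolding predictable_on_def case_prod_beta' by measurable
    qed
    have "L2_norm2 P T (\<lambda>t \<omega>. of_bool (ereal t \<le> \<tau> \<omega>) *\<^sub>R H t \<omega>) \<le> L2_norm2 P T H"
      unfolding L2_norm2_def by (intro nn_integral_mono) (auto simp: indicator_def)
    then show "L2_norm2 P T (\<lambda>t \<omega>. of_bool (ereal t \<le> \<tau> \<omega>) *\<^sub>R H t \<omega>) < \<infinity>"
      using HL by (rule le_less_trans)
    show "adapted_on \<G> {0..T} (\<lambda>t \<omega>. I (stopped t (\<tau> \<omega>)) \<omega>)"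
      unfolding adapted_on_def
    proof
      fix t assume t: "t \<in> {0..T}"
      then have t': "0 \<le> t" "t \<le> T" by auto
      have "(\<lambda>\<omega>. I (min t (cut_time T \<omega>)) \<omega>) \<in> borel_measurable (\<G> t)"
        by (rule stopped_measurable[OF T0 t' Ic]) (rule IG, use t' in auto)
      also have "?this \<longleftrightarrow> (\<lambda>\<omega>. I (stopped t (\<tau> \<omega>)) \<omega>) \<in> borel_measurable (\<G> t)"
        by (intro measurable_cong) (simp add: space_G stopped_eq_min[OF _ t'(2)])
      finally show "(\<lambda>\<omega>. I (stopped t (\<tau> \<omega>)) \<omega>) \<in> borel_measurable (\<G> t)" .
    qed
    show "AE \<omega> in P. continuous_on {0..T} (\<lambda>t. I (stopped t (\<tau> \<omega>)) \<omega>)"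
      using Ic AE_space
    proof eventually_elim
      case (elim \<omega>)
      have "continuous_on {0..T} (\<lambda>t. I (min t (cut_time T \<omega>)) \<omega>)"
        by (rule continuous_on_compose2[OF elim(1)])
           (use cut_time_bounds[OF T0 elim(2)] in \<open>auto intro!: continuous_intros\<close>)
      also have "?this \<longleftrightarrow> ?case"
        by (intro continuous_on_cong) (simp_all add: stopped_eq_min[OF elim(2), of _ T])
      finally show ?case .
    qed
    show "simple_integrand P \<G> T (S' k)" for k by (rule S')
    show "(\<lambda>k. L2_norm2 P T (\<lambda>t \<omega>. simple_value (S' k) t \<omega> - of_bool (ereal t \<le> \<tau> \<omega>) *\<^sub>R H t \<omega>)) \<longlonglongrightarrow> 0"
    proof (rule tendsto_sandwich[of "\<lambda>_. 0" _ _ "\<lambda>k. L2_norm2 P T (\<lambda>t \<omega>. simple_value (S k) t \<omega> - H t \<omega>) + ennreal ((1 / 2) ^ k)"])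
      show "(\<lambda>k. L2_norm2 P T (\<lambda>t \<omega>. simple_value (S k) t \<omega> - H t \<omega>) + ennreal ((1 / 2) ^ k)) \<longlonglongrightarrow> 0"
        using tendsto_add[OF SH half] by simp
      show "\<forall>\<^sub>F k in sequentially. L2_norm2 P T (\<lambda>t \<omega>. simple_value (S' k) t \<omega> - of_bool (ereal t \<le> \<tau> \<omega>) *\<^sub>R H t \<omega>)
          \<le> L2_norm2 P T (\<lambda>t \<omega>. simple_value (S k) t \<omega> - H t \<omega>) + ennreal ((1 / 2) ^ k)"
      proof (intro always_eventually allI)
        fix k
        show "L2_norm2 P T (\<lambda>t \<omega>. simple_value (S' k) t \<omega> - of_bool (ereal t \<le> \<tau> \<omega>) *\<^sub>R H t \<omega>)
          \<le> L2_norm2 P T (\<lambda>t \<omega>. simple_value (S k) t \<omega> - H t \<omega>) + ennreal ((1 / 2) ^ k)"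
          unfolding S'_def
          by (rule order_trans[OF L2_norm2_dyadic_cut[OF T0 SG HG K(1,2)] add_left_mono[OF nK]])
      qed
    qed auto
    fix t assume t: "t \<in> {0..T}"
    then have t': "0 \<le> t" "t \<le> T" by auto
    define e where "e k = (\<integral>\<^sup>+\<omega>. ennreal ((simple_integral W (S k) t \<omega> - I t \<omega>)\<^sup>2) \<partial>P)" for k
    show "(\<lambda>k. \<integral>\<^sup>+\<omega>. ennreal ((simple_integral W (S' k) t \<omega> - I (stopped t (\<tau> \<omega>)) \<omega>)\<^sup>2) \<partial>P) \<longlonglongrightarrow> 0"
    proof (rule tendsto_sandwich[of "\<lambda>_. 0" _ _ "\<lambda>k. 2 * ennreal ((1 / 2) ^ k) + 2 * (4 * e k)"])
      have "(\<lambda>k. 2 * ennreal ((1 / 2) ^ k) + 2 * (4 * e k)) \<longlonglongrightarrow> 2 * 0 + 2 * (4 * 0)"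
        using SI[OF t] half unfolding e_def[symmetric]
        by (intro tendsto_add ennreal_tendsto_cmult) auto
      then show "(\<lambda>k. 2 * ennreal ((1 / 2) ^ k) + 2 * (4 * e k)) \<longlonglongrightarrow> 0" by simp
      show "\<forall>\<^sub>F k in sequentially. (\<integral>\<^sup>+\<omega>. ennreal ((simple_integral W (S' k) t \<omega> - I (stopped t (\<tau> \<omega>)) \<omega>)\<^sup>2) \<partial>P)
          \<le> 2 * ennreal ((1 / 2) ^ k) + 2 * (4 * e k)"
      proof (intro always_eventually allI)
        fix k
        define p where "p \<omega> = simple_integral W (S k) (min t (dyadic (n k) (cut_time T \<omega>))) \<omega> -
          simple_integral W (S k) (min t (cut_time T \<omega>)) \<omega>" for \<omega>
        define r where "r \<omega> = simple_integral W (S k) (min t (cut_time T \<omega>)) \<omega> - I (min t (cut_time T \<omega>)) \<omega>" for \<omega>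
        note sm = simple_integral_stopped_measurable[OF T0 SG t']
        have Im: "(\<lambda>\<omega>. I (min t (cut_time T \<omega>)) \<omega>) \<in> borel_measurable P"
          by (rule G.measurable_H_P[OF t'(1) stopped_measurable[OF T0 t' Ic]]) (rule IG, use t' in auto)
        have pm: "p \<in> borel_measurable P" and rm: "r \<in> borel_measurable P"
          unfolding p_def[abs_def] r_def[abs_def] by (intro borel_measurable_diff sm(1,2) Im)+
        have r_le: "(\<integral>\<^sup>+\<omega>. ennreal ((r \<omega>)\<^sup>2) \<partial>P) \<le> 4 * e k"
          unfolding r_def e_def
        proof (rule stopped_square_le[of T t "\<lambda>s \<omega>. simple_integral W (S k) s \<omega> - I s \<omega>", OF T0 t'])
          show "AE \<omega> in P. continuous_on {0..T} (\<lambda>s. simple_integral W (S k) s \<omega> - I s \<omega>)"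
            using sm(3)[of k] Ic by eventually_elim (intro continuous_on_diff)
          show "(\<lambda>\<omega>. simple_integral W (S k) s \<omega> - I s \<omega>) \<in> borel_measurable (\<G> s)" if "0 \<le> s" "s \<le> t" for s
            using G.martingale_measurable[OF simple_integral_martingale[OF SG] that(1)] IG[OF that(1)] that t'
            by (intro borel_measurable_diff) auto
          show "(\<integral>\<^sup>+\<omega>. indicator A \<omega> * ennreal ((simple_integral W (S k) s \<omega> - I s \<omega>)\<^sup>2) \<partial>P)
            \<le> 4 * (\<integral>\<^sup>+\<omega>. indicator A \<omega> * ennreal ((simple_integral W (S k) t \<omega> - I t \<omega>)\<^sup>2) \<partial>P)"
            if "0 \<le> s" "s \<le> t" "A \<in> sets (\<G> s)" for s A
            by (rule approximation_error_square_le[OF SG SG IP SI that(1,2) t'(2) that(3)])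
        qed simp
        have "(\<integral>\<^sup>+\<omega>. indicator (space P) \<omega> * ennreal ((simple_integral W (S' k) t \<omega> - I (stopped t (\<tau> \<omega>)) \<omega>)\<^sup>2) \<partial>P) \<le>
          ennreal 2 * (\<integral>\<^sup>+\<omega>. indicator (space P) \<omega> * ennreal ((p \<omega>)\<^sup>2) \<partial>P) + ennreal 2 * (\<integral>\<^sup>+\<omega>. indicator (space P) \<omega> * ennreal ((r \<omega>)\<^sup>2) \<partial>P)"
        proof (rule nn_integral_square_add_le_space[OF pm rm])
          fix \<omega> assume \<omega>: "\<omega> \<in> space P"
          have "simple_integral W (S' k) t \<omega> - I (stopped t (\<tau> \<omega>)) \<omega> = p \<omega> + r \<omega>"
            unfolding S'_def p_def r_def stopped_eq_min[OF \<omega> t'(2)]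
            by (simp add: simple_integral_dyadic_cut[where \<sigma> = "cut_time T", OF SG cut_time_bounds[OF T0 \<omega>]])
          then show "(simple_integral W (S' k) t \<omega> - I (stopped t (\<tau> \<omega>)) \<omega>)\<^sup>2 \<le> 2 * (p \<omega>)\<^sup>2 + 2 * (r \<omega>)\<^sup>2"
            using sum_square_le by simp
        qed simp_all
        also have "\<dots> \<le> ennreal 2 * ennreal ((1 / 2) ^ k) + ennreal 2 * (4 * e k)"
          unfolding nn_integral_space_indicator
          by (intro add_mono mult_left_mono r_le order_trans[OF _ nC]) (use C(2)[OF t] in \<open>auto simp: p_def\<close>)
        finally show "(\<integral>\<^sup>+\<omega>. ennreal ((simple_integral W (S' k) t \<omega> - I (stopped t (\<tau> \<omega>)) \<omega>)\<^sup>2) \<partial>P)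
          \<le> 2 * ennreal ((1 / 2) ^ k) + 2 * (4 * e k)"
          unfolding nn_integral_space_indicator by simp
      qed
    qed auto
  qed
qed

end


section \<open>Statements holding almost everywhere in time\<close>

context default_market
begin

text \<open>Time 0 is Lebesgue null, so the pathwise statement is asked only for positive times,
  where \<open>left_limit\<close> is a genuine left limit.\<close>

lemma ae_timeI:
  assumes "AE \<omega> in P. \<forall>t\<in>{0<..T}. Q t \<omega>"
  shows "ae_time P T Q"
proof -
  obtain N where N: "{\<omega> \<in> space P. \<not> (\<forall>t\<in>{0<..T}. Q t \<omega>)} \<subseteq> N" "N \<in> null_sets P"
    using assms by (rule AE_E3) (auto simp: Collect_conj_eq)
  have "(UNIV :: real set) \<times> N \<in> null_sets (lborel \<Otimes>\<^sub>M P)"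
    using N(2) by (intro null_setsI) (simp_all add: emeasure_pair_measure_Times null_setsD1 null_setsD2)
  moreover have "{0 :: real} \<times> space P \<in> null_sets (lborel \<Otimes>\<^sub>M P)"
    by (intro null_setsI) (auto simp: emeasure_pair_measure_Times)
  ultimately have "(UNIV :: real set) \<times> N \<union> {0} \<times> space P \<in> null_sets (lborel \<Otimes>\<^sub>M P)"
    by (rule null_sets.Un)
  then show ?thesis
    unfolding ae_time_def
    by (rule AE_I') (use N(1) in \<open>force simp: space_pair_measure\<close>)
qed

text \<open>Fubini for null sets, after swapping the factors, since \<open>ae_time\<close> puts time
  first.\<close>

lemma ae_time_path:
  assumes "ae_time P T Q"
  shows "AE \<omega> in P. AE t in lborel. t \<in> {0..T} \<longrightarrow> Q t \<omega>"
proof -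
  interpret PL: pair_sigma_finite P lborel ..
  interpret LP: pair_sigma_finite lborel P ..
  have "AE x in distr (P \<Otimes>\<^sub>M lborel) (lborel \<Otimes>\<^sub>M P) (\<lambda>(x, y). (y, x)). fst x \<in> {0..T} \<longrightarrow> Q (fst x) (snd x)"
    using assms unfolding ae_time_def LP.distr_pair_swap[symmetric] .
  then have "AE x in P \<Otimes>\<^sub>M lborel. snd x \<in> {0..T} \<longrightarrow> Q (snd x) (fst x)"
    by (rule AE_distrD[rotated, THEN eventually_mono]) (auto simp: case_prod_beta)
  from PL.AE_pair[OF this] show ?thesis by simp
qed

lemma ae_time_imp:
  assumes "ae_time P T Q" "ae_time P T R" "\<And>t \<omega>. 0 \<le> t \<Longrightarrow> t \<le> T \<Longrightarrow> Q t \<omega> \<Longrightarrow> R t \<omega> \<Longrightarrow> S t \<omega>"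
  shows "ae_time P T S"
  using assms(1,2) unfolding ae_time_def by eventually_elim (use assms(3) in auto)


section \<open>Integrals against the compensated jump martingale\<close>

text \<open>The jump part is a point mass at \<tau>, for which any real value of U is integrable. In
  the compensator part, b \<le> \<tau> makes \<open>rate\<close> equal to \<open>lam\<close> on (a,
  b], and a bound on U for almost every time is enough because that measure has a density.\<close>

lemma
  assumes \<omega>: "\<omega> \<in> space P" and T: "0 \<le> T"
    and U: "(\<lambda>s. indicator {0..T} s *\<^sub>R U s \<omega>) \<in> borel_measurable borel"
    and B: "AE s in lborel. s \<in> {0..T} \<longrightarrow> \<bar>U s \<omega>\<bar> \<le> B"
    and ab: "0 \<le> a" "b \<le> stopped T (\<tau> \<omega>)"
  shows lam_set_integrable: "set_integrable lborel {a<..b} (\<lambda>s. lam s \<omega> * U s \<omega>)"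
    and M_integrableI: "M_integrable \<tau> lam U a b \<omega>"
    and M_integral_eq: "M_integral \<tau> lam U a b \<omega> =
      (if ereal a < \<tau> \<omega> \<and> \<tau> \<omega> \<le> ereal b then U (real_of_ereal (\<tau> \<omega>)) \<omega> else 0) - (LINT s:{a<..b}|lborel. lam s \<omega> * U s \<omega>)"
proof -
  have \<tau>0: "0 \<le> \<tau> \<omega>" by (rule \<tau>_nonneg[OF \<omega>])
  have b: "b \<le> T" "s \<le> b \<Longrightarrow> ereal s \<le> \<tau> \<omega>" for s
    using ab(2) le_stopped_iff[OF \<tau>0, of b T] le_stopped_iff[OF \<tau>0, of s T] by auto
  obtain K where K: "0 \<le> K" "\<And>s. 0 \<le> s \<Longrightarrow> 0 \<le> lam s \<omega> \<and> lam s \<omega> \<le> K"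
    using lam_bounded \<omega> by blast
  have Um: "(\<lambda>s. indicator {a<..b} s *\<^sub>R U s \<omega>) \<in> borel_measurable borel"
  proof -
    have "(\<lambda>s. indicator {a<..b} s *\<^sub>R (indicator {0..T} s *\<^sub>R U s \<omega>)) \<in> borel_measurable borel"
      using U by measurable
    also have "(\<lambda>s. indicator {a<..b} s *\<^sub>R (indicator {0..T} s *\<^sub>R U s \<omega>)) = (\<lambda>s. indicator {a<..b} s *\<^sub>R U s \<omega>)"
      using ab b by (auto simp: indicator_def fun_eq_iff)
    finally show ?thesis .
  qed
  have rate: "rate \<omega> s = lam s \<omega>" if "s \<in> {a<..b}" for s
    using that ab b(2)[of s] by (simp add: rate_def)
  note [measurable] = Um rate_measurable[OF \<omega>]
  have ind: "indicator {a<..b} s *\<^sub>R (lam s \<omega> * U s \<omega>) = (rate \<omega> s * indicator {0<..} s) * (indicator {a<..b} s *\<^sub>R U s \<omega>)" for s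
    using rate[of s] ab by (auto simp: indicator_def)
  have "integrable lborel (\<lambda>s. indicator {a<..b} s *\<^sub>R (lam s \<omega> * U s \<omega>))"
  proof (rule integrableI_bounded_set[where A = "{a<..b}" and B = "K * B"])
    show "(\<lambda>s. indicator {a<..b} s *\<^sub>R (lam s \<omega> * U s \<omega>)) \<in> borel_measurable lborel"
      unfolding ind by measurable
    show "AE s in lborel. s \<in> {a<..b} \<longrightarrow> norm (indicator {a<..b} s *\<^sub>R (lam s \<omega> * U s \<omega>)) \<le> K * B"
      using B
    proof eventually_elim
      case (elim s)
      show ?case
      proof
        assume s: "s \<in> {a<..b}"
        then have "0 \<le> s" "s \<in> {0..T}" using ab b by auto
        then have "\<bar>lam s \<omega>\<bar> \<le> K" "\<bar>U s \<omega>\<bar> \<le> B" using K(2)[of s] elim by auto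
        then have "\<bar>lam s \<omega>\<bar> * \<bar>U s \<omega>\<bar> \<le> K * B" using K(1) by (intro mult_mono) auto
        then show "norm (indicator {a<..b} s *\<^sub>R (lam s \<omega> * U s \<omega>)) \<le> K * B" using s by (simp add: abs_mult)
      qed
    qed
  qed (auto simp: emeasure_Ioc_finite)
  then show int: "set_integrable lborel {a<..b} (\<lambda>s. lam s \<omega> * U s \<omega>)"
    by (simp only: set_integrable_def)
  have comp: "interval_measure (\<lambda>u. compensator \<tau> lam u \<omega>) = density lborel (\<lambda>s. ennreal (rate \<omega> s * indicator {0<..} s))"
    unfolding interval_measure_compensator[OF \<omega>] by (intro arg_cong2[where f = density] ext) (auto simp: indicator_def)
  have rate_nonneg: "0 \<le> rate \<omega> s * indicator {0<..} s" for s
    using K(2)[of "max 0 s"] by (simp add: rate_def)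
  have gi: "integrable lborel (\<lambda>s. (rate \<omega> s * indicator {0<..} s) * (indicator {a<..b} s *\<^sub>R U s \<omega>))"
    using int unfolding set_integrable_def ind .
  have compi: "set_integrable (interval_measure (\<lambda>u. compensator \<tau> lam u \<omega>)) {a<..b} (\<lambda>s. U s \<omega>)"
    unfolding comp set_integrable_def
    by (rule integrable_real_density[THEN iffD2, OF _ _ _ gi]) (use rate_nonneg in \<open>simp_all del: real_scaleR_def\<close>)
  have compe: "(LINT s:{a<..b}|interval_measure (\<lambda>u. compensator \<tau> lam u \<omega>). U s \<omega>) = (LINT s:{a<..b}|lborel. lam s \<omega> * U s \<omega>)"
    unfolding comp set_lebesgue_integral_def ind
    by (rule integral_real_density) (use rate_nonneg in \<open>simp_all del: real_scaleR_def\<close>)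
  have jump: "set_integrable (interval_measure (\<lambda>u. jump_process \<tau> u \<omega>)) {a<..b} (\<lambda>s. U s \<omega>) \<and>
    (LINT s:{a<..b}|interval_measure (\<lambda>u. jump_process \<tau> u \<omega>). U s \<omega>) =
      (if ereal a < \<tau> \<omega> \<and> \<tau> \<omega> \<le> ereal b then U (real_of_ereal (\<tau> \<omega>)) \<omega> else 0)"
  proof (cases "\<tau> \<omega>")
    case (real x)
    have m: "interval_measure (\<lambda>u. jump_process \<tau> u \<omega>) = return borel x"
      using interval_measure_step[of "\<tau> \<omega>"] by (simp add: jump_process_def real)
    have "integrable (return borel x) (\<lambda>s. indicator {a<..b} s *\<^sub>R U s \<omega>)"
      unfolding integrable_iff_bounded by (subst nn_integral_return) (simp_all del: real_scaleR_def)
    moreover have "(LINT s|return borel x. indicator {a<..b} s *\<^sub>R U s \<omega>) = indicator {a<..b} x *\<^sub>R U x \<omega>"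
      by (rule integral_return) (simp_all del: real_scaleR_def)
    ultimately show ?thesis
      unfolding m set_integrable_def set_lebesgue_integral_def by (auto simp: real indicator_def)
  next
    case PInf
    have "interval_measure (\<lambda>u. jump_process \<tau> u \<omega>) = null_measure borel"
      using interval_measure_step[of "\<tau> \<omega>"] by (simp add: jump_process_def PInf)
    moreover have "(\<lambda>s. indicator {a<..b} s *\<^sub>R U s \<omega>) \<in> borel_measurable (null_measure borel)"
      using Um by (subst measurable_cong_sets[OF sets_null_measure refl])
    ultimately show ?thesis
      unfolding set_integrable_def set_lebesgue_integral_def integrable_iff_bounded
      by (simp add: PInf integral_null_measure)
  next
    case MInf
    then show ?thesis using \<tau>0 by simp
  qed
  show "M_integrable \<tau> lam U a b \<omega>"
    unfolding M_integrable_def using jump compi by simp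
  show "M_integral \<tau> lam U a b \<omega> =
      (if ereal a < \<tau> \<omega> \<and> \<tau> \<omega> \<le> ereal b then U (real_of_ereal (\<tau> \<omega>)) \<omega> else 0) - (LINT s:{a<..b}|lborel. lam s \<omega> * U s \<omega>)"
    unfolding M_integral_def using jump compe by simp
qed

end


section \<open>Paths of the glued processes\<close>

text \<open>With u = \<open>cGa c i s \<omega>\<close> - p, the coefficient of F is \<lambda> E (p +
  u) + \<lambda> u = \<lambda> (E + 1) (p + u) - \<lambda> p, and p + u is the value of
  \<open>cGa\<close>.\<close>

lemma N_jump_eq_N_hat:
  assumes "intensity_G \<tau> lam s \<omega> = lam s \<omega>"
  shows "N_jump c \<tau> lam i s \<omega> p L (cGa c i s \<omega> - p) = N_hat c lam i s \<omega> p L"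
  unfolding N_jump_def N_hat_def assms
  by (simp add: vec_eq_iff algebra_simps)

lemma R_jump_eq_R_hat:
  assumes "intensity_G \<tau> lam s \<omega> = lam s \<omega>"
  shows "R_jump c \<tau> lam i s \<omega> p (cGa c i s \<omega> - p) = R_hat c lam i s \<omega> p"
  unfolding R_jump_def R_hat_def assms by simp

text \<open>The case distinction is non-strict: at s = \<tau> the left limit still sees only times
  before \<tau>, hence the continuous path of Pb. The jump of the glued process is therefore
  invisible in the drivers up to and including \<tau>.\<close>

lemma left_limit_glued_P:
  assumes cont: "continuous_on {0..T} (\<lambda>t. Pb i t \<omega>)" and s: "0 < s" "s \<le> T" and \<tau>: "0 \<le> \<tau> \<omega>"
  shows "((\<lambda>u. glued_P \<tau> c Pb i u \<omega>) \<longlongrightarrow> (if ereal s \<le> \<tau> \<omega> then Pb i s \<omega> else cGa c i (real_of_ereal (\<tau> \<omega>)) \<omega>)) (at_left s)"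
    and "left_limit (\<lambda>u. glued_P \<tau> c Pb i u \<omega>) s = (if ereal s \<le> \<tau> \<omega> then Pb i s \<omega> else cGa c i (real_of_ereal (\<tau> \<omega>)) \<omega>)"
proof -
  show lim: "((\<lambda>u. glued_P \<tau> c Pb i u \<omega>) \<longlongrightarrow> (if ereal s \<le> \<tau> \<omega> then Pb i s \<omega> else cGa c i (real_of_ereal (\<tau> \<omega>)) \<omega>)) (at_left s)"
  proof (cases "ereal s \<le> \<tau> \<omega>")
    case True
    have "((\<lambda>t. Pb i t \<omega>) \<longlongrightarrow> Pb i s \<omega>) (at s within {0..T})"
      using cont s unfolding continuous_on_def by auto
    moreover have "at s within {0..s} \<le> at s within {0..T}"
      using s by (intro at_le) auto
    ultimately have "((\<lambda>t. Pb i t \<omega>) \<longlongrightarrow> Pb i s \<omega>) (at_left s)"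
      unfolding at_within_Icc_at_left[OF s(1)] by (rule tendsto_mono[rotated])
    moreover have "eventually (\<lambda>u. Pb i u \<omega> = glued_P \<tau> c Pb i u \<omega>) (at_left s)"
      unfolding eventually_at_filter
    proof (intro always_eventually allI impI)
      fix u assume "u \<noteq> s" "u \<in> {..<s}"
      then have "ereal u < ereal s" by simp
      then have "ereal u < \<tau> \<omega>" using True by (rule less_le_trans)
      then show "Pb i u \<omega> = glued_P \<tau> c Pb i u \<omega>" by (simp add: glued_P_def not_le)
    qed
    ultimately show ?thesis unfolding if_P[OF True] by (rule Lim_transform_eventually)
  next
    case False
    then obtain r where r: "\<tau> \<omega> = ereal r" "r < s" using \<tau> by (cases "\<tau> \<omega>") auto
    have "eventually (\<lambda>u. r < u) (at_left s)" by (rule order_tendstoD(1)[OF tendsto_ident_at r(2)])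
    then have "eventually (\<lambda>u. cGa c i r \<omega> = glued_P \<tau> c Pb i u \<omega>) (at_left s)"
      by eventually_elim (simp add: glued_P_def r)
    from Lim_transform_eventually[OF tendsto_const this] show ?thesis using r by simp
  qed
  then show "left_limit (\<lambda>u. glued_P \<tau> c Pb i u \<omega>) s = (if ereal s \<le> \<tau> \<omega> then Pb i s \<omega> else cGa c i (real_of_ereal (\<tau> \<omega>)) \<omega>)"
    unfolding left_limit_def using s by (simp add: tendsto_Lim)
qed

lemma cadlag_glued_P:
  assumes cont: "continuous_on {0..T} (\<lambda>t. Pb i t \<omega>)" and \<tau>: "0 \<le> \<tau> \<omega>"
  shows "cadlag_on T (\<lambda>t. glued_P \<tau> c Pb i t \<omega>)"
  unfolding cadlag_on_def
proof (intro conjI ballI)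
  fix t assume t: "t \<in> {0..<T}"
  show "((\<lambda>t. glued_P \<tau> c Pb i t \<omega>) \<longlongrightarrow> glued_P \<tau> c Pb i t \<omega>) (at_right t)"
  proof (cases "ereal t < \<tau> \<omega>")
    case True
    have "((\<lambda>t. Pb i t \<omega>) \<longlongrightarrow> Pb i t \<omega>) (at t within {0..T})"
      using cont t unfolding continuous_on_def by auto
    moreover have "at t within {t..T} \<le> at t within {0..T}"
      using t by (intro at_le) auto
    ultimately have "((\<lambda>t. Pb i t \<omega>) \<longlongrightarrow> Pb i t \<omega>) (at_right t)"
      using t at_within_Icc_at_right[of t T] by (simp add: tendsto_mono)
    moreover have "eventually (\<lambda>u. ereal u < \<tau> \<omega>) (at_right t)"
    proof (cases "\<tau> \<omega>")
      case (real r)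
      then have "t < r" using True by simp
      then have "eventually (\<lambda>u. u < r) (at_right t)" by (rule order_tendstoD(2)[OF tendsto_ident_at])
      then show ?thesis by (simp add: real)
    qed (use \<tau> in auto)
    then have "eventually (\<lambda>u. Pb i u \<omega> = glued_P \<tau> c Pb i u \<omega>) (at_right t)"
      by eventually_elim (simp add: glued_P_def not_le)
    ultimately have "((\<lambda>t. glued_P \<tau> c Pb i t \<omega>) \<longlongrightarrow> Pb i t \<omega>) (at_right t)"
      by (rule Lim_transform_eventually)
    moreover have "glued_P \<tau> c Pb i t \<omega> = Pb i t \<omega>" using True by (simp add: glued_P_def not_le)
    ultimately show ?thesis by simp
  next
    case False
    have "eventually (\<lambda>u. glued_P \<tau> c Pb i t \<omega> = glued_P \<tau> c Pb i u \<omega>) (at_right t)"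
      unfolding eventually_at_filter
    proof (intro always_eventually allI impI)
      fix u assume "u \<noteq> t" "u \<in> {t<..}"
      then have "\<tau> \<omega> \<le> ereal t" "ereal t \<le> ereal u" using False by (simp_all add: not_less)
      then have "\<tau> \<omega> \<le> ereal t" "\<tau> \<omega> \<le> ereal u" by (auto intro: order_trans)
      then show "glued_P \<tau> c Pb i t \<omega> = glued_P \<tau> c Pb i u \<omega>" by (simp add: glued_P_def leD)
    qed
    then show ?thesis by (rule Lim_transform_eventually[OF tendsto_const])
  qed
next
  fix t assume "t \<in> {0<..T}"
  then show "\<exists>l. ((\<lambda>t. glued_P \<tau> c Pb i t \<omega>) \<longlongrightarrow> l) (at_left t)"
    using left_limit_glued_P(1)[of T Pb i \<omega> t \<tau> c] cont \<tau> by auto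
qed

text \<open>The correction is cancelled by the compensator part of \<open>U dM\<close>.\<close>

lemma driver_J_glued:
  assumes cont: "\<And>j. continuous_on {0..T} (\<lambda>t. Pb j t \<omega>)" and s: "0 < s" "s \<le> T" "ereal s \<le> \<tau> \<omega>" and \<tau>: "0 \<le> \<tau> \<omega>"
  shows "driver_J c q \<tau> lam (glued_P \<tau> c Pb) (glued_L \<tau> Lb) (glued_U \<tau> c Pb) i \<omega> s =
    driver_B c q lam Pb Lb i \<omega> s - lam s \<omega> * glued_U \<tau> c Pb i s \<omega>"
proof -
  have lG: "intensity_G \<tau> lam s \<omega> = lam s \<omega>" using s by (simp add: intensity_G_def)
  have p: "left_limit (\<lambda>u. glued_P \<tau> c Pb j u \<omega>) s = Pb j s \<omega>" for j
    using left_limit_glued_P(2)[where Pb = Pb and i = j, of T \<omega> s \<tau> c, OF cont[of j] s(1,2) \<tau>] s(3) by simp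
  have L: "glued_L \<tau> Lb i s \<omega> = Lb i s \<omega>" using s by (simp add: glued_L_def)
  have U: "glued_U \<tau> c Pb i s \<omega> = cGa c i s \<omega> - Pb i s \<omega>" using s by (simp add: glued_U_def)
  \<comment> \<open>Writing G for \<open>cGa\<close> and p for Pb, the terms in which the drivers
    differ satisfy \<lambda> G (E + 1)^2 - (2 \<lambda> E + \<lambda>) p = \<lambda> E^2 G + 2
    \<lambda> E (G - p) + \<lambda> (G - p); the last summand is \<lambda> U.\<close>
  show ?thesis
    unfolding driver_J_def driver_B_def Let_def p L U lG N_jump_eq_N_hat[OF lG] R_jump_eq_R_hat[OF lG]
    by (simp add: algebra_simps power2_eq_square)
qed

text \<open>The indefinite Henstock-Kurzweil integral is continuous; passing between half-open and
  closed intervals changes a single point.\<close>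

lemma set_integral_Ioc_continuous:
  fixes f :: "real \<Rightarrow> real"
  assumes f: "set_integrable lborel {0<..T} f" and T: "0 \<le> T"
  shows "continuous_on {0..T} (\<lambda>t. LINT s:{t<..T}|lborel. f s)"
proof -
  have sub: "set_integrable lborel {t<..T} f" if "t \<in> {0..T}" for t
    using f by (rule set_integrable_subset) (use that in auto)
  have "f integrable_on {0<..T}" by (rule set_borel_integral_eq_integral(1)[OF f])
  then have "f integrable_on {0..T}"
    by (rule integrable_spike_set) (auto intro: negligible_subset[OF negligible_sing[of 0]])
  then have "continuous_on {0..T} (\<lambda>t. integral {t..T} f)" by (rule indefinite_integral_continuous_1')
  also have "?this \<longleftrightarrow> ?thesis"
  proof (intro continuous_on_cong refl)
    fix t assume t: "t \<in> {0..T}"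
    have "(LINT s:{t<..T}|lborel. f s) = integral {t<..T} f"
      by (rule set_borel_integral_eq_integral(2)[OF sub[OF t]])
    also have "\<dots> = integral {t..T} f"
      by (rule integral_spike_set) (auto intro: negligible_subset[OF negligible_sing[of t]])
    finally show "integral {t..T} f = (LINT s:{t<..T}|lborel. f s)" ..
  qed
  finally show ?thesis .
qed

lemma set_integral_Ioc_split:
  fixes f :: "real \<Rightarrow> real"
  assumes f: "set_integrable lborel {0<..T} f" and ab: "0 \<le> a" "a \<le> b" "b \<le> T"
  shows "(LINT s:{a<..T}|lborel. f s) = (LINT s:{a<..b}|lborel. f s) + (LINT s:{b<..T}|lborel. f s)"
proof -
  have "{a<..T} = {a<..b} \<union> {b<..T}" using ab by auto
  moreover have "set_integrable lborel {a<..b} f" "set_integrable lborel {b<..T} f"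
    by (rule set_integrable_subset[OF f]; use ab in auto)+
  ultimately show ?thesis by (simp add: set_integral_Un)
qed


section \<open>The solution of the system with jumps\<close>

lemma stopped_stopped: "0 \<le> r \<Longrightarrow> stopped (stopped t r) r = stopped t r"
  by (cases r) (auto simp: stopped_def min_def)

section \<open>Continuity, measurability and bounds of the glued processes\<close>

context default_market
begin

text \<open>A solution is only assumed predictable and essentially bounded; continuity of its paths
  is read off the equation. There are finitely many regimes, so one null set serves all of
  them.\<close>

lemma solution_B_continuous:
  fixes c :: "('l::finite, 'w, 'n, 'm::finite) coefficients"
  assumes T: "0 < T" and sol: "solution_B P W lam T q c Pb Lb"
  shows "AE \<omega> in P. \<forall>i. continuous_on {0..T} (\<lambda>t. Pb i t \<omega>)"
proof -
  have "AE \<omega> in P. continuous_on {0..T} (\<lambda>t. Pb i t \<omega>)" for i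
  proof -
    obtain I where I: "has_ito_integral P \<F> W T (Lb i) I" and
      eq: "AE \<omega> in P. set_integrable lborel {0<..T} (driver_B c q lam Pb Lb i \<omega>) \<and>
         (\<forall>t\<in>{0..T}. Pb i t \<omega> =
            cGb c i \<omega> + (LINT s:{t<..T}|lborel. driver_B c q lam Pb Lb i \<omega> s) - (I T \<omega> - I t \<omega>))"
      using sol unfolding solution_B_def by blast
    have "AE \<omega> in P. continuous_on {0..T} (\<lambda>t. I t \<omega>)"
      using I by (simp add: has_ito_integral_def)
    with eq show ?thesis
    proof eventually_elim
      case (elim \<omega>)
      have "continuous_on {0..T} (\<lambda>t. LINT s:{t<..T}|lborel. driver_B c q lam Pb Lb i \<omega> s)"
        using elim T by (intro set_integral_Ioc_continuous) auto
      then have "continuous_on {0..T} (\<lambda>t. cGb c i \<omega> + (LINT s:{t<..T}|lborel. driver_B c q lam Pb Lb i \<omega> s) - (I T \<omega> - I t \<omega>))"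
        using elim(2) by (intro continuous_intros)
      also have "?this \<longleftrightarrow> ?case"
        by (intro continuous_on_cong) (use elim(1) in auto)
      finally show ?case .
    qed
  qed
  then have "AE \<omega> in P. \<forall>i\<in>UNIV. continuous_on {0..T} (\<lambda>t. Pb i t \<omega>)"
    by (intro AE_finite_allI) auto
  then show ?thesis by simp
qed

text \<open>On \<open>\<tau> = 0\<close> the essential bound on \<open>X\<close> says nothing, but \<open>X 0\<close> is almost surely constant.\<close>

lemma bounded_at_\<tau>:
  fixes X :: "real \<Rightarrow> 'w \<Rightarrow> real"
  assumes T: "0 < T" and X: "bounded_predictable P \<F> T X"
  shows "\<exists>K. AE \<omega> in P. \<tau> \<omega> \<le> ereal T \<longrightarrow> \<bar>X (real_of_ereal (\<tau> \<omega>)) \<omega>\<bar> \<le> K"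
proof -
  have p: "predictable_on P \<F> {0..T} X" using X by (simp add: bounded_predictable_def)
  obtain K where K: "ae_time P T (\<lambda>t \<omega>. norm (X t \<omega>) \<le> K)"
    using X by (auto simp: bounded_predictable_def ess_bounded_def)
  have 1: "AE \<omega> in P. 0 < \<tau> \<omega> \<and> \<tau> \<omega> \<le> ereal T \<longrightarrow> X (real_of_ereal (\<tau> \<omega>)) \<omega> \<in> {-K..K}"
    by (rule ae_time_imp_at_\<tau>[OF T p]) (use K in \<open>simp_all add: abs_le_iff minus_le_iff conj_commute\<close>)
  have "X 0 \<in> borel_measurable (\<F> 0)" by (rule F.predictable_on_section[OF p]) (use T in auto)
  from F0_bounded[OF this] obtain L where L: "AE \<omega> in P. \<bar>X 0 \<omega>\<bar> \<le> L" by blast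
  have "AE \<omega> in P. \<tau> \<omega> \<le> ereal T \<longrightarrow> \<bar>X (real_of_ereal (\<tau> \<omega>)) \<omega>\<bar> \<le> max K L"
    using 1 L AE_space
  proof eventually_elim
    case (elim \<omega>)
    show ?case
    proof (cases "\<tau> \<omega> = 0")
      case True
      then show ?thesis using elim(2) by (simp add: le_max_iff_disj)
    next
      case False
      then have "0 < \<tau> \<omega>" using \<tau>_nonneg[OF elim(3)] by (simp add: less_le)
      then show ?thesis using elim(1) by auto
    qed
  qed
  then show ?thesis by blast
qed

text \<open>On \<tau> \<le> t the value is X along the graph of
  \<open>min t (cut_time T \<omega>)\<close>, and this graph map is measurable from
  \<open>\<G> t\<close> to the predictable \<sigma>-algebra of \<F>: a rectangle starting at s is
  met only if s < t, and then its base is in \<open>\<G> t\<close>.\<close>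

lemma value_at_\<tau>_measurable:
  fixes X :: "real \<Rightarrow> 'w \<Rightarrow> real"
  assumes t: "0 \<le> t" "t \<le> T" and X: "predictable_on P \<F> {0..T} X"
  shows "(\<lambda>\<omega>. X (real_of_ereal (\<tau> \<omega>)) \<omega> * of_bool (\<tau> \<omega> \<le> ereal t)) \<in> borel_measurable (\<G> t)"
proof -
  have T: "0 \<le> T" using t by simp
  have m: "(\<lambda>\<omega>. min t (cut_time T \<omega>)) \<in> borel_measurable (\<G> t)" by (rule min_cut_time_measurable[OF T t(1)])
  have graph: "(\<lambda>\<omega>. (min t (cut_time T \<omega>), \<omega>)) \<in> measurable (\<G> t) (predictable_algebra P \<F>)"
  proof (rule F.measurable_predictableI)
    show "(min t (cut_time T \<omega>), \<omega>) \<in> {0..} \<times> space P" if "\<omega> \<in> space (\<G> t)" for \<omega>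
      using that t cut_time_bounds[OF T] by (simp add: space_G)
    fix A assume "A \<in> sets (\<F> 0)"
    then have A: "A \<in> sets (\<G> t)" using F_G[of 0] G_mono[OF t(1)] by blast
    have "(\<lambda>\<omega>. (min t (cut_time T \<omega>), \<omega>)) -` ({0} \<times> A) \<inter> space (\<G> t) =
        ((\<lambda>\<omega>. min t (cut_time T \<omega>)) -` {0} \<inter> space (\<G> t)) \<inter> A"
      using sets.sets_into_space[OF A] by auto
    also have "\<dots> \<in> sets (\<G> t)" by (intro sets.Int measurable_sets[OF m] A) simp
    finally show "(\<lambda>\<omega>. (min t (cut_time T \<omega>), \<omega>)) -` ({0} \<times> A) \<inter> space (\<G> t) \<in> sets (\<G> t)" .
  next
    fix s u A assume *: "0 \<le> s" "s \<le> u" "A \<in> sets (\<F> s)"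
    show "(\<lambda>\<omega>. (min t (cut_time T \<omega>), \<omega>)) -` ({s<..u} \<times> A) \<inter> space (\<G> t) \<in> sets (\<G> t)"
    proof (cases "s < t")
      case True
      then have A: "A \<in> sets (\<G> t)" using F_G[of s] G_mono[of s t] *(3) by auto
      have "(\<lambda>\<omega>. (min t (cut_time T \<omega>), \<omega>)) -` ({s<..u} \<times> A) \<inter> space (\<G> t) =
          ((\<lambda>\<omega>. min t (cut_time T \<omega>)) -` {s<..u} \<inter> space (\<G> t)) \<inter> A"
        using sets.sets_into_space[OF A] by auto
      also have "\<dots> \<in> sets (\<G> t)" by (intro sets.Int measurable_sets[OF m] A) simp
      finally show ?thesis .
    next
      case False
      then have "(\<lambda>\<omega>. (min t (cut_time T \<omega>), \<omega>)) -` ({s<..u} \<times> A) \<inter> space (\<G> t) = {}" by auto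
      then show ?thesis by (simp only: sets.empty_sets)
    qed
  qed
  have "(\<lambda>\<omega>. (min t (cut_time T \<omega>), \<omega>)) \<in> measurable (\<G> t) (restrict_space (predictable_algebra P \<F>) ({0..T} \<times> space P))"
    by (rule measurable_restrict_space2[OF _ graph]) (use t cut_time_bounds[OF T] in \<open>auto simp: space_G min_le_iff_disj\<close>)
  from measurable_compose[OF this X[unfolded predictable_on_def]]
  have [measurable]: "(\<lambda>\<omega>. X (min t (cut_time T \<omega>)) \<omega>) \<in> borel_measurable (\<G> t)" by simp
  have [measurable]: "Measurable.pred (\<G> t) (\<lambda>\<omega>. \<tau> \<omega> \<le> ereal t)"
    using \<tau>_stopping[OF t(1)] by (simp add: pred_def space_G)
  have "(\<lambda>\<omega>. X (min t (cut_time T \<omega>)) \<omega> * of_bool (\<tau> \<omega> \<le> ereal t)) \<in> borel_measurable (\<G> t)"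
    by measurable
  also have "?this \<longleftrightarrow> ?thesis"
  proof (intro measurable_cong)
    fix \<omega> assume "\<omega> \<in> space (\<G> t)"
    then have \<omega>: "\<omega> \<in> space P" by (simp add: space_G)
    show "X (min t (cut_time T \<omega>)) \<omega> * of_bool (\<tau> \<omega> \<le> ereal t) = X (real_of_ereal (\<tau> \<omega>)) \<omega> * of_bool (\<tau> \<omega> \<le> ereal t)"
    proof (cases "\<tau> \<omega> \<le> ereal t")
      case True
      then have "min t (cut_time T \<omega>) = real_of_ereal (\<tau> \<omega>)"
        using \<tau>_nonneg[OF \<omega>] t by (cases "\<tau> \<omega>") (auto simp: cut_time_def stopped_def min_def)
      then show ?thesis by simp
    qed simp
  qed
  finally show ?thesis .
qed

lemma glued_U_bounded_predictable:
  fixes c :: "('l, 'w, 'n, 'm::finite) coefficients"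
  assumes Ga: "bounded_predictable P \<F> T (cGa c i)" and Pb: "bounded_predictable P \<F> T (Pb i)"
  shows "bounded_predictable P \<G> T (glued_U \<tau> c Pb i)"
  unfolding bounded_predictable_def
proof
  let ?M = "restrict_space (predictable_algebra P \<G>) ({0..T} \<times> space P)"
  have [measurable]: "(\<lambda>x. cGa c i (fst x) (snd x)) \<in> borel_measurable ?M" "(\<lambda>x. Pb i (fst x) (snd x)) \<in> borel_measurable ?M"
  proof -
    have "predictable_on P \<G> {0..T} (cGa c i)" "predictable_on P \<G> {0..T} (Pb i)"
      by (rule predictable_F_G; use Ga Pb in \<open>simp only: bounded_predictable_def\<close>)+
    then show "(\<lambda>x. cGa c i (fst x) (snd x)) \<in> borel_measurable ?M" "(\<lambda>x. Pb i (fst x) (snd x)) \<in> borel_measurable ?M"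
      unfolding predictable_on_def case_prod_beta' .
  qed
  have [measurable]: "Measurable.pred ?M (\<lambda>x. ereal (fst x) \<le> \<tau> (snd x))"
    by (rule measurable_restrict_space1[OF G.predictable_before[OF \<tau>_stopping \<tau>_nonneg]])
  show "predictable_on P \<G> {0..T} (glued_U \<tau> c Pb i)"
    unfolding predictable_on_def case_prod_beta' glued_U_def by measurable
  obtain K L where "ae_time P T (\<lambda>t \<omega>. norm (cGa c i t \<omega>) \<le> K)" "ae_time P T (\<lambda>t \<omega>. norm (Pb i t \<omega>) \<le> L)"
    using Ga Pb by (auto simp: bounded_predictable_def ess_bounded_def)
  then have "ae_time P T (\<lambda>t \<omega>. norm (glued_U \<tau> c Pb i t \<omega>) \<le> K + L)"
    by (rule ae_time_imp) (auto simp: glued_U_def)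
  then show "ess_bounded P T (glued_U \<tau> c Pb i)" unfolding ess_bounded_def by blast
qed

lemma glued_P_adapted:
  fixes c :: "('l, 'w, 'n, 'm::finite) coefficients"
  assumes Ga: "predictable_on P \<F> {0..T} (cGa c i)" and Pb: "predictable_on P \<F> {0..T} (Pb i)"
  shows "adapted_on \<G> {0..T} (glued_P \<tau> c Pb i)"
  unfolding adapted_on_def
proof
  fix t assume t: "t \<in> {0..T}"
  then have t': "0 \<le> t" "t \<le> T" by auto
  have [measurable]: "Pb i t \<in> borel_measurable (\<G> t)"
    by (rule measurable_F_G[OF F.predictable_on_section[OF Pb t t'(1)]])
  have [measurable]: "Measurable.pred (\<G> t) (\<lambda>\<omega>. \<tau> \<omega> \<le> ereal t)"
    using \<tau>_stopping[OF t'(1)] by (simp add: pred_def space_G)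
  have "(\<lambda>\<omega>. Pb i t \<omega> * of_bool (\<not> \<tau> \<omega> \<le> ereal t)) \<in> borel_measurable (\<G> t)"
    by measurable
  from borel_measurable_add[OF this value_at_\<tau>_measurable[OF t' Ga]]
  show "glued_P \<tau> c Pb i t \<in> borel_measurable (\<G> t)"
    by (simp add: glued_P_def[abs_def] not_le)
qed

lemma glued_P_ess_bounded:
  fixes c :: "('l, 'w, 'n, 'm::finite) coefficients"
  assumes T: "0 < T" and Ga: "bounded_predictable P \<F> T (cGa c i)" and Pb: "ess_bounded P T (Pb i)"
  shows "ess_bounded P T (glued_P \<tau> c Pb i)"
proof -
  obtain K where K: "AE \<omega> in P. \<tau> \<omega> \<le> ereal T \<longrightarrow> \<bar>cGa c i (real_of_ereal (\<tau> \<omega>)) \<omega>\<bar> \<le> K"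
    using bounded_at_\<tau>[OF T Ga] by blast
  obtain L where L: "ae_time P T (\<lambda>t \<omega>. norm (Pb i t \<omega>) \<le> L)" using Pb by (auto simp: ess_bounded_def)
  have "ae_time P T (\<lambda>t \<omega>. \<tau> \<omega> \<le> ereal t \<longrightarrow> \<bar>cGa c i (real_of_ereal (\<tau> \<omega>)) \<omega>\<bar> \<le> K)"
  proof (rule ae_timeI)
    show "AE \<omega> in P. \<forall>t\<in>{0<..T}. \<tau> \<omega> \<le> ereal t \<longrightarrow> \<bar>cGa c i (real_of_ereal (\<tau> \<omega>)) \<omega>\<bar> \<le> K"
      using K
    proof eventually_elim
      case (elim \<omega>)
      have "\<tau> \<omega> \<le> ereal T" if "\<tau> \<omega> \<le> ereal t" "t \<in> {0<..T}" for t
        using that(1) by (rule order_trans) (use that(2) in simp)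
      then show ?case using elim by blast
    qed
  qed
  then have "ae_time P T (\<lambda>t \<omega>. norm (glued_P \<tau> c Pb i t \<omega>) \<le> max K L)"
    by (rule ae_time_imp[OF L]) (auto simp: glued_P_def not_le[symmetric])
  then show ?thesis unfolding ess_bounded_def by blast
qed

text \<open>The equation is checked path by path, outside the null sets where (B), the continuity of
  some Pb, or the bound on U for almost every time fails. Only increments of I between
  \<open>stopped t (\<tau> \<omega>)\<close> and \<open>stopped T (\<tau> \<omega>)\<close> enter,
  and these are the same for I and for the stopped integral.\<close>

theorem solution_J_glued:
  fixes c :: "('l::finite, 'w, 'n, 'm::finite) coefficients"
  assumes T: "0 < T" and coeffs: "admissible_coefficients P \<F> T c" and sol: "solution_B P W lam T q c Pb Lb"
  shows "solution_J P W \<tau> lam T q c (glued_P \<tau> c Pb) (glued_L \<tau> Lb) (glued_U \<tau> c Pb)"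
  unfolding solution_J_def
proof (intro allI conjI)
  fix i
  have T0: "0 \<le> T" using T by simp
  have Ga: "bounded_predictable P \<F> T (cGa c i)" using coeffs by (simp add: admissible_coefficients_def)
  have Pb: "bounded_predictable P \<F> T (Pb i)" using sol by (simp add: solution_B_def)
  note cont = solution_B_continuous[OF T sol]
  show "AE \<omega> in P. cadlag_on T (\<lambda>t. glued_P \<tau> c Pb i t \<omega>)"
    using cont AE_space
    by eventually_elim (intro cadlag_glued_P \<tau>_nonneg, auto)
  show "adapted_on \<G> {0..T} (glued_P \<tau> c Pb i)"
    using Ga Pb by (intro glued_P_adapted) (simp_all add: bounded_predictable_def)
  show "ess_bounded P T (glued_P \<tau> c Pb i)"
    using Pb by (intro glued_P_ess_bounded T Ga) (simp add: bounded_predictable_def)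
  obtain I where I: "has_ito_integral P \<F> W T (Lb i) I" and
    eq: "AE \<omega> in P. set_integrable lborel {0<..T} (driver_B c q lam Pb Lb i \<omega>) \<and>
       (\<forall>t\<in>{0..T}. Pb i t \<omega> =
          cGb c i \<omega> + (LINT s:{t<..T}|lborel. driver_B c q lam Pb Lb i \<omega> s) - (I T \<omega> - I t \<omega>))"
    using sol unfolding solution_B_def by blast
  have ito: "has_ito_integral P \<G> W T (glued_L \<tau> Lb i) (\<lambda>t \<omega>. I (stopped t (\<tau> \<omega>)) \<omega>)"
    unfolding glued_L_def[abs_def] by (rule has_ito_integral_stopped[OF T I])
  then show "predictable_on P \<G> {0..T} (glued_L \<tau> Lb i)" "L2_norm2 P T (glued_L \<tau> Lb i) < \<infinity>"
    by (simp_all add: has_ito_integral_def)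
  show U: "bounded_predictable P \<G> T (glued_U \<tau> c Pb i)" by (rule glued_U_bounded_predictable[where Pb = Pb, OF Ga Pb])
  then obtain B where B: "ae_time P T (\<lambda>t \<omega>. norm (glued_U \<tau> c Pb i t \<omega>) \<le> B)"
    and Up: "predictable_on P \<G> {0..T} (glued_U \<tau> c Pb i)"
    by (auto simp: bounded_predictable_def ess_bounded_def)
  show "\<exists>I. has_ito_integral P \<G> W T (glued_L \<tau> Lb i) I \<and>
       (AE \<omega> in P. set_integrable lborel {0<..stopped T (\<tau> \<omega>)} (driver_J c q \<tau> lam (glued_P \<tau> c Pb) (glued_L \<tau> Lb) (glued_U \<tau> c Pb) i \<omega>) \<and>
         M_integrable \<tau> lam (glued_U \<tau> c Pb i) 0 (stopped T (\<tau> \<omega>)) \<omega> \<and>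
         (\<forall>t\<in>{0..T}. glued_P \<tau> c Pb i t \<omega> =
            terminal \<tau> T c i \<omega>
            + (LINT s:{stopped t (\<tau> \<omega>)<..stopped T (\<tau> \<omega>)}|lborel. driver_J c q \<tau> lam (glued_P \<tau> c Pb) (glued_L \<tau> Lb) (glued_U \<tau> c Pb) i \<omega> s)
            - (I (stopped T (\<tau> \<omega>)) \<omega> - I (stopped t (\<tau> \<omega>)) \<omega>)
            - M_integral \<tau> lam (glued_U \<tau> c Pb i) (stopped t (\<tau> \<omega>)) (stopped T (\<tau> \<omega>)) \<omega>))"
  \<comment> \<open>The witness is itself stopped, so the times in the equation are stopped twice;
    \<open>stopped_stopped\<close> undoes this.\<close>
  proof (intro exI[of _ "\<lambda>t \<omega>. I (stopped t (\<tau> \<omega>)) \<omega>"] conjI ito)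
    show "AE \<omega> in P. set_integrable lborel {0<..stopped T (\<tau> \<omega>)} (driver_J c q \<tau> lam (glued_P \<tau> c Pb) (glued_L \<tau> Lb) (glued_U \<tau> c Pb) i \<omega>) \<and>
         M_integrable \<tau> lam (glued_U \<tau> c Pb i) 0 (stopped T (\<tau> \<omega>)) \<omega> \<and>
         (\<forall>t\<in>{0..T}. glued_P \<tau> c Pb i t \<omega> =
            terminal \<tau> T c i \<omega>
            + (LINT s:{stopped t (\<tau> \<omega>)<..stopped T (\<tau> \<omega>)}|lborel. driver_J c q \<tau> lam (glued_P \<tau> c Pb) (glued_L \<tau> Lb) (glued_U \<tau> c Pb) i \<omega> s)
            - (I (stopped (stopped T (\<tau> \<omega>)) (\<tau> \<omega>)) \<omega> - I (stopped (stopped t (\<tau> \<omega>)) (\<tau> \<omega>)) \<omega>)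
            - M_integral \<tau> lam (glued_U \<tau> c Pb i) (stopped t (\<tau> \<omega>)) (stopped T (\<tau> \<omega>)) \<omega>)"
      using cont eq ae_time_path[OF B] AE_space
    proof eventually_elim
      case (elim \<omega>)
      note \<omega> = elim(4)
      have \<tau>0: "0 \<le> \<tau> \<omega>" by (rule \<tau>_nonneg[OF \<omega>])
      define b where "b = stopped T (\<tau> \<omega>)"
      let ?D = "driver_B c q lam Pb Lb i \<omega>" and ?U = "glued_U \<tau> c Pb i"
        and ?J = "driver_J c q \<tau> lam (glued_P \<tau> c Pb) (glued_L \<tau> Lb) (glued_U \<tau> c Pb) i \<omega>"
      have b: "0 \<le> b" "b \<le> T" and b\<tau>: "ereal s \<le> \<tau> \<omega>" if "s \<le> b" for s
        using stopped_nonneg[OF \<tau>0 T0] le_stopped_iff[OF \<tau>0, of b T] le_stopped_iff[OF \<tau>0, of s T] that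
        by (auto simp: b_def)
      note b = b[OF order_refl]
      have Um: "(\<lambda>s. indicator {0..T} s *\<^sub>R ?U s \<omega>) \<in> borel_measurable borel"
        by (rule G.predictable_on_path[OF Up G.predictable_strip _ _ \<omega>]) auto
      have UB: "AE s in lborel. s \<in> {0..T} \<longrightarrow> \<bar>?U s \<omega>\<bar> \<le> B"
        using elim(3) by simp
      note lamU = lam_set_integrable[where U = ?U, OF \<omega> T0 Um UB] and MI = M_integrableI[where U = ?U, OF \<omega> T0 Um UB] and ME = M_integral_eq[where U = ?U, OF \<omega> T0 Um UB]
      have D: "set_integrable lborel {0<..T} ?D" using elim(2) by blast
      have Dab: "set_integrable lborel {a<..b} ?D" if "0 \<le> a" for a
        by (rule set_integrable_subset[OF D]) (use that b in auto)
      have J: "?J s = ?D s - lam s \<omega> * ?U s \<omega>" if "s \<in> {0<..b}" for s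
        by (rule driver_J_glued[where T = T]) (use that b b\<tau> \<tau>0 elim(1) in auto)
      have Ji: "set_integrable lborel {0<..b} ?J"
      proof -
        have "set_integrable lborel {0<..b} (\<lambda>s. ?D s - lam s \<omega> * ?U s \<omega>)"
          by (intro set_integral_diff(1) Dab lamU) (simp_all add: b_def)
        also have "?this \<longleftrightarrow> ?thesis"
          by (rule set_integrable_cong) (simp_all add: J)
        finally show ?thesis .
      qed
      have Je: "(LINT s:{a<..b}|lborel. ?J s) = (LINT s:{a<..b}|lborel. ?D s) - (LINT s:{a<..b}|lborel. lam s \<omega> * ?U s \<omega>)"
        if "0 \<le> a" for a
      proof -
        have "(LINT s:{a<..b}|lborel. ?J s) = (LINT s:{a<..b}|lborel. ?D s - lam s \<omega> * ?U s \<omega>)"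
          by (rule set_lebesgue_integral_cong) (use that J in auto)
        also have "\<dots> = (LINT s:{a<..b}|lborel. ?D s) - (LINT s:{a<..b}|lborel. lam s \<omega> * ?U s \<omega>)"
          by (rule set_integral_diff(2)[OF Dab[OF that] lamU[OF that]]) (simp add: b_def)
        finally show ?thesis .
      qed
      have main: "glued_P \<tau> c Pb i t \<omega> = terminal \<tau> T c i \<omega> + (LINT s:{stopped t (\<tau> \<omega>)<..b}|lborel. ?J s)
          - (I (stopped b (\<tau> \<omega>)) \<omega> - I (stopped (stopped t (\<tau> \<omega>)) (\<tau> \<omega>)) \<omega>) - M_integral \<tau> lam ?U (stopped t (\<tau> \<omega>)) b \<omega>"
        if t: "t \<in> {0..T}" for t
      proof -
        define a where "a = stopped t (\<tau> \<omega>)"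
        have a: "0 \<le> a" using stopped_nonneg[OF \<tau>0] t by (simp add: a_def)
        have Pbt: "Pb i u \<omega> = cGb c i \<omega> + (LINT s:{u<..T}|lborel. ?D s) - (I T \<omega> - I u \<omega>)" if "u \<in> {0..T}" for u
          using elim(2) that by blast
        have ss: "stopped a (\<tau> \<omega>) = a" "stopped b (\<tau> \<omega>) = b"
          by (simp_all add: a_def b_def stopped_stopped[OF \<tau>0])
        \<comment> \<open>The integral of \<lambda> U enters negatively through the driver of (J)
          and positively through the compensator in -M; what is left is the driver of (B) and the
          jump at \<tau>.\<close>
        have rhs: "terminal \<tau> T c i \<omega> + (LINT s:{a<..b}|lborel. ?J s)
          - (I (stopped b (\<tau> \<omega>)) \<omega> - I (stopped a (\<tau> \<omega>)) \<omega>) - M_integral \<tau> lam ?U a b \<omega> =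
          terminal \<tau> T c i \<omega> + (LINT s:{a<..b}|lborel. ?D s) - (I b \<omega> - I a \<omega>) -
          (if ereal a < \<tau> \<omega> \<and> \<tau> \<omega> \<le> ereal b then ?U (real_of_ereal (\<tau> \<omega>)) \<omega> else 0)"
          unfolding ss using Je[OF a] ME[OF a, of b] by (simp add: b_def)
        have "glued_P \<tau> c Pb i t \<omega> = terminal \<tau> T c i \<omega> + (LINT s:{a<..b}|lborel. ?D s) - (I b \<omega> - I a \<omega>) -
          (if ereal a < \<tau> \<omega> \<and> \<tau> \<omega> \<le> ereal b then ?U (real_of_ereal (\<tau> \<omega>)) \<omega> else 0)"
        \<comment> \<open>After \<tau>, a = b = \<tau>: the intervals are empty, and the strict
          inequality a < \<tau> keeps the jump from being counted again. If t < \<tau> \<le> T,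
          subtracting the jump turns the terminal value \<open>cGa\<close> at \<tau> into Pb at
          \<tau>, and (B) at t and at \<tau> gives the rest. If \<tau> > T, the claim is (B) on (t,
          T].\<close>
        proof (cases "\<tau> \<omega> \<le> ereal t")
          case True
          then obtain r where r: "\<tau> \<omega> = ereal r" "r \<le> t" using \<tau>0 by (cases "\<tau> \<omega>") auto
          then have "a = r" "b = r" using t by (auto simp: a_def b_def stopped_def min_def)
          then show ?thesis using r t by (simp add: glued_P_def terminal_def set_lebesgue_integral_def)
        next
          case False
          then have at: "a = t" using \<tau>0 by (cases "\<tau> \<omega>") (auto simp: a_def stopped_def min_def)
          have gP: "glued_P \<tau> c Pb i t \<omega> = Pb i t \<omega>" using False by (simp add: glued_P_def not_le)
          show ?thesis
          proof (cases "\<tau> \<omega> \<le> ereal T")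
            case True
            then obtain r where r: "\<tau> \<omega> = ereal r" "t < r" "r \<le> T" using \<tau>0 False by (cases "\<tau> \<omega>") auto
            then have br: "b = r" by (auto simp: b_def stopped_def min_def)
            have "terminal \<tau> T c i \<omega> = cGa c i r \<omega>" "?U r \<omega> = cGa c i r \<omega> - Pb i r \<omega>"
              using r by (simp_all add: terminal_def glued_U_def)
            moreover have "(LINT s:{t<..T}|lborel. ?D s) = (LINT s:{t<..r}|lborel. ?D s) + (LINT s:{r<..T}|lborel. ?D s)"
              by (rule set_integral_Ioc_split[OF D]) (use r t in auto)
            ultimately show ?thesis
              unfolding gP at br using Pbt[OF t] Pbt[of r] r t by simp
          next
            case False
            then have bT: "b = T" using \<tau>0 by (cases "\<tau> \<omega>") (auto simp: b_def stopped_def min_def)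
            have "terminal \<tau> T c i \<omega> = cGb c i \<omega>" using False by (simp add: terminal_def not_le)
            then show ?thesis unfolding gP at bT using Pbt[OF t] False by simp
          qed
        qed
        then show ?thesis using rhs unfolding a_def by simp
      qed
      show ?case
        using Ji MI[of 0 b] main unfolding b_def by auto
    qed
  qed
  have 1: "ae_time P T (\<lambda>s \<omega>. 0 < s \<and> (ereal s \<le> \<tau> \<omega> \<longrightarrow> left_limit (\<lambda>u. glued_P \<tau> c Pb i u \<omega>) s = Pb i s \<omega>))"
  proof (rule ae_timeI)
    show "AE \<omega> in P. \<forall>s\<in>{0<..T}. 0 < s \<and> (ereal s \<le> \<tau> \<omega> \<longrightarrow> left_limit (\<lambda>u. glued_P \<tau> c Pb i u \<omega>) s = Pb i s \<omega>)"
      using cont AE_space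
    proof eventually_elim
      case (elim \<omega>)
      show ?case
        using left_limit_glued_P(2)[of T Pb i \<omega> _ \<tau> c] elim(1) \<tau>_nonneg[OF elim(2)] by auto
    qed
  qed
  have 2: "ae_time P T (\<lambda>s \<omega>. pos_def (R_hat c lam i s \<omega> (Pb i s \<omega>)))"
    using sol by (simp add: solution_B_def)
  show "ae_time P T (\<lambda>s \<omega>. ereal s \<le> \<tau> \<omega> \<longrightarrow>
       pos_def (R_jump c \<tau> lam i s \<omega> (left_limit (\<lambda>u. glued_P \<tau> c Pb i u \<omega>) s) (glued_U \<tau> c Pb i s \<omega>)))"
  proof (rule ae_time_imp[OF 1 2])
    fix s \<omega>
    assume l: "0 < s \<and> (ereal s \<le> \<tau> \<omega> \<longrightarrow> left_limit (\<lambda>u. glued_P \<tau> c Pb i u \<omega>) s = Pb i s \<omega>)"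
      and pd: "pos_def (R_hat c lam i s \<omega> (Pb i s \<omega>))"
    show "ereal s \<le> \<tau> \<omega> \<longrightarrow>
       pos_def (R_jump c \<tau> lam i s \<omega> (left_limit (\<lambda>u. glued_P \<tau> c Pb i u \<omega>) s) (glued_U \<tau> c Pb i s \<omega>))"
    proof
      assume s: "ereal s \<le> \<tau> \<omega>"
      then have "glued_U \<tau> c Pb i s \<omega> = cGa c i s \<omega> - Pb i s \<omega>" "intensity_G \<tau> lam s \<omega> = lam s \<omega>"
        by (simp_all add: glued_U_def intensity_G_def)
      then show "pos_def (R_jump c \<tau> lam i s \<omega> (left_limit (\<lambda>u. glued_P \<tau> c Pb i u \<omega>) s) (glued_U \<tau> c Pb i s \<omega>))"
        using l s pd by (simp add: R_jump_eq_R_hat)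
    qed
  qed
qed

section \<open>Sign conditions in the three cases\<close>

lemma glued_P_ge:
  assumes "AE \<omega> in P. \<forall>t\<in>{0..T}. k \<le> Pb i t \<omega>"
    and "AE \<omega> in P. \<tau> \<omega> \<le> ereal T \<longrightarrow> k \<le> cGa c i (real_of_ereal (\<tau> \<omega>)) \<omega>"
  shows "AE \<omega> in P. \<forall>t\<in>{0..T}. k \<le> glued_P \<tau> c Pb i t \<omega>"
  using assms
proof eventually_elim
  case (elim \<omega>)
  show ?case
  proof
    fix t assume t: "t \<in> {0..T}"
    show "k \<le> glued_P \<tau> c Pb i t \<omega>"
    proof (cases "\<tau> \<omega> \<le> ereal t")
      case True
      have "ereal t \<le> ereal T" using t by simp
      with True have "\<tau> \<omega> \<le> ereal T" by (rule order_trans)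
      then show ?thesis using elim(2) True by (simp add: glued_P_def leD)
    next
      case False
      then have "glued_P \<tau> c Pb i t \<omega> = Pb i t \<omega>" by (simp add: glued_P_def not_le)
      then show ?thesis using elim(1) t by simp
    qed
  qed
qed

text \<open>On \<tau> \<le> T the terminal value is \<open>cGa\<close> at \<tau> itself, so an
  almost sure bound on it transfers directly, \<tau> = 0 included.\<close>

lemma terminal_ge_imp:
  assumes "AE \<omega> in P. k \<le> terminal \<tau> T c i \<omega>"
  shows "AE \<omega> in P. \<tau> \<omega> \<le> ereal T \<longrightarrow> k \<le> cGa c i (real_of_ereal (\<tau> \<omega>)) \<omega>"
  using assms
proof eventually_elim
  case (elim \<omega>)
  show ?case
  proof
    assume "\<tau> \<omega> \<le> ereal T"
    then show "k \<le> cGa c i (real_of_ereal (\<tau> \<omega>)) \<omega>" using elim by (simp add: terminal_def leD)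
  qed
qed

text \<open>In contrast to a bound on the terminal value, a bound almost everywhere in time has to
  be moved to \<tau>: predictability does this for \<tau> > 0, and the value at time 0 is covered by
  the separate assumption.\<close>

lemma cGa_ge_imp:
  assumes T: "0 < T" and Ga: "predictable_on P \<F> {0..T} (cGa c i)"
    and ge: "ae_time P T (\<lambda>t \<omega>. k \<le> cGa c i t \<omega>)" and 0: "AE \<omega> in P. \<tau> \<omega> = 0 \<longrightarrow> k \<le> cGa c i 0 \<omega>"
  shows "AE \<omega> in P. \<tau> \<omega> \<le> ereal T \<longrightarrow> k \<le> cGa c i (real_of_ereal (\<tau> \<omega>)) \<omega>"
proof -
  have "AE \<omega> in P. 0 < \<tau> \<omega> \<and> \<tau> \<omega> \<le> ereal T \<longrightarrow> cGa c i (real_of_ereal (\<tau> \<omega>)) \<omega> \<in> {k..}"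
    by (rule ae_time_imp_at_\<tau>[OF T Ga]) (use ge in simp_all)
  with 0 AE_space show ?thesis
  proof eventually_elim
    case (elim \<omega>)
    show ?case
    proof (cases "\<tau> \<omega> = 0")
      case True
      then show ?thesis using elim by simp
    next
      case False
      then have "0 < \<tau> \<omega>" using \<tau>_nonneg[OF elim(2)] by (simp add: less_le)
      then show ?thesis using elim by simp
    qed
  qed
qed

text \<open>Up to \<tau> the sum is Pb + (\<open>cGa\<close> - Pb) = \<open>cGa\<close>, bounded
  almost everywhere in time; after \<tau>, U vanishes and the left limit is \<open>cGa\<close> at
  \<tau>. Each of the two bounds on \<open>cGa\<close> serves one side of \<tau>.\<close>

lemma left_limit_plus_glued_U_ge:
  fixes c :: "('l::finite, 'w, 'n, 'm::finite) coefficients"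
  assumes T: "0 < T" and sol: "solution_B P W lam T q c Pb Lb"
    and ge: "ae_time P T (\<lambda>t \<omega>. k \<le> cGa c i t \<omega>)"
    and ge_\<tau>: "AE \<omega> in P. \<tau> \<omega> \<le> ereal T \<longrightarrow> k \<le> cGa c i (real_of_ereal (\<tau> \<omega>)) \<omega>"
  shows "ae_time P T (\<lambda>t \<omega>. k \<le> left_limit (\<lambda>u. glued_P \<tau> c Pb i u \<omega>) t + glued_U \<tau> c Pb i t \<omega>)"
proof -
  have "ae_time P T (\<lambda>t \<omega>. (ereal t \<le> \<tau> \<omega> \<longrightarrow> left_limit (\<lambda>u. glued_P \<tau> c Pb i u \<omega>) t = Pb i t \<omega>) \<and>
    (\<not> ereal t \<le> \<tau> \<omega> \<longrightarrow> k \<le> left_limit (\<lambda>u. glued_P \<tau> c Pb i u \<omega>) t))"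
  proof (rule ae_timeI)
    show "AE \<omega> in P. \<forall>t\<in>{0<..T}. (ereal t \<le> \<tau> \<omega> \<longrightarrow> left_limit (\<lambda>u. glued_P \<tau> c Pb i u \<omega>) t = Pb i t \<omega>) \<and>
      (\<not> ereal t \<le> \<tau> \<omega> \<longrightarrow> k \<le> left_limit (\<lambda>u. glued_P \<tau> c Pb i u \<omega>) t)"
      using solution_B_continuous[OF T sol] ge_\<tau> AE_space
    proof eventually_elim
      case (elim \<omega>)
      show ?case
      proof
        fix t assume t: "t \<in> {0<..T}"
        have ll: "left_limit (\<lambda>u. glued_P \<tau> c Pb i u \<omega>) t = (if ereal t \<le> \<tau> \<omega> then Pb i t \<omega> else cGa c i (real_of_ereal (\<tau> \<omega>)) \<omega>)"
          by (rule left_limit_glued_P(2)[of T]) (use elim(1) t \<tau>_nonneg[OF elim(3)] in auto)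
        have "\<tau> \<omega> \<le> ereal T" if "\<not> ereal t \<le> \<tau> \<omega>"
        proof -
          have "\<tau> \<omega> \<le> ereal t" using that by (simp add: less_imp_le not_le)
          also have "ereal t \<le> ereal T" using t by simp
          finally show ?thesis .
        qed
        then show "(ereal t \<le> \<tau> \<omega> \<longrightarrow> left_limit (\<lambda>u. glued_P \<tau> c Pb i u \<omega>) t = Pb i t \<omega>) \<and>
          (\<not> ereal t \<le> \<tau> \<omega> \<longrightarrow> k \<le> left_limit (\<lambda>u. glued_P \<tau> c Pb i u \<omega>) t)"
          using elim(2) ll by simp
      qed
    qed
  qed
  then show ?thesis
    by (rule ae_time_imp[OF ge]) (auto simp: glued_U_def)
qed

end

theorem theorem3p8:
  fixes P :: "'w measure" and W :: "real \<Rightarrow> 'w \<Rightarrow> real ^ 'n" and \<tau> :: "'w \<Rightarrow> ereal"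
    and lam :: "real \<Rightarrow> 'w \<Rightarrow> real" and T :: real
    and q :: "'l::finite \<Rightarrow> 'l \<Rightarrow> real"
    and c :: "('l, 'w, 'n::finite, 'm::finite) coefficients"
    and Pb :: "'l \<Rightarrow> real \<Rightarrow> 'w \<Rightarrow> real" and Lb :: "'l \<Rightarrow> real \<Rightarrow> 'w \<Rightarrow> real ^ 'n"
  assumes setting: "default_setting P W \<tau> lam"
    and T: "0 < T"
    and q: "generator_matrix q"
    and coeffs: "admissible_coefficients P (filt_F P W) T c"
    and sol: "solution_B P W lam T q c Pb Lb"
  shows
    "(standard_case P \<tau> T c \<and> nonnegative_family P T Pb \<longrightarrow>
        solution_J P W \<tau> lam T q c (glued_P \<tau> c Pb) (glued_L \<tau> Lb) (glued_U \<tau> c Pb) \<and>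
        nonnegative_family P T (glued_P \<tau> c Pb)) \<and>
     (singular_case_I P \<tau> T c \<and> uniformly_positive_family P T Pb \<longrightarrow>
        solution_J P W \<tau> lam T q c (glued_P \<tau> c Pb) (glued_L \<tau> Lb) (glued_U \<tau> c Pb) \<and>
        uniformly_positive_family P T (glued_P \<tau> c Pb)) \<and>
     (singular_case_II P \<tau> lam T c \<and> nonnegative_family P T Pb \<longrightarrow>
        solution_J P W \<tau> lam T q c (glued_P \<tau> c Pb) (glued_L \<tau> Lb) (glued_U \<tau> c Pb) \<and>
        positive_family P T (glued_P \<tau> c Pb) (glued_U \<tau> c Pb))"
proof -
  interpret default_market P W \<tau> lam by unfold_locales (rule setting)
  have J: "solution_J P W \<tau> lam T q c (glued_P \<tau> c Pb) (glued_L \<tau> Lb) (glued_U \<tau> c Pb)"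
    by (rule solution_J_glued[OF T coeffs sol])
  have Ga: "predictable_on P \<F> {0..T} (cGa c i)" for i
    using coeffs by (simp add: admissible_coefficients_def bounded_predictable_def)
  show ?thesis
  proof (intro conjI impI J; elim conjE)
    assume "standard_case P \<tau> T c" and Pb: "nonnegative_family P T Pb"
    then have G: "AE \<omega> in P. 0 \<le> terminal \<tau> T c i \<omega>" for i
      unfolding standard_case_def by blast
    show "nonnegative_family P T (glued_P \<tau> c Pb)"
      unfolding nonnegative_family_def
      using Pb by (intro allI glued_P_ge terminal_ge_imp G) (simp add: nonnegative_family_def)
  next
    assume "singular_case_I P \<tau> T c" and Pb: "uniformly_positive_family P T Pb"
    then obtain \<delta> where \<delta>: "0 < \<delta>" and G: "AE \<omega> in P. \<delta> \<le> terminal \<tau> T c i \<omega>" for i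
      unfolding singular_case_I_def by blast
    obtain k where k: "0 < k" and Pbk: "AE \<omega> in P. \<forall>t\<in>{0..T}. k \<le> Pb i t \<omega>" for i
      using Pb unfolding uniformly_positive_family_def by blast
    show "uniformly_positive_family P T (glued_P \<tau> c Pb)"
      unfolding uniformly_positive_family_def
    \<comment> \<open>The bound k for Pb holds before \<tau>, the bound \<delta> on the terminal
      value from \<tau> on.\<close>
    proof (intro exI[of _ "min k \<delta>"] conjI allI glued_P_ge terminal_ge_imp)
      show "AE \<omega> in P. \<forall>t\<in>{0..T}. min k \<delta> \<le> Pb i t \<omega>" for i
        using Pbk[of i] by eventually_elim (auto intro: min.coboundedI1)
      show "AE \<omega> in P. min k \<delta> \<le> terminal \<tau> T c i \<omega>" for i
        using G[of i] by eventually_elim (auto intro: min.coboundedI2)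
    qed (use k \<delta> in simp)
  next
    assume "singular_case_II P \<tau> lam T c" and Pb: "nonnegative_family P T Pb"
    then obtain \<delta> where \<delta>: "0 < \<delta>" and G: "ae_time P T (\<lambda>t \<omega>. \<delta> \<le> cGa c i t \<omega>)"
      and G0: "AE \<omega> in P. \<tau> \<omega> = 0 \<longrightarrow> \<delta> \<le> cGa c i 0 \<omega>" for i
      unfolding singular_case_II_def by blast
    have G\<tau>: "AE \<omega> in P. \<tau> \<omega> \<le> ereal T \<longrightarrow> \<delta> \<le> cGa c i (real_of_ereal (\<tau> \<omega>)) \<omega>" for i
      by (rule cGa_ge_imp[OF T Ga G G0])
    show "positive_family P T (glued_P \<tau> c Pb) (glued_U \<tau> c Pb)"
      unfolding positive_family_def nonnegative_family_def
    \<comment> \<open>Here \<delta> bounds the sum of left limit and U. For the glued process itself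
      only the bound 0 is available before \<tau>, as Pb is merely nonnegative.\<close>
    proof (intro conjI allI exI[of _ \<delta>] \<delta> glued_P_ge left_limit_plus_glued_U_ge[OF T sol G G\<tau>])
      show "AE \<omega> in P. \<forall>t\<in>{0..T}. 0 \<le> Pb i t \<omega>" for i
        using Pb by (simp add: nonnegative_family_def)
      show "AE \<omega> in P. \<tau> \<omega> \<le> ereal T \<longrightarrow> 0 \<le> cGa c i (real_of_ereal (\<tau> \<omega>)) \<omega>" for i
        using G\<tau>[of i] by eventually_elim (use \<delta> in auto)
    qed
  qed
qed

end
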